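(* Let $n\ge 0$ and let $S\in\mathbb{Z}^{n\times n}$ be a symmetric, positive definite, even matrix. Put $S_0=\begin{pmatrix}0&0&1\\0&-S&0\\1&0&0\end{pmatrix}\in\mathbb{Z}^{(n+2)\times(n+2)}$ and $S_1=\begin{pmatrix}0&0&1\\0&S_0&0\\1&0&0\end{pmatrix}\in\mathbb{Z}^{(n+4)\times(n+4)}$. Assume that the lattice $L_1=\mathbb{Z}^{n+4}$ with Gram matrix $S_1$ is maximal even. Let $SO^+(S_1;\mathbb{R})$ be the identity component of $SO(S_1;\mathbb{R})=\{M\in SL(n+4;\mathbb{R}) : M^{tr}S_1M=S_1\}$, let $\Gamma_S=SO^+(S_1;\mathbb{R})\cap\mathbb{Z}^{(n+4)\times(n+4)}$, and let $\widetilde{\Gamma}_S=\{M\in\Gamma_S : M\in I+\mathbb{Z}^{(n+4)\times(n+4)}S_1\}$. Then $\Gamma_S$ is the uniquely determined maximal discrete extension of $\widetilde{\Gamma}_S$ in $SO^+(S_1;\mathbb{R})$; that is, $\Gamma_S$ is a discrete subgroup of $SO^+(S_1;\mathbb{R})$ containing $\widetilde{\Gamma}_S$, and every discrete subgroup $\Delta$ of $SO^+(S_1;\mathbb{R})$ with $\widetilde{\Gamma}_S\subseteq\Delta$ satisfies $\Delta\subseteq\Gamma_S$. Moreover, $\Gamma_S$ coincides with the normalizer of $\widetilde{\Gamma}_S$ in $SO^+(S_1;\mathbb{R})$.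
   Context: A matrix $S\in\mathbb{Z}^{n\times n}$ is even if it is symmetric with even diagonal entries. A lattice $\Lambda$ of rank $m$ in a $\mathbb{Q}$-vector space with a non-degenerate symmetric bilinear form $\langle\cdot,\cdot\rangle$ is even if $\langle\lambda,\lambda\rangle\in2\mathbb{Z}$ for all $\lambda\in\Lambda$; it is maximal even if it is even and there is no even lattice $\Lambda'$ in the same space with $\Lambda\subsetneq\Lambda'$. Here $L_1=\mathbb{Z}^{n+4}\subset\mathbb{Q}^{n+4}$ carries the form $\langle x,y\rangle=x^{tr}S_1y$. $I$ denotes the identity matrix. *)

theory Defs
  imports
    "HOL-Analysis.Function_Topology"
    "HOL-Algebra.Group_Action"
    "Jordan_Normal_Form.Determinant"
begin

section \<open>Even matrices and maximal even lattices\<close>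

definition even_mat :: "int mat \<Rightarrow> bool" where
  "even_mat S \<longleftrightarrow> S\<^sup>T = S \<and> (\<forall>i < dim_row S. even (S $$ (i, i)))"

definition pos_def_mat :: "nat \<Rightarrow> real mat \<Rightarrow> bool" where
  "pos_def_mat n A \<longleftrightarrow>
     (\<forall>x \<in> carrier_vec n. x \<noteq> 0\<^sub>v n \<longrightarrow> 0 < x \<bullet> (A *\<^sub>v x))"

text \<open>
  The columns of \<open>B\<close> are a basis of \<open>\<rat>\<^sup>m\<close>, and the lattice is their integral span.
\<close>

definition is_lattice :: "nat \<Rightarrow> rat vec set \<Rightarrow> bool" where
  "is_lattice m L \<longleftrightarrow>
     (\<exists>B \<in> carrier_mat m m. invertible_mat B \<and>
        L = {B *\<^sub>v map_vec rat_of_int v | v. v \<in> carrier_vec m})"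

text \<open>
  Here \<open>Q\<close> is the Gram matrix of the form on the ambient space \<open>\<rat>\<^sup>m\<close>.
\<close>

definition even_lattice :: "nat \<Rightarrow> rat mat \<Rightarrow> rat vec set \<Rightarrow> bool" where
  "even_lattice m Q L \<longleftrightarrow>
     is_lattice m L \<and> (\<forall>x \<in> L. \<exists>k::int. x \<bullet> (Q *\<^sub>v x) = rat_of_int (2 * k))"

definition maximal_even_lattice :: "nat \<Rightarrow> rat mat \<Rightarrow> rat vec set \<Rightarrow> bool" where
  "maximal_even_lattice m Q L \<longleftrightarrow>
     even_lattice m Q L \<and> \<not> (\<exists>L'. even_lattice m Q L' \<and> L \<subset> L')"

definition int_lattice :: "nat \<Rightarrow> rat vec set" where
  "int_lattice m = {map_vec rat_of_int v | v. v \<in> carrier_vec m}"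


section \<open>The Gram matrices\<close>

text \<open>
  For \<open>A\<close> of size \<open>k \<times> k\<close> this is the block matrix with rows
  \<open>(0, 0, 1)\<close>, \<open>(0, A, 0)\<close>, \<open>(1, 0, 0)\<close>, of size \<open>(k + 2) \<times> (k + 2)\<close>.
\<close>

definition hyp_ext :: "int mat \<Rightarrow> int mat" where
  "hyp_ext A = (let k = dim_row A in
     mat (k + 2) (k + 2) (\<lambda>(i, j).
       if (i = 0 \<and> j = k + 1) \<or> (i = k + 1 \<and> j = 0) then 1
       else if 1 \<le> i \<and> i \<le> k \<and> 1 \<le> j \<and> j \<le> k then A $$ (i - 1, j - 1)
       else 0))"

definition S0 :: "int mat \<Rightarrow> int mat" where
  "S0 S = hyp_ext (- S)"

definition S1 :: "int mat \<Rightarrow> int mat" where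
  "S1 S = hyp_ext (S0 S)"


section \<open>The orthogonal groups\<close>

text \<open>
  The usual topology of \<open>\<real>\<^bsup>m \<times> m\<^esup>\<close>, transported along the matrix entries.
\<close>

definition mat_topology :: "nat \<Rightarrow> real mat topology" where
  "mat_topology m =
     pullback_topology (carrier_mat m m)
       (\<lambda>M. \<lambda>ij \<in> {..<m} \<times> {..<m}. M $$ ij)
       (product_topology (\<lambda>_. euclideanreal) ({..<m} \<times> {..<m}))"

definition SO :: "nat \<Rightarrow> real mat \<Rightarrow> real mat set" where
  "SO m Q = {M \<in> carrier_mat m m. det M = 1 \<and> M\<^sup>T * Q * M = Q}"

definition SO_plus :: "nat \<Rightarrow> real mat \<Rightarrow> real mat set" where
  "SO_plus m Q = connected_component_of_set (subtopology (mat_topology m) (SO m Q)) (1\<^sub>m m)"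

definition SO_plus_group :: "nat \<Rightarrow> real mat \<Rightarrow> real mat monoid" where
  "SO_plus_group m Q = \<lparr>carrier = SO_plus m Q, monoid.mult = (*), one = 1\<^sub>m m\<rparr>"

definition discrete_subgroup :: "nat \<Rightarrow> real mat monoid \<Rightarrow> real mat set \<Rightarrow> bool" where
  "discrete_subgroup m G D \<longleftrightarrow>
     subgroup D G \<and> subtopology (mat_topology m) D = discrete_topology D"

abbreviation G_S :: "nat \<Rightarrow> int mat \<Rightarrow> real mat monoid" where
  "G_S n S \<equiv> SO_plus_group (n + 4) (map_mat real_of_int (S1 S))"

definition Gamma_S :: "nat \<Rightarrow> int mat \<Rightarrow> real mat set" where
  "Gamma_S n S = carrier (G_S n S) \<inter> {map_mat real_of_int A | A. A \<in> carrier_mat (n + 4) (n + 4)}"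

definition tilde_Gamma_S :: "nat \<Rightarrow> int mat \<Rightarrow> real mat set" where
  "tilde_Gamma_S n S =
     {M \<in> Gamma_S n S. \<exists>A \<in> carrier_mat (n + 4) (n + 4).
        M = map_mat real_of_int (1\<^sub>m (n + 4) + A * S1 S)}"

end

theory Submission
  imports "HOL-Analysis.Kronecker_Approximation_Theorem" Defs
begin

text \<open>
  Let \<open>e1, f1, e2, f2\<close> be the standard basis vectors of the two hyperbolic planes.  All integral Eichler
  transformations \<open>E e u\<close> (with \<open>e\<close> isotropic and \<open>u\<close> orthogonal to \<open>e\<close>) lie in the discriminant kernel \<open>T\<close>,
  and since the lattice is maximal even, every integral isotropic vector is an integral multiple of a vector
  \<open>t e1\<close> with \<open>t \<in> T\<close>.

  Let \<open>D\<close> be discrete and let \<open>H \<supseteq> T\<close> be a group with \<open>h T h\<^sup>-\<^sup>1 \<subseteq> D\<close> for \<open>h \<in> H\<close>; this covers both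
  \<open>H = D = \<Delta>\<close> and the normalizer \<open>H\<close> of \<open>T\<close> with \<open>D = \<Gamma>\<^sub>S\<close>.  Shimizu's lemma shows that the pairing of an integral
  isotropic bivector with the image under \<open>h\<close> of another one is 0 or has absolute value at least 1.  Testing
  this against explicit families of integral isotropic bivectors, Dirichlet's approximation theorem forces the
  image bivectors, viewed as skew endomorphisms, to map integral isotropic vectors to real multiples of integral
  vectors.  Hence \<open>h e1 = a t e1\<close> for some real \<open>a\<close> and \<open>t \<in> T\<close>.  Discreteness of the unipotent radical of the
  stabilizer of \<open>e1\<close> gives \<open>a = \<plusminus>1\<close>, so \<open>h\<close> maps isotropic lattice vectors, and therefore all lattice vectors, to
  lattice vectors.
\<close>

text \<open>Nothing relates \<Delta> to the integral matrices in advance: its entries may be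
  transcendental. An element of the normalizer is not even known to lie in a discrete group, which
  is why the group \<open>H\<close> to be shown integral is kept apart from the discrete group
  \<open>D\<close>. The rigidity comes from Shimizu's iteration: with the given pairing
  \<open>c\<close> as first value, each further step turns the current value \<open>d\<close> into
  \<open>-d^2\<close>. A nonzero \<open>c\<close> with absolute value below 1 is thus driven to 0
  without vanishing, against discreteness; this is the origin of the bound 1. The iteration sees
  bivectors only, because for isotropic \<open>u\<close> the matrix \<open>E e u\<close> depends
  only on the bivector of \<open>e\<close> and \<open>u\<close>. A single vector is isolated by
  composing two bivectors that share it. This is where the second hyperbolic plane enters:
  \<open>e2\<close> and \<open>f2\<close> are both isotropic and orthogonal to \<open>e1\<close>,
  but not to each other. Since the images of vectors under these bivectors are controlled only up to
  real factors, only the line of the image of \<open>e1\<close> is found, and its scale needs a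
  separate argument.\<close>

unbundle no vec_syntax and no inner_syntax

section \<open>The quadratic space\<close>

lemma sum_four_split:
  fixes f :: "nat \<Rightarrow> 'a::comm_monoid_add"
  shows "(\<Sum>i\<in>{0..<n+4}. f i) = f 0 + f 1 + (\<Sum>i<n. f (i+2)) + f (n+2) + f (n+3)"
proof -
  have "(\<Sum>i\<in>{0..<n+4}. f i) = (\<Sum>i\<in>{0..<n+2}. f i) + f (n+2) + f (n+3)"
    by (simp add: numeral_eq_Suc add.assoc)
  also have "(\<Sum>i\<in>{0..<n+2}. f i) = f 0 + (f 1 + (\<Sum>i\<in>{0..<n}. f (i+2)))"
    by (simp add: numeral_eq_Suc sum.atLeast0_lessThan_Suc_shift del: sum.op_ivl_Suc)
  finally show ?thesis by (simp add: atLeast0LessThan add.assoc)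
qed

lemma index_four_cases:
  assumes "(i::nat) < n + 4"
  obtains "i = 0" | "i = 1" | k where "k < n" "i = k + 2" | "i = n + 2" | "i = n + 3"
proof -
  have "i = 0 \<or> i = 1 \<or> (i - 2 < n \<and> i = (i - 2) + 2) \<or> i = n + 2 \<or> i = n + 3"
    using assms by arith
  then show ?thesis using that by blast
qed

lemma mat_eq_if_mult_vec_eq:
  fixes A :: "'a::comm_ring_1 mat"
  assumes A: "A \<in> carrier_mat m k" "B \<in> carrier_mat m k"
    and eq: "\<And>x. x \<in> carrier_vec k \<Longrightarrow> A *\<^sub>v x = B *\<^sub>v x"
  shows "A = B"
proof (rule eq_matI)
  fix i j assume ij: "i < dim_row B" "j < dim_col B"
  have "(A *\<^sub>v unit_vec k j) $ i = (B *\<^sub>v unit_vec k j) $ i" by (simp add: eq)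
  then show "A $$ (i, j) = B $$ (i, j)" using A ij by (simp add: mult_mat_vec_def)
qed (use A in auto)

locale split_lattice =
  fixes n :: nat and S :: "int mat"
  assumes S_carrier: "S \<in> carrier_mat n n"
    and S_even: "even_mat S"
    and S_pos: "pos_def_mat n (map_mat real_of_int S)"
begin

abbreviation "V \<equiv> carrier_vec (n + 4) :: real vec set"
abbreviation "M \<equiv> carrier_mat (n + 4) (n + 4) :: real mat set"
abbreviation "Q \<equiv> map_mat real_of_int (S1 S)"

text \<open>The arguments are coordinate functions, so that the middle block of a vector is inserted
  by shifting the index by 2. Only the values below \<open>n\<close> matter.\<close>

definition sf :: "(nat \<Rightarrow> real) \<Rightarrow> (nat \<Rightarrow> real) \<Rightarrow> real" where
  "sf u v = (\<Sum>i<n. \<Sum>j<n. u i * real_of_int (S $$ (i, j)) * v j)"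

text \<open>The coordinates belong, in this order, to \<open>e1\<close>, \<open>e2\<close>, the
  middle block, \<open>f2\<close>, \<open>f1\<close>. Pairing with one of these four vectors reads
  off a single coordinate; \<open>bl_mat\<close> gives the link with the Gram matrix.\<close>

definition bl :: "real vec \<Rightarrow> real vec \<Rightarrow> real" where
  "bl x y = x $ 0 * y $ (n+3) + x $ (n+3) * y $ 0 + x $ 1 * y $ (n+2) + x $ (n+2) * y $ 1
     - sf (\<lambda>i. x $ (i+2)) (\<lambda>i. y $ (i+2))"

lemma S_sym: "i < n \<Longrightarrow> j < n \<Longrightarrow> S $$ (i, j) = S $$ (j, i)"
  using S_even S_carrier unfolding even_mat_def by (metis carrier_matD index_transpose_mat(1))

lemma S_diag_even: "i < n \<Longrightarrow> even (S $$ (i, i))"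
  using S_even S_carrier unfolding even_mat_def by auto

lemma sf_commute: "sf u v = sf v u"
proof -
  have "sf u v = (\<Sum>j<n. \<Sum>i<n. u i * real_of_int (S $$ (i, j)) * v j)"
    unfolding sf_def by (rule sum.swap)
  also have "\<dots> = sf v u"
    unfolding sf_def by (intro sum.cong refl) (simp add: S_sym mult.commute mult.left_commute)
  finally show ?thesis .
qed

lemma sf_add_left: "sf (\<lambda>i. u i + u' i) v = sf u v + sf u' v"
  unfolding sf_def by (simp add: algebra_simps sum.distrib)

lemma sf_scale_left: "sf (\<lambda>i. a * u i) v = a * sf u v"
  unfolding sf_def by (simp add: sum_distrib_left mult.assoc)

lemma sf_add_right: "sf v (\<lambda>i. u i + u' i) = sf v u + sf v u'"
  by (metis sf_add_left sf_commute)

lemma sf_scale_right: "sf v (\<lambda>i. a * u i) = a * sf v u"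
  by (metis sf_scale_left sf_commute)

lemma sf_cong: "(\<And>i. i < n \<Longrightarrow> u i = u' i) \<Longrightarrow> (\<And>i. i < n \<Longrightarrow> v i = v' i) \<Longrightarrow> sf u v = sf u' v'"
  unfolding sf_def by (intro sum.cong) auto

lemma sf_zero [simp]: "sf (\<lambda>i. 0) v = 0" "sf u (\<lambda>i. 0) = 0"
  by (simp_all add: sf_def)

lemma sf_pos:
  assumes "i < n" "u i \<noteq> 0"
  shows "sf u u > 0"
proof -
  let ?x = "vec n u"
  have "?x \<noteq> 0\<^sub>v n" using assms by (metis index_vec index_zero_vec(1))
  then have "0 < ?x \<bullet> (map_mat real_of_int S *\<^sub>v ?x)"
    using S_pos unfolding pos_def_mat_def by simp
  also have "?x \<bullet> (map_mat real_of_int S *\<^sub>v ?x) = sf u u"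
  proof -
    have "(map_mat real_of_int S *\<^sub>v ?x) $ i = (\<Sum>j<n. real_of_int (S $$ (i, j)) * u j)" if "i < n" for i
      using that S_carrier by (simp add: scalar_prod_def atLeast0LessThan)
    then show ?thesis using S_carrier
      by (simp add: sf_def scalar_prod_def sum_distrib_left mult.assoc atLeast0LessThan)
  qed
  finally show ?thesis .
qed

lemma sf_nonneg: "sf u u \<ge> 0"
proof (cases "\<exists>i<n. u i \<noteq> 0")
  case True then show ?thesis using sf_pos by (meson less_imp_le)
next
  case False
  then have "sf u u = sf (\<lambda>i. 0) (\<lambda>i. 0)" by (intro sf_cong) auto
  then show ?thesis by simp
qed

lemma sf_eq_0: "sf u u = 0 \<Longrightarrow> i < n \<Longrightarrow> u i = 0"
  using sf_pos by fastforce

lemma sf_int: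
  assumes "\<And>i. i < n \<Longrightarrow> u i \<in> \<int>" "\<And>i. i < n \<Longrightarrow> v i \<in> \<int>"
  shows "sf u v \<in> \<int>"
  unfolding sf_def using assms by (intro Ints_sum Ints_mult) auto

text \<open>Off-diagonal terms occur twice by symmetry, and the diagonal entries of \<open>S\<close>
  are even. The induction enlarges the leading square block by one row and one column, which
  contribute equally.\<close>

lemma sf_even:
  assumes "\<And>i. i < n \<Longrightarrow> u i \<in> \<int>"
  shows "sf u u / 2 \<in> \<int>"
proof -
  let ?f = "\<lambda>i j. u i * real_of_int (S $$ (i, j)) * u j"
  have "(\<Sum>i<k. \<Sum>j<k. ?f i j) / 2 \<in> \<int>" if "k \<le> n" for k
    using that
  proof (induction k)
    case (Suc k)
    have "(\<Sum>i<Suc k. \<Sum>j<Suc k. ?f i j) =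
        (\<Sum>i<k. \<Sum>j<k. ?f i j) + (\<Sum>i<k. ?f i k) + (\<Sum>j<k. ?f k j) + ?f k k"
      by (simp add: sum.distrib)
    also have "(\<Sum>j<k. ?f k j) = (\<Sum>i<k. ?f i k)"
      using Suc.prems by (intro sum.cong) (auto simp: S_sym)
    finally have eq: "(\<Sum>i<Suc k. \<Sum>j<Suc k. ?f i j) / 2 =
        (\<Sum>i<k. \<Sum>j<k. ?f i j) / 2 + (\<Sum>i<k. ?f i k) + ?f k k / 2" by simp
    obtain c where c: "S $$ (k, k) = 2 * c" using S_diag_even[of k] Suc.prems by auto
    have 1: "?f k k / 2 = u k * real_of_int c * u k" by (simp add: c)
    have uk: "u i \<in> \<int>" if "i \<le> k" for i using assms Suc.prems that by auto
    have "?f k k / 2 \<in> \<int>" unfolding 1 using uk by (intro Ints_mult) auto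
    moreover have "(\<Sum>i<k. ?f i k) \<in> \<int>" using uk by (intro Ints_sum Ints_mult) auto
    ultimately show ?case unfolding eq using Suc by (intro Ints_add) auto
  qed simp
  from this[of n] show ?thesis by (simp add: sf_def)
qed

lemma dim_S1: "S1 S \<in> carrier_mat (n+4) (n+4)"
  using S_carrier by (simp add: S1_def S0_def hyp_ext_def Let_def numeral_eq_Suc)

lemma bl_mat:
  assumes x: "x \<in> V" and y: "y \<in> V"
  shows "x \<bullet> (Q *\<^sub>v y) = bl x y"
proof -
  have d: "dim_row S = n" "dim_col S = n" using S_carrier by auto
  have q: "S1 S $$ (i, j) = (if (i = 0 \<and> j = n+3) \<or> (i = n+3 \<and> j = 0) \<or> (i = 1 \<and> j = n+2) \<or> (i = n+2 \<and> j = 1)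
     then 1 else if 2 \<le> i \<and> i < n+2 \<and> 2 \<le> j \<and> j < n+2 then - S $$ (i-2, j-2) else 0)"
    if "i < n+4" "j < n+4" for i j
    using that d by (auto simp: S1_def S0_def hyp_ext_def Let_def numeral_eq_Suc)
  have r: "(Q *\<^sub>v y) $ i = (\<Sum>j\<in>{0..<n+4}. real_of_int (S1 S $$ (i, j)) * y $ j)" if "i < n + 4" for i
    using that dim_S1 y by (simp add: scalar_prod_def row_def)
  have r0: "(Q *\<^sub>v y) $ 0 = y $ (n+3)"
    by (subst r, simp, subst sum_four_split, simp add: q)
  have r1: "(Q *\<^sub>v y) $ 1 = y $ (n+2)"
    by (subst r, simp, subst sum_four_split, simp add: q)
  have r2: "(Q *\<^sub>v y) $ (n+2) = y $ 1"
    by (subst r, simp, subst sum_four_split, simp add: q)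
  have r3: "(Q *\<^sub>v y) $ (n+3) = y $ 0"
    by (subst r, simp, subst sum_four_split, simp add: q)
  have rk: "(Q *\<^sub>v y) $ (k+2) = - (\<Sum>j<n. real_of_int (S $$ (k, j)) * y $ (j+2))" if "k < n" for k
    using that
    by (subst r, simp, subst sum_four_split, simp add: q sum_negf)
  have "dim_vec (Q *\<^sub>v y) = n + 4" using dim_S1 by simp
  then have "x \<bullet> (Q *\<^sub>v y) = (\<Sum>i\<in>{0..<n+4}. x $ i * (Q *\<^sub>v y) $ i)"
    by (simp add: scalar_prod_def)
  also have "\<dots> = x $ 0 * y $ (n+3) + x $ 1 * y $ (n+2) +
      (\<Sum>i<n. x $ (i+2) * - (\<Sum>j<n. real_of_int (S $$ (i, j)) * y $ (j+2)))
      + x $ (n+2) * y $ 1 + x $ (n+3) * y $ 0"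
  proof -
    have "(\<Sum>i<n. x $ (i+2) * (Q *\<^sub>v y) $ (i+2)) =
        (\<Sum>i<n. x $ (i+2) * - (\<Sum>j<n. real_of_int (S $$ (i, j)) * y $ (j+2)))"
      by (rule sum.cong[OF refl]) (simp only: rk lessThan_iff)
    then show ?thesis by (subst sum_four_split) (simp only: r0 r1 r2 r3)
  qed
  also have "(\<Sum>i<n. x $ (i+2) * - (\<Sum>j<n. real_of_int (S $$ (i, j)) * y $ (j+2))) =
     - sf (\<lambda>i. x $ (i+2)) (\<lambda>i. y $ (i+2))"
    by (simp add: sf_def sum_negf sum_distrib_left mult.assoc)
  finally show ?thesis by (simp add: bl_def)
qed

lemma bl_commute: "bl x y = bl y x"
  unfolding bl_def by (subst sf_commute) simp

lemma bl_add_left: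
  assumes "x \<in> V" "x' \<in> V"
  shows "bl (x + x') y = bl x y + bl x' y"
proof -
  have "sf (\<lambda>i. (x + x') $ (i+2)) v = sf (\<lambda>i. x $ (i+2) + x' $ (i+2)) v" for v
    using assms by (intro sf_cong) auto
  then show ?thesis using assms by (simp add: bl_def sf_add_left algebra_simps)
qed

lemma bl_smult_left:
  assumes "x \<in> V"
  shows "bl (a \<cdot>\<^sub>v x) y = a * bl x y"
proof -
  have "sf (\<lambda>i. (a \<cdot>\<^sub>v x) $ (i+2)) v = sf (\<lambda>i. a * x $ (i+2)) v" for v
    using assms by (intro sf_cong) auto
  then show ?thesis using assms by (simp add: bl_def sf_scale_left algebra_simps)
qed

lemma bl_add_right: "x \<in> V \<Longrightarrow> x' \<in> V \<Longrightarrow> bl y (x + x') = bl y x + bl y x'"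
  by (metis bl_add_left bl_commute)

lemma bl_smult_right: "x \<in> V \<Longrightarrow> bl y (a \<cdot>\<^sub>v x) = a * bl y x"
  by (metis bl_smult_left bl_commute)

lemmas bl_lin = bl_add_left bl_smult_left bl_add_right bl_smult_right

lemma bl_zero [simp]: "bl (0\<^sub>v (n + 4)) y = 0" "bl y (0\<^sub>v (n + 4)) = 0"
proof -
  have "0 \<cdot>\<^sub>v 0\<^sub>v (n + 4) = (0\<^sub>v (n + 4) :: real vec)" by auto
  then show "bl (0\<^sub>v (n + 4)) y = 0" "bl y (0\<^sub>v (n + 4)) = 0"
    using bl_smult_left[of "0\<^sub>v (n + 4)" 0 y] by (simp_all add: bl_commute)
qed

section \<open>The two hyperbolic planes and the Eichler transformations\<close>

definition e1 :: "real vec" where "e1 = unit_vec (n + 4) 0"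
definition e2 :: "real vec" where "e2 = unit_vec (n + 4) 1"
definition f2 :: "real vec" where "f2 = unit_vec (n + 4) (n + 2)"
definition f1 :: "real vec" where "f1 = unit_vec (n + 4) (n + 3)"

lemmas basis_defs = e1_def f1_def e2_def f2_def

lemma basis_carrier [simp]: "e1 \<in> V" "f1 \<in> V" "e2 \<in> V" "f2 \<in> V"
  by (simp_all add: basis_defs)

lemma bl_unit_left:
  assumes "x \<in> V"
  shows "bl e1 x = x $ (n+3)" "bl f1 x = x $ 0" "bl e2 x = x $ (n+2)" "bl f2 x = x $ 1"
proof -
  have "sf (\<lambda>i. unit_vec (n + 4) k $ (i+2)) v = 0" if "k < 2 \<or> n + 2 \<le> k \<and> k < n + 4" for v k
  proof -
    have "sf (\<lambda>i. unit_vec (n + 4) k $ (i+2)) v = sf (\<lambda>i. 0) v"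
      by (rule sf_cong) (use that in auto)
    then show ?thesis by simp
  qed
  then have "sf (\<lambda>i. e1 $ (i+2)) v = 0" "sf (\<lambda>i. f1 $ (i+2)) v = 0"
    "sf (\<lambda>i. e2 $ (i+2)) v = 0" "sf (\<lambda>i. f2 $ (i+2)) v = 0" for v
    by (simp_all add: basis_defs)
  then show "bl e1 x = x $ (n+3)" "bl f1 x = x $ 0" "bl e2 x = x $ (n+2)" "bl f2 x = x $ 1"
    by (simp_all add: bl_def) (simp_all add: basis_defs)
qed

lemma bl_unit_right:
  assumes "x \<in> V"
  shows "bl x e1 = x $ (n+3)" "bl x f1 = x $ 0" "bl x e2 = x $ (n+2)" "bl x f2 = x $ 1"
  using bl_unit_left[OF assms] by (simp_all add: bl_commute)

definition qf :: "real vec \<Rightarrow> real" where "qf x = bl x x / 2"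

lemma qf_add:
  assumes "x \<in> V" "y \<in> V"
  shows "qf (x + y) = qf x + bl x y + qf y"
  using assms by (simp add: qf_def bl_lin bl_commute[of y x] field_simps)

lemma qf_smult: "x \<in> V \<Longrightarrow> qf (a \<cdot>\<^sub>v x) = a\<^sup>2 * qf x"
  by (simp add: qf_def bl_lin power2_eq_square)

lemmas qf_lin = qf_add qf_smult

text \<open>Eichler transformations; they are isometries when \<open>e\<close> is isotropic and orthogonal to \<open>u\<close>.\<close>

definition E :: "real vec \<Rightarrow> real vec \<Rightarrow> real mat" where
  "E e u = mat (n + 4) (n + 4) (\<lambda>(i, j). (if i = j then 1 else 0) + bl e (unit_vec (n + 4) j) * u $ i
     - (bl u (unit_vec (n + 4) j) + qf u * bl e (unit_vec (n + 4) j)) * e $ i)"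

lemma E_carrier [simp]: "E e u \<in> M" by (simp add: E_def)

lemma bl_unit_sum:
  assumes "x \<in> V" "j < n + 4"
  shows "bl x (unit_vec (n + 4) j) = (\<Sum>k\<in>{0..<n+4}. x $ k * Q $$ (k, j))"
proof -
  have "(Q *\<^sub>v unit_vec (n + 4) j) $ i = Q $$ (i, j)" if "i < n + 4" for i
    using that assms dim_S1 by simp
  then show ?thesis using dim_S1 assms by (simp add: bl_mat[symmetric] scalar_prod_def)
qed

lemma bl_expand:
  assumes x: "x \<in> V" and y: "y \<in> V"
  shows "bl x y = (\<Sum>j\<in>{0..<n+4}. bl x (unit_vec (n + 4) j) * y $ j)"
proof -
  have "bl x y = (\<Sum>i\<in>{0..<n+4}. x $ i * (\<Sum>j\<in>{0..<n+4}. Q $$ (i, j) * y $ j))"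
    using dim_S1 x y by (subst bl_mat[symmetric]) (simp_all add: scalar_prod_def)
  also have "\<dots> = (\<Sum>i\<in>{0..<n+4}. \<Sum>j\<in>{0..<n+4}. x $ i * Q $$ (i, j) * y $ j)"
    by (simp add: sum_distrib_left mult.assoc)
  also have "\<dots> = (\<Sum>j\<in>{0..<n+4}. \<Sum>i\<in>{0..<n+4}. x $ i * Q $$ (i, j) * y $ j)"
    by (rule sum.swap)
  also have "\<dots> = (\<Sum>j\<in>{0..<n+4}. bl x (unit_vec (n + 4) j) * y $ j)"
    by (intro sum.cong refl) (simp add: bl_unit_sum[OF x] sum_distrib_right)
  finally show ?thesis .
qed

lemma E_mult_vec:
  assumes "e \<in> V" "u \<in> V" "x \<in> V"
  shows "E e u *\<^sub>v x = x + (bl e x \<cdot>\<^sub>v u + (- (bl u x + qf u * bl e x)) \<cdot>\<^sub>v e)"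
proof (rule eq_vecI)
  fix i assume "i < dim_vec (x + (bl e x \<cdot>\<^sub>v u + (- (bl u x + qf u * bl e x)) \<cdot>\<^sub>v e))"
  then have i: "i < n + 4" using assms by simp
  let ?u = "\<lambda>j. unit_vec (n + 4) j :: real vec"
  have "(E e u *\<^sub>v x) $ i = (\<Sum>j\<in>{0..<n+4}. ((if i = j then 1 else 0) + bl e (?u j) * u $ i
     - (bl u (?u j) + qf u * bl e (?u j)) * e $ i) * x $ j)"
    using assms i by (simp add: E_def scalar_prod_def)
  also have "\<dots> = (\<Sum>j\<in>{0..<n+4}. (if i = j then x $ j else 0) + u $ i * (bl e (?u j) * x $ j)
     - e $ i * (bl u (?u j) * x $ j) - e $ i * qf u * (bl e (?u j) * x $ j))"
    by (intro sum.cong refl) (simp add: algebra_simps)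
  also have "\<dots> = x $ i + u $ i * bl e x - e $ i * bl u x - e $ i * qf u * bl e x"
    using i by (simp only: bl_expand[OF assms(1,3)] bl_expand[OF assms(2,3)] sum.distrib sum_subtractf sum_distrib_left) simp
  finally show "(E e u *\<^sub>v x) $ i = (x + (bl e x \<cdot>\<^sub>v u + (- (bl u x + qf u * bl e x)) \<cdot>\<^sub>v e)) $ i"
    using assms i by (simp add: algebra_simps)
qed (use assms in \<open>auto simp: E_def\<close>)

end

section \<open>Eichler transformations and transitivity on isotropic vectors\<close>

context split_lattice
begin

lemma basis_dim [simp]:
  "dim_vec e1 = n + 4" "dim_vec f1 = n + 4" "dim_vec e2 = n + 4" "dim_vec f2 = n + 4"
  by (simp_all add: basis_defs)

lemma bl_basis [simp]:
  "bl e1 e1 = 0" "bl e1 f1 = 1" "bl e1 e2 = 0" "bl e1 f2 = 0"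
  "bl f1 e1 = 1" "bl f1 f1 = 0" "bl f1 e2 = 0" "bl f1 f2 = 0"
  "bl e2 e1 = 0" "bl e2 f1 = 0" "bl e2 e2 = 0" "bl e2 f2 = 1"
  "bl f2 e1 = 0" "bl f2 f1 = 0" "bl f2 e2 = 1" "bl f2 f2 = 0"
  by (simp_all only: bl_unit_left basis_carrier) (simp_all add: basis_defs)

lemma qf_basis [simp]: "qf e1 = 0" "qf f1 = 0" "qf e2 = 0" "qf f2 = 0"
  by (simp_all add: qf_def)

lemma E_vec_carrier [simp]: "x \<in> V \<Longrightarrow> E e u *\<^sub>v x \<in> V"
  using mult_mat_vec_carrier[OF E_carrier] .

lemma bl_E:
  assumes "e \<in> V" "u \<in> V" "x \<in> V"
  shows "bl w (E e u *\<^sub>v x) = bl w x + bl e x * bl w u - (bl u x + qf u * bl e x) * bl w e"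
  using assms by (simp add: E_mult_vec bl_lin algebra_simps)

lemma mult_M [simp]: "A \<in> M \<Longrightarrow> B \<in> M \<Longrightarrow> A * B \<in> M"
  by (rule mult_carrier_mat)

section \<open>Isometries and the calculus of Eichler transformations\<close>

definition isom :: "real mat \<Rightarrow> bool" where
  "isom g \<longleftrightarrow> g \<in> M \<and> (\<forall>x\<in>V. \<forall>y\<in>V. bl (g *\<^sub>v x) (g *\<^sub>v y) = bl x y)"

lemma isom_carrier: "isom g \<Longrightarrow> g \<in> M"
  by (simp add: isom_def)

lemma isom_bl: "isom g \<Longrightarrow> x \<in> V \<Longrightarrow> y \<in> V \<Longrightarrow> bl (g *\<^sub>v x) (g *\<^sub>v y) = bl x y"
  by (simp add: isom_def)

lemma isom_qf: "isom g \<Longrightarrow> x \<in> V \<Longrightarrow> qf (g *\<^sub>v x) = qf x"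
  by (simp add: qf_def isom_bl)

lemma isom_vec [simp]: "isom g \<Longrightarrow> x \<in> V \<Longrightarrow> g *\<^sub>v x \<in> V"
  using isom_carrier by (metis mult_mat_vec_carrier)

lemma E_isom:
  assumes "e \<in> V" "u \<in> V" "bl e e = 0" "bl e u = 0"
  shows "isom (E e u)"
  unfolding isom_def
proof (intro conjI ballI)
  fix x y assume xy: "x \<in> V" "y \<in> V"
  have c: "bl u e = 0" "bl x e = bl e x" "bl x u = bl u x" "bl u u = 2 * qf u"
    using assms by (simp_all add: bl_commute qf_def)
  show "bl (E e u *\<^sub>v x) (E e u *\<^sub>v y) = bl x y"
    using assms xy by (simp add: E_mult_vec bl_lin c algebra_simps)
qed simp

lemma mult_mat_smult_vec:
  assumes "A \<in> M" "v \<in> V"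
  shows "A *\<^sub>v (a \<cdot>\<^sub>v v) = a \<cdot>\<^sub>v (A *\<^sub>v v)"
  using mult_mat_vec[OF assms] .

lemma mult_mat_vec_comb:
  assumes "A \<in> M" "x \<in> V" "y \<in> V" "z \<in> V"
  shows "A *\<^sub>v (x + (a \<cdot>\<^sub>v y + b \<cdot>\<^sub>v z)) = A *\<^sub>v x + (a \<cdot>\<^sub>v (A *\<^sub>v y) + b \<cdot>\<^sub>v (A *\<^sub>v z))"
proof -
  have "A *\<^sub>v (x + (a \<cdot>\<^sub>v y + b \<cdot>\<^sub>v z)) = A *\<^sub>v x + A *\<^sub>v (a \<cdot>\<^sub>v y + b \<cdot>\<^sub>v z)"
    by (rule mult_add_distrib_mat_vec[OF assms(1,2)]) (use assms in auto)
  also have "A *\<^sub>v (a \<cdot>\<^sub>v y + b \<cdot>\<^sub>v z) = A *\<^sub>v (a \<cdot>\<^sub>v y) + A *\<^sub>v (b \<cdot>\<^sub>v z)"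
    by (rule mult_add_distrib_mat_vec[OF assms(1)]) (use assms in auto)
  finally show ?thesis using assms by (simp add: mult_mat_smult_vec)
qed

lemma inverse_vec:
  assumes "A \<in> M" "B \<in> M" "A * B = 1\<^sub>m (n + 4)" "x \<in> V"
  shows "A *\<^sub>v (B *\<^sub>v x) = x"
  using assms by (metis assoc_mult_mat_vec one_mult_mat_vec)

text \<open>The formula in \<open>E_mult_vec\<close> is built from the form, \<open>e\<close> and
  \<open>u\<close> alone, so an isometry transports it by acting on \<open>e\<close> and
  \<open>u\<close>.\<close>

lemma E_conj:
  assumes g: "isom g" "h \<in> M" "g * h = 1\<^sub>m (n + 4)" and eu: "e \<in> V" "u \<in> V"
  shows "g * E e u * h = E (g *\<^sub>v e) (g *\<^sub>v u)"
proof (rule mat_eq_if_mult_vec_eq[where m="n+4" and k="n+4"])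
  fix x :: "real vec" assume x: "x \<in> V"
  define y where "y = h *\<^sub>v x"
  have y: "y \<in> V" "x = g *\<^sub>v y"
    using x g inverse_vec[OF isom_carrier[OF g(1)] g(2,3) x] unfolding y_def
    by (auto intro: mult_mat_vec_carrier)
  have gM: "g \<in> M" using g isom_carrier by auto
  have "(g * E e u * h) *\<^sub>v x = (g * E e u) *\<^sub>v y"
    using g gM x unfolding y_def by (intro assoc_mult_mat_vec[where n\<^sub>2="n+4" and n\<^sub>1="n+4" and n\<^sub>3="n+4"]) (auto intro: mult_carrier_mat)
  also have "\<dots> = g *\<^sub>v (E e u *\<^sub>v y)"
    by (rule assoc_mult_mat_vec[OF gM E_carrier y(1)])
  also have "\<dots> = E (g *\<^sub>v e) (g *\<^sub>v u) *\<^sub>v x"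
    using eu g y by (simp add: E_mult_vec mult_mat_vec_comb gM isom_bl isom_qf)
  finally show "(g * E e u * h) *\<^sub>v x = E (g *\<^sub>v e) (g *\<^sub>v u) *\<^sub>v x" .
qed (use g isom_carrier in auto)

text \<open>The cross term \<open>bl u v\<close> in \<open>qf (u + v)\<close> is exactly what
  composing the two maps produces. Thus the orthogonal complement of \<open>e\<close> parametrizes
  an abelian group, the unipotent radical of the stabilizer of \<open>e\<close>.\<close>

lemma E_add:
  assumes "e \<in> V" "u \<in> V" "v \<in> V" "bl e e = 0" "bl e u = 0" "bl e v = 0"
  shows "E e u * E e v = E e (u + v)"
proof (rule mat_eq_if_mult_vec_eq[where m="n+4" and k="n+4"])
  fix x :: "real vec" assume x: "x \<in> V"
  have c: "bl u e = 0" using assms by (simp add: bl_commute)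
  have "(E e u * E e v) *\<^sub>v x = E e u *\<^sub>v (E e v *\<^sub>v x)"
    by (rule assoc_mult_mat_vec[OF E_carrier E_carrier x])
  also have "\<dots> = E e (u + v) *\<^sub>v x"
    using assms x by (intro eq_vecI) (simp_all add: E_mult_vec bl_lin c qf_lin algebra_simps)
  finally show "(E e u * E e v) *\<^sub>v x = E e (u + v) *\<^sub>v x" .
qed auto

lemma E_zero:
  assumes "e \<in> V"
  shows "E e (0\<^sub>v (n + 4)) = 1\<^sub>m (n + 4)"
proof (rule mat_eq_if_mult_vec_eq[where m="n+4" and k="n+4"])
  fix x :: "real vec" assume x: "x \<in> V"
  show "E e (0\<^sub>v (n + 4)) *\<^sub>v x = 1\<^sub>m (n + 4) *\<^sub>v x"
    using assms x by (intro eq_vecI) (simp_all add: E_mult_vec qf_def)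
qed auto

text \<open>The linear terms have degree 1, and the quadratic term degree 2, in each of
  \<open>e\<close> and \<open>u\<close>, so a scalar can be moved from one to the other.\<close>

lemma E_scale:
  assumes "e \<in> V" "u \<in> V"
  shows "E (a \<cdot>\<^sub>v e) u = E e (a \<cdot>\<^sub>v u)"
proof (rule mat_eq_if_mult_vec_eq[where m="n+4" and k="n+4"])
  fix x :: "real vec" assume x: "x \<in> V"
  show "E (a \<cdot>\<^sub>v e) u *\<^sub>v x = E e (a \<cdot>\<^sub>v u) *\<^sub>v x"
    using assms x
    by (intro eq_vecI) (simp_all add: E_mult_vec bl_lin qf_lin algebra_simps power2_eq_square)
qed auto

text \<open>For isotropic \<open>u\<close> the quadratic term vanishes and \<open>E e u\<close> is
  the identity plus the bivector of \<open>e\<close> and \<open>u\<close>, which a base change of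
  determinant 1 preserves.\<close>

lemma E_base_change:
  assumes "e \<in> V" "u \<in> V" "bl e e = 0" "bl e u = 0" "bl u u = 0" "a * d - b * c = 1"
  shows "E (a \<cdot>\<^sub>v e + b \<cdot>\<^sub>v u) (c \<cdot>\<^sub>v e + d \<cdot>\<^sub>v u) = E e u"
proof (rule mat_eq_if_mult_vec_eq[where m="n+4" and k="n+4"])
  fix x :: "real vec" assume x: "x \<in> V"
  have 0: "bl u e = 0" "qf u = 0" "qf e = 0" using assms by (simp_all add: bl_commute qf_def)
  show "E (a \<cdot>\<^sub>v e + b \<cdot>\<^sub>v u) (c \<cdot>\<^sub>v e + d \<cdot>\<^sub>v u) *\<^sub>v x = E e u *\<^sub>v x"
  proof (rule eq_vecI)
    fix i assume "i < dim_vec (E e u *\<^sub>v x)"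
    then have i: "i < n + 4" using assms x by (simp add: E_mult_vec)
    have "(E (a \<cdot>\<^sub>v e + b \<cdot>\<^sub>v u) (c \<cdot>\<^sub>v e + d \<cdot>\<^sub>v u) *\<^sub>v x) $ i =
        x $ i + (a * d - b * c) * (bl e x * u $ i - bl u x * e $ i)"
      using assms(1-5) x i 0 by (simp add: E_mult_vec bl_lin qf_lin algebra_simps)
    also have "\<dots> = (E e u *\<^sub>v x) $ i"
      using assms x i 0 by (simp add: E_mult_vec)
    finally show "(E (a \<cdot>\<^sub>v e + b \<cdot>\<^sub>v u) (c \<cdot>\<^sub>v e + d \<cdot>\<^sub>v u) *\<^sub>v x) $ i = (E e u *\<^sub>v x) $ i" .
  qed (use assms x in \<open>simp add: E_mult_vec\<close>)
qed auto

section \<open>Integral vectors\<close>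

definition intv :: "real vec \<Rightarrow> bool" where
  "intv x \<longleftrightarrow> x \<in> V \<and> (\<forall>i<n+4. x $ i \<in> \<int>)"

lemma intv_carrier [simp]: "intv x \<Longrightarrow> x \<in> V" by (simp add: intv_def)

lemma intv_add: "intv x \<Longrightarrow> intv y \<Longrightarrow> intv (x + y)"
  by (auto simp: intv_def)

lemma intv_smult: "intv x \<Longrightarrow> a \<in> \<int> \<Longrightarrow> intv (a \<cdot>\<^sub>v x)"
  by (auto simp: intv_def)

lemma intv_unit: "intv (unit_vec (n + 4) k)"
  by (auto simp: intv_def unit_vec_def)

lemma intv_basis [simp]: "intv e1" "intv e2" "intv f1" "intv f2"
  by (simp_all add: basis_defs intv_unit)

lemma bl_int: "intv x \<Longrightarrow> intv y \<Longrightarrow> bl x y \<in> \<int>"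
  unfolding bl_def intv_def by (intro Ints_add Ints_diff Ints_mult sf_int) auto

lemma qf_int:
  assumes "intv x"
  shows "qf x \<in> \<int>"
proof -
  have "qf x = x $ 0 * x $ (n+3) + x $ 1 * x $ (n+2) - sf (\<lambda>i. x $ (i+2)) (\<lambda>i. x $ (i+2)) / 2"
    by (simp add: qf_def bl_def field_simps)
  also have "\<dots> \<in> \<int>"
    using assms unfolding intv_def by (intro Ints_add Ints_diff Ints_mult sf_even) auto
  finally show ?thesis .
qed

lemma E_intv: "intv e \<Longrightarrow> intv u \<Longrightarrow> intv x \<Longrightarrow> intv (E e u *\<^sub>v x)"
  by (simp add: E_mult_vec bl_int qf_int intv_add intv_smult)

text \<open>The form is definite on the complement of the two hyperbolic planes, so an isotropic
  vector with no component in the planes vanishes.\<close>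

lemma isotropic_pairing_nonzero:
  assumes x: "x \<in> V" "bl x x = 0" "x \<noteq> 0\<^sub>v (n + 4)"
  shows "bl e1 x \<noteq> 0 \<or> bl f1 x \<noteq> 0 \<or> bl e2 x \<noteq> 0 \<or> bl f2 x \<noteq> 0"
proof (rule ccontr)
  assume "\<not> ?thesis"
  then have c: "x $ (n+3) = 0" "x $ 0 = 0" "x $ (n+2) = 0" "x $ 1 = 0"
    using x by (simp_all add: bl_unit_left)
  then have "sf (\<lambda>i. x $ (i+2)) (\<lambda>i. x $ (i+2)) = 0" using x by (simp add: bl_def)
  then have k: "x $ (i+2) = 0" if "i < n" for i using sf_eq_0 that by blast
  have "x = 0\<^sub>v (n + 4)"
  proof (rule eq_vecI)
    fix i assume "i < dim_vec (0\<^sub>v (n + 4) :: real vec)"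
    then have i: "i < n + 4" by simp
    from i show "x $ i = 0\<^sub>v (n + 4) $ i" by (cases rule: index_four_cases) (use c k i in auto)
  qed (use x in auto)
  then show False using x by simp
qed

text \<open>A vector orthogonal to everything is orthogonal to itself, hence isotropic, and
  \<open>isotropic_pairing_nonzero\<close> applies.\<close>

lemma bl_nondegenerate:
  assumes x: "x \<in> V" and 0: "\<And>y. y \<in> V \<Longrightarrow> bl x y = 0"
  shows "x = 0\<^sub>v (n + 4)"
  using isotropic_pairing_nonzero[OF x 0[OF x]] 0[of e1] 0[of f1] 0[of e2] 0[of f2]
  by (auto simp: bl_commute)

end

text \<open>This collects what the integrality argument uses of the discriminant kernel.
  \<open>maximal\<close> is maximality of the lattice in usable form: a vector \<open>w / a\<close>
  of the dual lattice on which \<open>qf\<close> is integral already lies in the lattice.\<close>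

locale eichler_group = split_lattice +
  fixes T :: "real mat set"
  assumes T_isom: "g \<in> T \<Longrightarrow> isom g"
    and T_mult: "g \<in> T \<Longrightarrow> h \<in> T \<Longrightarrow> g * h \<in> T"
    and T_inv: "g \<in> T \<Longrightarrow> \<exists>h\<in>T. g * h = 1\<^sub>m (n + 4) \<and> h * g = 1\<^sub>m (n + 4)"
    and T_intv: "g \<in> T \<Longrightarrow> intv x \<Longrightarrow> intv (g *\<^sub>v x)"
    and T_E: "intv e \<Longrightarrow> intv u \<Longrightarrow> bl e e = 0 \<Longrightarrow> bl e u = 0 \<Longrightarrow> E e u \<in> T"
    and maximal: "intv w \<Longrightarrow> a \<in> \<int> \<Longrightarrow> a \<noteq> 0 \<Longrightarrow> (\<And>l. intv l \<Longrightarrow> bl w l / a \<in> \<int>) \<Longrightarrow>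
      qf w / a\<^sup>2 \<in> \<int> \<Longrightarrow> intv ((1 / a) \<cdot>\<^sub>v w)"
begin

lemma T_vec_mult:
  assumes "g \<in> T" "h \<in> T" "x \<in> V"
  shows "(g * h) *\<^sub>v x = g *\<^sub>v (h *\<^sub>v x)"
  using assms T_isom isom_carrier by (meson assoc_mult_mat_vec)

definition orbit :: "real vec \<Rightarrow> real vec set" where
  "orbit x = {g *\<^sub>v x | g. g \<in> T}"

lemma orbit_step:
  assumes "x \<in> V" "y \<in> orbit x" "g \<in> T"
  shows "g *\<^sub>v y \<in> orbit x"
  using assms T_vec_mult T_mult unfolding orbit_def by (smt (verit) mem_Collect_eq)

lemma orbit_self: "x \<in> V \<Longrightarrow> x \<in> orbit x"
proof -
  assume x: "x \<in> V"
  \<comment> \<open>The neutral element of \<open>T\<close> is obtained as an Eichler transformation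
    with zero parameter.\<close>
  have "E e1 (0 \<cdot>\<^sub>v e1) \<in> T" by (intro T_E intv_smult) (simp_all add: bl_lin)
  moreover have "0 \<cdot>\<^sub>v e1 = 0\<^sub>v (n + 4)" by (auto simp: e1_def)
  ultimately have "1\<^sub>m (n + 4) \<in> T" by (simp add: E_zero)
  then show ?thesis unfolding orbit_def using x by (metis (mono_tags, lifting) mem_Collect_eq one_mult_mat_vec)
qed

lemma orbit_intv:
  assumes "intv x" "y \<in> orbit x"
  shows "intv y"
  using assms T_intv by (auto simp: orbit_def)

text \<open>\<open>E f2 e1\<close> and \<open>E e2 e1\<close> add the pairings with
  \<open>f2\<close> and \<open>e2\<close> to the pairing with \<open>f1\<close>. If only the pairing
  with \<open>e1\<close> is nonzero, \<open>E e2 e1\<close> first moves it to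
  \<open>f2\<close>.\<close>

lemma orbit_pairing_nonzero:
  assumes x: "intv x" "bl x x = 0" "x \<noteq> 0\<^sub>v (n + 4)"
  shows "\<exists>y\<in>orbit x. bl f1 y \<noteq> 0"
proof -
  have xV: "x \<in> V" using x by simp
  have E2: "E f2 e1 \<in> T" "E e2 e1 \<in> T" by (rule T_E; simp)+
  have *: "\<exists>y\<in>orbit x. bl f1 y \<noteq> 0" if z: "z \<in> orbit x" and nz: "bl f1 z \<noteq> 0 \<or> bl f2 z \<noteq> 0 \<or> bl e2 z \<noteq> 0" for z
  proof -
    have zV: "z \<in> V" using orbit_intv[OF x(1) z] by simp
    have "bl f1 (E f2 e1 *\<^sub>v z) = bl f1 z + bl f2 z" "bl f1 (E e2 e1 *\<^sub>v z) = bl f1 z + bl e2 z"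
      using zV by (simp_all add: bl_E)
    then show ?thesis
      using nz z orbit_step[OF xV z] E2 by (metis add_0_left)
  qed
  show ?thesis
  proof (cases "bl f1 x \<noteq> 0 \<or> bl f2 x \<noteq> 0 \<or> bl e2 x \<noteq> 0")
    case True then show ?thesis using * orbit_self xV by blast
  next
    case False
    then have "bl e1 x \<noteq> 0" using isotropic_pairing_nonzero[OF xV x(2,3)] by blast
    moreover have "bl f2 (E e2 e1 *\<^sub>v x) = bl f2 x - bl e1 x" using xV False by (simp add: bl_E)
    ultimately show ?thesis using * orbit_step[OF xV orbit_self[OF xV] E2(2)] False by auto
  qed
qed

text \<open>Euclid's algorithm with Eichler transformations along the plane spanned by \<open>p\<close> and \<open>p'\<close>.\<close>

lemma orbit_min_dvd:
  assumes x: "intv x" and y: "y \<in> orbit x"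
    and p: "(p, p') = (e2, f2) \<or> (p, p') = (f2, e2)"
    and A: "bl f1 y = of_int A" "A \<noteq> 0"
    and min: "\<And>z. z \<in> orbit x \<Longrightarrow> bl f1 z \<noteq> 0 \<Longrightarrow> \<bar>bl f1 y\<bar> \<le> \<bar>bl f1 z\<bar>"
  shows "\<exists>t::int. bl p' y = of_int t * of_int A"
proof -
  have xV: "x \<in> V" using x by simp
  have yI: "intv y" using orbit_intv x y by blast
  then have yV: "y \<in> V" by simp
  have pV: "p \<in> V" "p' \<in> V" "intv p" "intv p'" using p by auto
  have pp: "bl f1 p = 0" "bl f1 p' = 0" "bl p' p = 1" "bl p' f1 = 0" "bl p' p' = 0" "bl p' e1 = 0" "qf p = 0"
    using p by auto
  obtain C where C: "bl p' y = of_int C" using bl_int[OF pV(4) yI] by (auto elim: Ints_cases)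
  \<comment> \<open>Division with remainder: the pairing with \<open>p'\<close> becomes
    \<open>C mod A\<close>, while the pairing with \<open>f1\<close> remains
    \<open>A\<close>.\<close>
  define y' where "y' = E f1 (of_int (- (C div A)) \<cdot>\<^sub>v p) *\<^sub>v y"
  have ET: "E f1 (of_int (- (C div A)) \<cdot>\<^sub>v p) \<in> T"
    using pV pp by (intro T_E intv_smult) (simp_all add: bl_lin)
  have y': "y' \<in> orbit x" "y' \<in> V" unfolding y'_def using orbit_step[OF xV y ET] yV by auto
  have "bl p' y' = of_int C - of_int (C div A) * of_int A"
    unfolding y'_def using yV pV pp by (subst bl_E) (simp_all add: bl_lin C A)
  then have r: "bl p' y' = of_int (C mod A)"
    by (metis of_int_diff of_int_mult minus_div_mult_eq_mod)
  have a: "bl f1 y' = of_int A"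
    unfolding y'_def using yV pV pp by (subst bl_E) (simp_all add: bl_lin C A)
  \<comment> \<open>The remainder is now subtracted from the pairing with \<open>f1\<close>. As
    \<open>mod\<close> takes the sign of \<open>A\<close>, a nonzero remainder makes
    \<open>A - C mod A\<close> nonzero and smaller than \<open>A\<close> in absolute value, against
    minimality.\<close>
  define z where "z = E p' ((-1) \<cdot>\<^sub>v e1) *\<^sub>v y'"
  have ET: "E p' ((-1) \<cdot>\<^sub>v e1) \<in> T"
    using pV pp by (intro T_E intv_smult) (simp_all add: bl_lin)
  have z: "z \<in> orbit x" unfolding z_def using orbit_step[OF xV y'(1) ET] .
  have bz: "bl f1 z = of_int (A - C mod A)"
    unfolding z_def using y' pV pp by (subst bl_E) (simp_all add: bl_lin r a qf_lin)
  have "C mod A = 0"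
  proof (rule ccontr)
    assume n0: "C mod A \<noteq> 0"
    have "\<bar>A - C mod A\<bar> < \<bar>A\<bar> \<and> A - C mod A \<noteq> 0"
    proof (cases "A > 0")
      case True then show ?thesis using pos_mod_bound[of A C] pos_mod_sign[of A C] n0 by linarith
    next
      case False then show ?thesis using neg_mod_bound[of A C] neg_mod_sign[of A C] n0 A(2) by linarith
    qed
    moreover have "\<bar>real_of_int A\<bar> \<le> \<bar>real_of_int (A - C mod A)\<bar>" if "A - C mod A \<noteq> 0"
      using min[OF z] that unfolding bz A(1) by simp
    ultimately show False by linarith
  qed
  then have "C = (C div A) * A" by (metis add.right_neutral div_mult_mod_eq)
  then show ?thesis using C by (metis of_int_mult)
qed

text \<open>Take an orbit element whose pairing \<open>A\<close> with \<open>f1\<close> is nonzero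
  and minimal in absolute value. Minimality makes \<open>A\<close> divide all its pairings with
  lattice vectors once those with \<open>e2\<close> and \<open>f2\<close> are cleared, and
  maximality of the lattice then allows division by \<open>A\<close>. The quotient pairs to 1 with
  \<open>f1\<close> and is reached from \<open>e1\<close> by one Eichler transformation.\<close>

theorem isotropic_transitive:
  assumes x: "intv x" "bl x x = 0" "x \<noteq> 0\<^sub>v (n + 4)"
  shows "\<exists>g\<in>T. \<exists>a\<in>\<int>. a \<noteq> 0 \<and> x = a \<cdot>\<^sub>v (g *\<^sub>v e1)"
proof -
  have xV: "x \<in> V" using x by simp
  define P where "P k \<longleftrightarrow> k > 0 \<and> (\<exists>y\<in>orbit x. \<bar>bl f1 y\<bar> = real k)" for k
  have PI: "P (nat \<lfloor>\<bar>bl f1 y\<bar>\<rfloor>) \<and> real (nat \<lfloor>\<bar>bl f1 y\<bar>\<rfloor>) = \<bar>bl f1 y\<bar>"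
    if "y \<in> orbit x" "bl f1 y \<noteq> 0" for y
  proof -
    have "bl f1 y \<in> \<int>" using bl_int[of f1 y] orbit_intv[OF x(1) that(1)] by simp
    then obtain B where B: "bl f1 y = of_int B" by (auto elim: Ints_cases)
    have "nat \<lfloor>\<bar>bl f1 y\<bar>\<rfloor> = nat \<bar>B\<bar>" unfolding B by (metis floor_of_int of_int_abs)
    then show ?thesis using that B unfolding P_def by (auto intro!: bexI[of _ y])
  qed
  have "\<exists>k. P k" using orbit_pairing_nonzero[OF x] PI by blast
  then have PL: "P (LEAST k. P k)" by (metis LeastI)
  then obtain y where y: "y \<in> orbit x" "\<bar>bl f1 y\<bar> = real (LEAST k. P k)" "bl f1 y \<noteq> 0"
    unfolding P_def by auto
  have min: "\<bar>bl f1 y\<bar> \<le> \<bar>bl f1 z\<bar>" if "z \<in> orbit x" "bl f1 z \<noteq> 0" for z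
    using PI[OF that] Least_le[of P] y(2) by (metis of_nat_le_iff)
  obtain A where A: "bl f1 y = of_int A"
    using bl_int[of f1 y] orbit_intv[OF x(1) y(1)] by (auto elim: Ints_cases)
  have A0: "A \<noteq> 0" using A y(3) by auto
  note dvd = orbit_min_dvd[OF x(1)]
  have dvd': "\<exists>t::int. bl p' z = of_int t * of_int A"
    if "z \<in> orbit x" "bl f1 z = of_int A" "(p, p') = (e2, f2) \<or> (p, p') = (f2, e2)" for z p p'
    by (rule dvd[OF that(1) that(3) that(2) A0]) (use that(2) A min in auto)
  obtain t :: int where t: "bl f2 y = of_int t * of_int A" using dvd'[OF y(1) A, of e2 f2] by auto
  define y1 where "y1 = E f1 (of_int (-t) \<cdot>\<^sub>v e2) *\<^sub>v y"
  have yV: "y \<in> V" using orbit_intv[OF x(1) y(1)] by simp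
  have ET: "E f1 (of_int (-t) \<cdot>\<^sub>v e2) \<in> T" "E f1 (of_int (-t) \<cdot>\<^sub>v f2) \<in> T" for t :: int
    by (intro T_E intv_smult; simp add: bl_lin)+
  have y1: "y1 \<in> orbit x" "y1 \<in> V" unfolding y1_def using orbit_step[OF xV y(1) ET(1)] yV by auto
  have b1: "bl f1 y1 = of_int A" "bl f2 y1 = 0"
    unfolding y1_def using yV by (simp_all add: bl_E bl_lin A t)
  obtain s :: int where s: "bl e2 y1 = of_int s * of_int A" using dvd'[OF y1(1) b1(1), of f2 e2] by auto
  define y2 where "y2 = E f1 (of_int (-s) \<cdot>\<^sub>v f2) *\<^sub>v y1"
  have y2: "y2 \<in> orbit x" unfolding y2_def using orbit_step[OF xV y1(1) ET(2)] .
  have y2I: "intv y2" and y2V: "y2 \<in> V" using orbit_intv[OF x(1) y2] by auto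
  have b2: "bl f1 y2 = of_int A" "bl f2 y2 = 0" "bl e2 y2 = 0"
    unfolding y2_def using y1 b1 by (simp_all add: bl_E bl_lin s)
  have div: "bl y2 l / of_int A \<in> \<int>" if l: "intv l" for l
  proof -
    \<comment> \<open>The correction makes \<open>l'\<close> orthogonal to \<open>e2\<close> without
      changing the pairing with \<open>y2\<close>. Then \<open>E e2 l'\<close> turns this pairing,
      up to sign, into the pairing with \<open>f2\<close> and keeps the minimal pairing with
      \<open>f1\<close>, so \<open>dvd'\<close> covers an arbitrary \<open>l\<close>.\<close>
    define l' where "l' = l + (- bl e2 l) \<cdot>\<^sub>v f2"
    have l': "intv l'" "bl e2 l' = 0" "bl l' y2 = bl l y2" "l' \<in> V"
      unfolding l'_def using l bl_int[of e2 l] y2V b2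
      by (simp_all add: bl_lin intv_add intv_smult)
    define y3 where "y3 = E e2 l' *\<^sub>v y2"
    have y3: "y3 \<in> orbit x" "bl f1 y3 = of_int A" "bl f2 y3 = - bl l y2"
      unfolding y3_def using l' y2V b2 orbit_step[OF xV y2 T_E[of e2 l']] by (simp_all add: bl_E)
    obtain r :: int where "bl f2 y3 = of_int r * of_int A" using dvd'[OF y3(1,2), of e2 f2] by auto
    then have "bl y2 l / of_int A = of_int (- r)" using y3(3) A0 by (simp add: bl_commute field_simps)
    then show ?thesis by (metis Ints_of_int)
  qed
  obtain g where g: "g \<in> T" "y2 = g *\<^sub>v x" using y2 by (auto simp: orbit_def)
  have q0: "qf y2 = 0" using isom_qf[OF T_isom[OF g(1)] xV] g x by (simp add: qf_def)
  define w where "w = (1 / of_int A) \<cdot>\<^sub>v y2"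
  have w: "intv w" unfolding w_def by (rule maximal[OF y2I _ _ div]) (use A0 q0 in auto)
  then have wV: "w \<in> V" by simp
  have bw: "bl f1 w = 1" "qf w = 0" unfolding w_def using y2V b2 A0 q0 by (simp_all add: bl_lin qf_lin)
  \<comment> \<open>\<open>E f1 u\<close> sends \<open>e1\<close> to \<open>e1 + u = w\<close>: the
    coefficient of \<open>f1\<close> is \<open>bl u e1 + qf u\<close> up to sign, which vanishes
    because \<open>w\<close> is isotropic and pairs to 1 with \<open>f1\<close>.\<close>
  define u where "u = w + (-1) \<cdot>\<^sub>v e1"
  have u: "intv u" "u \<in> V" unfolding u_def using w by (simp_all add: intv_add intv_smult)
  have bu: "bl f1 u = 0" "bl u e1 = bl w e1" "qf u = - bl w e1"
    unfolding u_def using wV bw by (simp_all add: bl_lin qf_lin)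
  have Ew: "E f1 u *\<^sub>v e1 = w"
    using u wV by (intro eq_vecI) (simp_all add: E_mult_vec bu, simp_all add: u_def)
  have EuT: "E f1 u \<in> T" using u bu by (intro T_E) auto
  obtain h where h: "h \<in> T" "h * g = 1\<^sub>m (n + 4)" using T_inv[OF g(1)] by blast
  have "x = h *\<^sub>v y2"
    using inverse_vec[OF _ _ h(2) xV] h(1) g T_isom isom_carrier by metis
  also have "y2 = of_int A \<cdot>\<^sub>v w" unfolding w_def using A0 y2V by (auto intro!: eq_vecI)
  also have "h *\<^sub>v (of_int A \<cdot>\<^sub>v w) = of_int A \<cdot>\<^sub>v ((h * E f1 u) *\<^sub>v e1)"
    using h(1) EuT wV T_isom isom_carrier by (simp add: T_vec_mult Ew mult_mat_smult_vec)
  finally show ?thesis using T_mult[OF h(1) EuT] A0 by (metis Ints_of_int of_int_eq_0_iff)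
qed

end

section \<open>Shimizu's lemma\<close>

text \<open>Once \<open>d\<close> is below 1/2 in absolute value, \<open>u\<close> stays bounded, so
  the correction \<open>d k * u k\<close> tends to 0. The recursion starts at index 1 because the
  sequence \<open>g\<close> of Shimizu's iteration satisfies it only from there.\<close>

lemma contracting_affine_tendsto_1:
  fixes u d :: "nat \<Rightarrow> real"
  assumes d: "d \<longlonglongrightarrow> 0" and rec: "\<And>k. k \<ge> 1 \<Longrightarrow> u (Suc k) = 1 - d k * u k"
  shows "u \<longlonglongrightarrow> 1"
proof -
  have "\<forall>\<^sub>F k in sequentially. \<bar>d k\<bar> < 1/2"
    using order_tendstoD(2)[OF tendsto_rabs_zero[OF d], of "1/2"] by simp
  then obtain N where N: "\<And>k. k \<ge> N \<Longrightarrow> \<bar>d k\<bar> < 1/2" "N \<ge> 1"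
    unfolding eventually_sequentially by (metis le_trans linorder_le_cases)
  define C where "C = max 2 \<bar>u N\<bar>"
  have bd: "\<bar>u k\<bar> \<le> C" if "k \<ge> N" for k
    using that
  proof (induction k rule: dec_induct)
    case (step k)
    have "\<bar>d k * u k\<bar> \<le> 1/2 * C"
      unfolding abs_mult using N step by (intro mult_mono) (auto intro: less_imp_le)
    then show ?case using rec[of k] step N C_def by linarith
  qed (simp add: C_def)
  have "(\<lambda>k. u (Suc k) - 1) \<longlonglongrightarrow> 0"
  proof (rule Lim_null_comparison)
    show "\<forall>\<^sub>F k in sequentially. norm (u (Suc k) - 1) \<le> \<bar>d k\<bar> * C"
      unfolding eventually_sequentially
    proof (intro exI[of _ N] allI impI)
      fix k assume "N \<le> k"
      then show "norm (u (Suc k) - 1) \<le> \<bar>d k\<bar> * C"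
        using rec[of k] N bd[of k] by (simp add: abs_mult mult_left_mono)
    qed
    show "(\<lambda>k. \<bar>d k\<bar> * C) \<longlonglongrightarrow> 0"
      using tendsto_mult_right[OF tendsto_rabs_zero[OF d], of C] by simp
  qed
  then have "(\<lambda>k. u (Suc k)) \<longlonglongrightarrow> 1" by (simp add: LIM_zero_iff)
  then show ?thesis by (rule LIMSEQ_imp_Suc)
qed

locale discrete_overgroup = eichler_group +
  fixes D :: "real mat set"
  assumes D_isom: "g \<in> D \<Longrightarrow> isom g"
    and D_mult: "g \<in> D \<Longrightarrow> h \<in> D \<Longrightarrow> g * h \<in> D"
    and D_inv: "g \<in> D \<Longrightarrow> \<exists>h\<in>D. g * h = 1\<^sub>m (n + 4) \<and> h * g = 1\<^sub>m (n + 4)"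
    and D_discrete: "g \<in> D \<Longrightarrow> \<exists>\<epsilon>>0. \<forall>h\<in>D.
      (\<forall>i<n+4. \<forall>j<n+4. \<bar>h $$ (i, j) - g $$ (i, j)\<bar> < \<epsilon>) \<longrightarrow> h = g"
    and T_D: "T \<subseteq> D"
begin

text \<open>Shimizu's lemma: the iteration \<open>X \<mapsto> X (E e f) X\<^sup>-\<^sup>1\<close>, started at \<open>E e' f'\<close>, stays in \<open>D\<close>
  and converges to \<open>E e f\<close> without reaching it.\<close>

lemma shimizu_normalized:
  assumes V: "e \<in> V" "f \<in> V" "e' \<in> V" "f' \<in> V"
    and iso: "bl e e = 0" "bl f f = 0" "bl e f = 0" "bl e' e' = 0" "bl f' f' = 0" "bl e' f' = 0"
    and pair: "bl e e' = 0" "bl f f' = 0" "bl e f' = 1" "bl f e' = c"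
    and ED: "E e f \<in> D" "E e' f' \<in> D"
    and c: "c \<noteq> 0" "\<bar>c\<bar> < 1"
  shows False
proof -
  \<comment> \<open>The iterates have the form \<open>E (a e + b e') (g f + d f')\<close>, and the
    tuple holds these coefficients. The recursion records where the current iterate sends
    \<open>e\<close> and \<open>f\<close>.\<close>
  define s where "s k = ((\<lambda>(a, b, g, d). (1 - d * a, - d * b, 1 + b * c * g, b * c * d)) ^^ k) (0, 1, 0, 1)"
    for k :: nat
  define a where "a k = fst (s k)" for k
  define b where "b k = fst (snd (s k))" for k
  define g where "g k = fst (snd (snd (s k)))" for k
  define d where "d k = snd (snd (snd (s k)))" for k
  have init: "a 0 = 0" "b 0 = 1" "g 0 = 0" "d 0 = 1"
    by (simp_all add: a_def b_def g_def d_def s_def)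
  have rec: "a (Suc k) = 1 - d k * a k" "b (Suc k) = - d k * b k" "g (Suc k) = 1 + b k * c * g k"
    "d (Suc k) = b k * c * d k" for k
    by (simp_all add: a_def b_def g_def d_def s_def split_beta)
  \<comment> \<open>This expresses that the two vectors of the iterate remain orthogonal.\<close>
  have perp: "a k * d k + b k * g k * c = 0" for k
  proof (induction k)
    case (Suc k)
    have "a (Suc k) * d (Suc k) + b (Suc k) * g (Suc k) * c = - b k * c * d k * (a k * d k + b k * g k * c)"
      by (simp add: rec algebra_simps)
    then show ?case using Suc by simp
  qed (simp add: init)
  \<comment> \<open>Hence \<open>d (Suc k) = - (d k)^2\<close> from index 1 on, with
    \<open>d 1 = c\<close>. At index 0 the relation fails, since there \<open>b\<close> and
    \<open>d\<close> are both 1.\<close>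
  have bd: "b k * c = - d k" if "k \<ge> 1" for k
    using that by (cases k) (simp_all add: rec)
  have dpow: "\<bar>d k\<bar> \<le> \<bar>c\<bar> ^ k" if "k \<ge> 1" for k
    using that
  proof (induction k rule: dec_induct)
    case base
    have "d (Suc 0) = c" unfolding rec(4) init by simp
    then show ?case by simp
  next
    case (step k)
    have "\<bar>d (Suc k)\<bar> = \<bar>d k\<bar> * \<bar>d k\<bar>" using step bd[of k] by (simp add: rec(4) abs_mult)
    also have "\<dots> \<le> \<bar>c\<bar> ^ 1 * \<bar>c\<bar> ^ k"
    proof (rule mult_mono)
      have "\<bar>c\<bar> ^ k \<le> \<bar>c\<bar> ^ 1" using step c by (intro power_decreasing) auto
      then show "\<bar>d k\<bar> \<le> \<bar>c\<bar> ^ 1" using step.IH by linarith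
    qed (use step in auto)
    finally show ?case by simp
  qed
  have nz: "b k \<noteq> 0 \<and> d k \<noteq> 0" for k
    by (induction k) (use c in \<open>simp_all add: init rec\<close>)
  have dlim: "d \<longlonglongrightarrow> 0"
  proof (rule Lim_null_comparison)
    show "\<forall>\<^sub>F k in sequentially. norm (d k) \<le> \<bar>c\<bar> ^ k"
      unfolding eventually_sequentially using dpow by (intro exI[of _ 1]) auto
    show "(\<lambda>k. \<bar>c\<bar> ^ k) \<longlonglongrightarrow> 0" using c by (intro LIMSEQ_power_zero) auto
  qed
  have blim: "b \<longlonglongrightarrow> 0"
  proof (rule Lim_transform_eventually)
    show "(\<lambda>k. - d k / c) \<longlonglongrightarrow> 0" using tendsto_divide[OF tendsto_minus[OF dlim] tendsto_const[of c]] c by simp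
    show "\<forall>\<^sub>F k in sequentially. - d k / c = b k"
      unfolding eventually_sequentially
    proof (intro exI[of _ 1] allI impI)
      fix k :: nat assume "1 \<le> k"
      then show "- d k / c = b k" using bd[of k] c by (simp add: field_simps)
    qed
  qed
  have alim: "a \<longlonglongrightarrow> 1" by (rule contracting_affine_tendsto_1[OF dlim]) (rule rec)
  have glim: "g \<longlonglongrightarrow> 1" by (rule contracting_affine_tendsto_1[OF dlim]) (use bd rec in simp)
  define es where "es k = a k \<cdot>\<^sub>v e + b k \<cdot>\<^sub>v e'" for k
  define fs where "fs k = g k \<cdot>\<^sub>v f + d k \<cdot>\<^sub>v f'" for k
  have kV: "es k \<in> V" "fs k \<in> V" for k using V by (simp_all add: es_def fs_def)
  have sym: "bl e' e = 0" "bl f' f = 0" "bl f' e = 1" "bl e' f = c" "bl f e = 0" "bl f' e' = 0"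
    using pair iso by (simp_all add: bl_commute)
  have kiso: "bl (es k) (es k) = 0" "bl (fs k) (fs k) = 0" "bl (es k) (fs k) = 0" for k
    using V iso pair sym perp[of k] by (simp_all add: es_def fs_def bl_lin algebra_simps)
  have qk: "qf (fs k) = 0" "qf f = 0" for k using kiso iso by (simp_all add: qf_def)
  have bk: "bl (es k) e = 0" "bl (fs k) e = d k" "bl (es k) f = b k * c" "bl (fs k) f = 0" for k
    using V iso pair sym by (simp_all add: es_def fs_def bl_lin)
  have step: "E (es k) (fs k) *\<^sub>v e = es (Suc k)" "E (es k) (fs k) *\<^sub>v f = fs (Suc k)" for k
  proof -
    have "E (es k) (fs k) *\<^sub>v e = e + (0 \<cdot>\<^sub>v fs k + (- d k) \<cdot>\<^sub>v es k)"
      using V kV by (simp add: E_mult_vec bk)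
    also have "\<dots> = es (Suc k)"
    proof (rule eq_vecI)
      fix i assume "i < dim_vec (es (Suc k))"
      then have "i < n + 4" using kV[of "Suc k"] by simp
      then show "(e + (0 \<cdot>\<^sub>v fs k + (- d k) \<cdot>\<^sub>v es k)) $ i = es (Suc k) $ i"
        using V unfolding es_def fs_def rec by (simp add: algebra_simps)
    qed (use kV[of k] kV[of "Suc k"] in simp)
    finally show "E (es k) (fs k) *\<^sub>v e = es (Suc k)" .
    have "E (es k) (fs k) *\<^sub>v f = f + ((b k * c) \<cdot>\<^sub>v fs k + 0 \<cdot>\<^sub>v es k)"
      using V kV by (simp add: E_mult_vec bk qk)
    also have "\<dots> = fs (Suc k)"
    proof (rule eq_vecI)
      fix i assume "i < dim_vec (fs (Suc k))"
      then have "i < n + 4" using kV[of "Suc k"] by simp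
      then show "(f + ((b k * c) \<cdot>\<^sub>v fs k + 0 \<cdot>\<^sub>v es k)) $ i = fs (Suc k) $ i"
        using V unfolding es_def fs_def rec by (simp add: algebra_simps)
    qed (use kV[of k] kV[of "Suc k"] in simp)
    finally show "E (es k) (fs k) *\<^sub>v f = fs (Suc k)" .
  qed
  have kD: "E (es k) (fs k) \<in> D" for k
  proof (induction k)
    case 0
    have "es 0 = e'" "fs 0 = f'" using V by (auto simp: es_def fs_def init)
    then show ?case using ED by simp
  next
    case (Suc k)
    obtain h where h: "h \<in> D" "E (es k) (fs k) * h = 1\<^sub>m (n + 4)" using D_inv[OF Suc] by blast
    have "E (es k) (fs k) * E e f * h = E (es (Suc k)) (fs (Suc k))"
      unfolding step[symmetric]
      by (rule E_conj[OF D_isom[OF Suc] _ h(2)]) (use h D_isom isom_carrier V in auto)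
    then show ?case using Suc h(1) ED(1) D_mult by metis
  qed
  have lim: "(\<lambda>k. E (es k) (fs k) $$ (i, j)) \<longlonglongrightarrow> E e f $$ (i, j)" if "i < n + 4" "j < n + 4" for i j
  proof -
    let ?u = "unit_vec (n + 4) j :: real vec"
    have "E (es k) (fs k) $$ (i, j) = (if i = j then 1 else 0)
       + (a k * bl e ?u + b k * bl e' ?u) * (g k * f $ i + d k * f' $ i)
       - (g k * bl f ?u + d k * bl f' ?u) * (a k * e $ i + b k * e' $ i)" for k
      using that V by (simp add: E_def qk) (simp add: es_def fs_def bl_lin)
    moreover have "E e f $$ (i, j) = (if i = j then 1 else 0)
       + (1 * bl e ?u + 0 * bl e' ?u) * (1 * f $ i + 0 * f' $ i)
       - (1 * bl f ?u + 0 * bl f' ?u) * (1 * e $ i + 0 * e' $ i)"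
      using that V by (simp add: E_def qk)
    moreover have "(\<lambda>k. (if i = j then 1 else 0)
       + (a k * bl e ?u + b k * bl e' ?u) * (g k * f $ i + d k * f' $ i)
       - (g k * bl f ?u + d k * bl f' ?u) * (a k * e $ i + b k * e' $ i)) \<longlonglongrightarrow>
       (if i = j then 1 else 0)
       + (1 * bl e ?u + 0 * bl e' ?u) * (1 * f $ i + 0 * f' $ i)
       - (1 * bl f ?u + 0 * bl f' ?u) * (1 * e $ i + 0 * e' $ i)"
      by (intro tendsto_intros alim blim glim dlim)
    ultimately show ?thesis by simp
  qed
  obtain \<epsilon> where \<epsilon>: "\<epsilon> > 0" "\<And>h. h \<in> D \<Longrightarrow>
      (\<forall>i<n+4. \<forall>j<n+4. \<bar>h $$ (i, j) - E e f $$ (i, j)\<bar> < \<epsilon>) \<Longrightarrow> h = E e f"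
    using D_discrete[OF ED(1)] by blast
  have "\<forall>\<^sub>F k in sequentially. \<forall>i\<in>{..<n+4}. \<forall>j\<in>{..<n+4}. \<bar>E (es k) (fs k) $$ (i, j) - E e f $$ (i, j)\<bar> < \<epsilon>"
  proof (intro eventually_ball_finite ballI finite_lessThan)
    fix i j assume "i \<in> {..<n+4}" "j \<in> {..<n+4}"
    then show "\<forall>\<^sub>F k in sequentially. \<bar>E (es k) (fs k) $$ (i, j) - E e f $$ (i, j)\<bar> < \<epsilon>"
      using tendstoD[OF lim[of i j] \<epsilon>(1)] by (simp add: dist_real_def)
  qed
  then obtain k where "\<forall>i\<in>{..<n+4}. \<forall>j\<in>{..<n+4}. \<bar>E (es k) (fs k) $$ (i, j) - E e f $$ (i, j)\<bar> < \<epsilon>"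
    unfolding eventually_sequentially by blast
  then have "E (es k) (fs k) = E e f" using \<epsilon>(2)[OF kD] by auto
  \<comment> \<open>The image of \<open>f\<close>, paired with \<open>e\<close>, separates the
    iterates from their limit: it is 0 for \<open>E e f\<close> and \<open>b k * c * d k\<close> for
    the iterate.\<close>
  then have eq: "bl e (E (es k) (fs k) *\<^sub>v f) = bl e (E e f *\<^sub>v f)" by simp
  have "bl e (E e f *\<^sub>v f) = 0" using V iso by (simp add: bl_E)
  moreover have "bl e (E (es k) (fs k) *\<^sub>v f) = b k * c * d k"
  proof -
    have "bl e (es k) = 0" "bl e (fs k) = d k" using bk[of k] by (simp_all add: bl_commute)
    then show ?thesis using V kV iso bk[of k] qk by (simp add: bl_E)
  qed
  ultimately show False using eq nz[of k] c by simp
qed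

text \<open>By \<open>E_base_change\<close> the basis of the second plane may be changed with
  determinant 1. Choosing \<open>e''\<close> orthogonal to \<open>e\<close> and \<open>f''\<close>
  orthogonal to \<open>f\<close> brings the pairings into the normalized shape, with
  \<open>c\<close> the determinant of the original ones up to sign.\<close>

lemma shimizu:
  assumes V: "e \<in> V" "f \<in> V" "e' \<in> V" "f' \<in> V"
    and iso: "bl e e = 0" "bl f f = 0" "bl e f = 0" "bl e' e' = 0" "bl f' f' = 0" "bl e' f' = 0"
    and ED: "E e f \<in> D" "E e' f' \<in> D"
  shows "bl e f' * bl f e' - bl e e' * bl f f' = 0 \<or> \<bar>bl e f' * bl f e' - bl e e' * bl f f'\<bar> \<ge> 1"
proof (rule ccontr)
  define c where "c = bl e f' * bl f e' - bl e e' * bl f f'"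
  assume "\<not> ?thesis"
  then have c: "c \<noteq> 0" "\<bar>c\<bar> < 1" by (simp_all add: c_def)
  define e'' where "e'' = bl e f' \<cdot>\<^sub>v e' + (- bl e e') \<cdot>\<^sub>v f'"
  define f'' where "f'' = (- bl f f' / c) \<cdot>\<^sub>v e' + (bl f e' / c) \<cdot>\<^sub>v f'"
  have "E e'' f'' = E e' f'"
    unfolding e''_def f''_def
  proof (rule E_base_change)
    show "bl e f' * (bl f e' / c) - - bl e e' * (- bl f f' / c) = 1"
      using c by (simp add: diff_divide_distrib[symmetric] c_def[symmetric])
  qed (use V iso in auto)
  moreover have "bl f' e' = 0" using iso by (simp add: bl_commute)
  moreover have "bl e f'' = 1"
  proof -
    have "bl e f'' = (bl e f' * bl f e' - bl e e' * bl f f') / c"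
      unfolding f''_def using V by (simp add: bl_lin diff_divide_distrib mult.commute)
    then show ?thesis using c unfolding c_def by simp
  qed
  moreover have "bl f e'' = c" unfolding e''_def c_def using V by (simp add: bl_lin)
  ultimately show False
    using V iso ED c
    by (intro shimizu_normalized[of e f e'' f'' c]) (simp_all add: e''_def f''_def bl_lin)
qed

end

section \<open>Rationality\<close>

context split_lattice
begin

lemma sf_bound: "\<exists>C\<ge>0. \<forall>v r. (\<forall>i<n. \<bar>v i\<bar> \<le> r) \<longrightarrow> sf v v \<le> C * r\<^sup>2"
proof (intro exI[of _ "\<Sum>i<n. \<Sum>j<n. \<bar>real_of_int (S $$ (i, j))\<bar>"] conjI allI impI)
  fix v :: "nat \<Rightarrow> real" and r assume v: "\<forall>i<n. \<bar>v i\<bar> \<le> r"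
  have "sf v v \<le> (\<Sum>i<n. \<Sum>j<n. \<bar>real_of_int (S $$ (i, j))\<bar> * r\<^sup>2)"
    unfolding sf_def
  proof (intro sum_mono)
    fix i j assume "i \<in> {..<n}" "j \<in> {..<n}"
    then have ij: "\<bar>v i\<bar> \<le> r" "\<bar>v j\<bar> \<le> r" using v by auto
    have "v i * real_of_int (S $$ (i, j)) * v j \<le> \<bar>v i * real_of_int (S $$ (i, j)) * v j\<bar>" by simp
    also have "\<dots> = \<bar>real_of_int (S $$ (i, j))\<bar> * (\<bar>v i\<bar> * \<bar>v j\<bar>)" by (simp add: abs_mult)
    also have "\<dots> \<le> \<bar>real_of_int (S $$ (i, j))\<bar> * (r * r)"
      using ij by (intro mult_left_mono mult_mono) auto
    finally show "v i * real_of_int (S $$ (i, j)) * v j \<le> \<bar>real_of_int (S $$ (i, j))\<bar> * r\<^sup>2"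
      by (simp add: power2_eq_square)
  qed
  then show "sf v v \<le> (\<Sum>i<n. \<Sum>j<n. \<bar>real_of_int (S $$ (i, j))\<bar>) * r\<^sup>2"
    by (simp add: sum_distrib_right)
qed (simp add: sum_nonneg)

section \<open>Vectors given by their coordinates at \<open>e1\<close>, \<open>e2\<close>, the
  middle block, \<open>f2\<close>, \<open>f1\<close>\<close>

definition mkv :: "real \<Rightarrow> real \<Rightarrow> (nat \<Rightarrow> real) \<Rightarrow> real \<Rightarrow> real \<Rightarrow> real vec" where
  "mkv a b \<phi> c d = vec (n + 4) (\<lambda>i. if i = 0 then a else if i = 1 then b else if i < n + 2 then \<phi> (i - 2)
     else if i = n + 2 then c else d)"

lemma mkv_carrier [simp]: "mkv a b \<phi> c d \<in> V"
  by (simp add: mkv_def)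

lemma mkv_index:
  "mkv a b \<phi> c d $ 0 = a" "mkv a b \<phi> c d $ 1 = b" "k < n \<Longrightarrow> mkv a b \<phi> c d $ (k + 2) = \<phi> k"
  "mkv a b \<phi> c d $ (n + 2) = c" "mkv a b \<phi> c d $ (n + 3) = d"
  by (simp_all add: mkv_def)

lemma bl_mkv:
  "bl (mkv a b \<phi> c d) x = a * x $ (n+3) + d * x $ 0 + b * x $ (n+2) + c * x $ 1 - sf \<phi> (\<lambda>i. x $ (i+2))"
proof -
  have "sf (\<lambda>i. mkv a b \<phi> c d $ (i+2)) w = sf \<phi> w" for w
    by (rule sf_cong) (simp_all only: mkv_index)
  then show ?thesis unfolding bl_def mkv_index by simp
qed

lemma bl_mkv_mkv:
  "bl (mkv a b \<phi> c d) (mkv a' b' \<phi>' c' d') = a * d' + d * a' + b * c' + c * b' - sf \<phi> \<phi>'"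
proof -
  have "sf w (\<lambda>i. mkv a' b' \<phi>' c' d' $ (i+2)) = sf w \<phi>'" for w
    by (rule sf_cong) (simp_all only: mkv_index)
  then show ?thesis unfolding bl_mkv mkv_index by simp
qed

lemma mkv_eqI:
  assumes "x \<in> V" "x $ 0 = a" "x $ 1 = b" "\<And>k. k < n \<Longrightarrow> x $ (k+2) = \<phi> k" "x $ (n+2) = c" "x $ (n+3) = d"
  shows "x = mkv a b \<phi> c d"
proof (rule eq_vecI)
  fix i assume "i < dim_vec (mkv a b \<phi> c d)"
  then have "i < n + 4" by (simp add: mkv_def)
  then show "x $ i = mkv a b \<phi> c d $ i"
    by (cases rule: index_four_cases) (use assms in \<open>simp_all only: mkv_index\<close>)
qed (use assms in \<open>simp add: mkv_def\<close>)

lemma mkv_intv: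
  assumes "a \<in> \<int>" "b \<in> \<int>" "\<And>k. k < n \<Longrightarrow> \<phi> k \<in> \<int>" "c \<in> \<int>" "d \<in> \<int>"
  shows "intv (mkv a b \<phi> c d)"
  unfolding intv_def
proof (intro conjI allI impI)
  fix i assume "i < n + 4"
  then show "mkv a b \<phi> c d $ i \<in> \<int>"
    by (cases rule: index_four_cases) (use assms in \<open>simp_all only: mkv_index\<close>)
qed simp

lemma mkv_e1: "e1 = mkv 1 0 (\<lambda>_. 0) 0 0" and mkv_f1: "f1 = mkv 0 0 (\<lambda>_. 0) 0 1"
  and mkv_e2: "e2 = mkv 0 1 (\<lambda>_. 0) 0 0"
  by (rule mkv_eqI; simp add: basis_defs)+

lemma mkv_comb: "s \<cdot>\<^sub>v mkv a b \<phi> c d + t \<cdot>\<^sub>v mkv a' b' \<phi>' c' d' =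
    mkv (s * a + t * a') (s * b + t * b') (\<lambda>k. s * \<phi> k + t * \<phi>' k) (s * c + t * c') (s * d + t * d')"
  by (rule mkv_eqI; simp add: mkv_def)

text \<open>The real isotropic vector \<open>z\<close>, orthogonal to \<open>e1\<close>, is tested against the integral isotropic vectors
  \<open>(0, q(\<mu>), m\<mu>, m\<^sup>2, 0)\<close>: if \<open>\<theta>\<close> is the middle part of \<open>z\<close> over its coordinate \<open>c\<close> at \<open>f2\<close>, the value is
  \<open>c q(m\<theta> - \<mu>)\<close>, which Dirichlet's theorem makes small.\<close>

lemma isotropic_direction_integral:
  assumes z: "z \<in> V" "bl z z = 0" "bl z e1 = 0"
    and quant: "\<And>f. intv f \<Longrightarrow> bl f f = 0 \<Longrightarrow> bl f e1 = 0 \<Longrightarrow> bl f z = 0 \<or> \<bar>bl f z\<bar> \<ge> 1"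
  shows "\<exists>w w' s t. intv w \<and> intv w' \<and> bl w w = 0 \<and> bl w' w' = 0 \<and> bl w e1 = 0 \<and> bl w' e1 = 0
    \<and> bl w f1 = 0 \<and> bl w' f1 = 0 \<and> bl w w' \<noteq> 0 \<and> z = s \<cdot>\<^sub>v w + t \<cdot>\<^sub>v e1"
proof -
  define a where "a = z $ 0"
  define b where "b = z $ 1"
  define \<zeta> where "\<zeta> k = z $ (k+2)" for k
  define c where "c = z $ (n+2)"
  have d: "z $ (n+3) = 0" using z by (simp add: bl_unit_right)
  have zc: "z $ 0 = a" "z $ 1 = b" "z $ (n+2) = c" "z $ (n+3) = 0" by (simp_all add: a_def b_def c_def d)
  have zm: "z = mkv a b \<zeta> c 0"
    by (rule mkv_eqI) (use z d in \<open>simp_all add: a_def b_def c_def \<zeta>_def\<close>)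
  have iso: "2 * b * c = sf \<zeta> \<zeta>" using z(2) unfolding zm bl_mkv_mkv by simp
  show ?thesis
  proof (cases "c = 0")
    case True
    \<comment> \<open>Definiteness kills the middle block, so \<open>z\<close> lies in the span of
      \<open>e1\<close> and \<open>e2\<close>.\<close>
    then have "\<zeta> k = 0" if "k < n" for k using iso sf_eq_0 that by simp
    then have "z = b \<cdot>\<^sub>v e2 + a \<cdot>\<^sub>v e1"
      unfolding mkv_e1 mkv_e2 mkv_comb by (intro mkv_eqI) (use True in \<open>simp_all add: zm mkv_def\<close>)
    then show ?thesis by (intro exI[of _ e2] exI[of _ f2] exI[of _ b] exI[of _ a]) simp
  next
    case False
    define \<theta> where "\<theta> k = \<zeta> k / c" for k
    obtain C where C: "C \<ge> 0" "\<And>v r. (\<forall>i<n. \<bar>v i\<bar> \<le> r) \<Longrightarrow> sf v v \<le> C * r\<^sup>2"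
      using sf_bound by blast
    \<comment> \<open>An approximation error below \<open>1 / N\<close> in each coordinate bounds
      the tested value by \<open>\<bar>c\<bar> / 2 * C / N^2\<close>, which this \<open>N\<close>
      pushes below the gap 1.\<close>
    define N where "N = nat \<lceil>\<bar>c\<bar> * C\<rceil> + 1"
    have N: "N > 0" "real N > \<bar>c\<bar> * C" unfolding N_def by linarith+
    obtain q p where qp: "0 < q" "\<And>i. i < n \<Longrightarrow> \<bar>of_int q * \<theta> i - of_int (p i)\<bar> < 1 / N"
      using Dirichlet_approx_simult[OF N(1), of n \<theta>] by metis
    define m where "m = real_of_int q"
    define \<mu> where "\<mu> k = real_of_int (p k)" for k
    define w where "w = mkv 0 (sf \<mu> \<mu> / 2) (\<lambda>k. m * \<mu> k) (m\<^sup>2) 0"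
    have w: "intv w" "bl w w = 0" "bl w e1 = 0" "bl w f1 = 0" "bl w e2 = m\<^sup>2"
    proof -
      show "intv w" unfolding w_def by (intro mkv_intv sf_even) (simp_all add: m_def \<mu>_def)
    qed (simp_all add: w_def mkv_e1 mkv_f1 mkv_e2 bl_mkv_mkv sf_scale_left sf_scale_right power2_eq_square)
    define v where "v k = m * \<theta> k - \<mu> k" for k
    have v: "sf v v = m\<^sup>2 * sf \<theta> \<theta> - 2 * m * sf \<theta> \<mu> + sf \<mu> \<mu>"
    proof -
      have "v = (\<lambda>k. m * \<theta> k + (-1) * \<mu> k)" by (simp add: v_def fun_eq_iff)
      then have "sf v v = sf (\<lambda>k. m * \<theta> k + (-1) * \<mu> k) (\<lambda>k. m * \<theta> k + (-1) * \<mu> k)" by simp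
      also have "\<dots> = m * (m * sf \<theta> \<theta> + (-1) * sf \<theta> \<mu>) + (-1) * (m * sf \<mu> \<theta> + (-1) * sf \<mu> \<mu>)"
        by (simp only: sf_add_left sf_add_right sf_scale_left sf_scale_right distrib_left)
      finally show ?thesis by (simp add: sf_commute[of \<mu> \<theta>] power2_eq_square algebra_simps)
    qed
    have \<zeta>: "\<zeta> = (\<lambda>k. c * \<theta> k)" using False by (simp add: \<theta>_def fun_eq_iff)
    have b: "b = c * sf \<theta> \<theta> / 2"
      using iso False unfolding \<zeta> by (simp add: sf_scale_left sf_scale_right field_simps)
    have wz: "bl w z = c / 2 * sf v v"
      unfolding w_def zm bl_mkv_mkv v b \<zeta>
      by (simp add: sf_scale_left sf_scale_right sf_commute[of \<mu> \<theta>] field_simps)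
    have "sf v v \<le> C * (1 / N)\<^sup>2"
      by (intro C(2) allI impI) (use qp(2) in \<open>force simp: v_def m_def \<mu>_def\<close>)
    then have "\<bar>bl w z\<bar> \<le> \<bar>c\<bar> / 2 * (C * (1 / N)\<^sup>2)"
      unfolding wz abs_mult using sf_nonneg[of v] by (simp add: mult_left_mono)
    also have "\<dots> < 1"
    proof -
      have "\<bar>c\<bar> * C < real N * real N"
        using N by (smt (verit, best) mult_le_cancel_left1 of_nat_less_iff of_nat_1 One_nat_def Suc_leI of_nat_mono)
      moreover have "0 \<le> real N * real N" by simp
      ultimately have "\<bar>c\<bar> * C < real N * (real N * 2)" by linarith
      then show ?thesis using N(1) C(1) by (simp add: power2_eq_square field_simps)
    qed
    \<comment> \<open>The value lies in the gap, hence is 0. Definiteness then turns the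
      approximation into the equality \<open>m * \<theta> k = \<mu> k\<close>.\<close>
    finally have "bl w z = 0" using quant[OF w(1-3)] by linarith
    then have "sf v v = 0" using wz False by simp
    then have v0: "m * \<theta> k = \<mu> k" if "k < n" for k using sf_eq_0[of v k] that by (simp add: v_def)
    have m: "m \<noteq> 0" using qp(1) by (simp add: m_def)
    have "sf \<mu> \<mu> = sf (\<lambda>k. m * \<theta> k) (\<lambda>k. m * \<theta> k)" by (rule sf_cong) (simp_all add: v0)
    then have s\<mu>: "sf \<mu> \<mu> = m\<^sup>2 * sf \<theta> \<theta>" by (simp add: sf_scale_left sf_scale_right power2_eq_square)
    have "z = (c / m\<^sup>2) \<cdot>\<^sub>v w + a \<cdot>\<^sub>v e1"
      unfolding mkv_e1 w_def mkv_comb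
    proof (rule mkv_eqI)
      fix k assume k: "k < n"
      have "z $ (k + 2) = c * \<theta> k" using k by (simp only: zm \<zeta> mkv_index)
      also have "\<dots> = c / m\<^sup>2 * (m * \<mu> k) + a * 0" using m v0[OF k, symmetric] by (simp add: power2_eq_square)
      finally show "z $ (k + 2) = c / m\<^sup>2 * (m * \<mu> k) + a * 0" .
    qed (use z m zc in \<open>simp_all add: s\<mu> b[symmetric]\<close>)
    \<comment> \<open>The partner \<open>e2\<close> pairs with \<open>w\<close> to
      \<open>m^2\<close>, which is nonzero.\<close>
    then show ?thesis
      by (intro exI[of _ w] exI[of _ e2] exI[of _ "c / m\<^sup>2"] exI[of _ a]) (use w m in simp)
  qed
qed

text \<open>The bivector \<open>x1 \<and> x2\<close> as a skew endomorphism; see \<open>E_mult_vec\<close> for isotropic arguments.\<close>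

definition wedge :: "real vec \<Rightarrow> real vec \<Rightarrow> real vec \<Rightarrow> real vec" where
  "wedge x1 x2 v = bl x1 v \<cdot>\<^sub>v x2 + (- bl x2 v) \<cdot>\<^sub>v x1"

lemma wedge_carrier [simp]: "x1 \<in> V \<Longrightarrow> x2 \<in> V \<Longrightarrow> wedge x1 x2 v \<in> V"
  by (simp add: wedge_def)

lemma bl_wedge:
  assumes "x1 \<in> V" "x2 \<in> V"
  shows "bl w (wedge x1 x2 v) = bl x1 v * bl w x2 - bl x2 v * bl w x1"
  using assms by (simp add: wedge_def bl_lin)

text \<open>The gap from Shimizu's lemma, stated for a real isotropic plane against integral ones.
  No discrete group occurs in it, so it can be transported freely by elements of
  \<open>T\<close>.\<close>

definition quantized :: "real vec \<Rightarrow> real vec \<Rightarrow> bool" where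
  "quantized x1 x2 \<longleftrightarrow> x1 \<in> V \<and> x2 \<in> V \<and> bl x1 x1 = 0 \<and> bl x2 x2 = 0 \<and> bl x1 x2 = 0 \<and>
     (\<forall>e f. intv e \<longrightarrow> intv f \<longrightarrow> bl e e = 0 \<longrightarrow> bl f f = 0 \<longrightarrow> bl e f = 0 \<longrightarrow>
        bl f (wedge x1 x2 e) = 0 \<or> \<bar>bl f (wedge x1 x2 e)\<bar> \<ge> 1)"

text \<open>With \<open>z = wedge x1 x2 e1 = s w + t e1\<close> and \<open>k = bl w w'\<close>, the test against \<open>l e1 + m w\<close> and \<open>- m k f1 + l w'\<close>
  gives \<open>s k (l - m t / s)\<^sup>2\<close>.\<close>

lemma quantized_wedge_e1:
  assumes q: "quantized x1 x2"
  shows "\<exists>r w. intv w \<and> bl w w = 0 \<and> wedge x1 x2 e1 = r \<cdot>\<^sub>v w"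
proof -
  have xV: "x1 \<in> V" "x2 \<in> V" and iso: "bl x1 x1 = 0" "bl x2 x2 = 0" "bl x1 x2 = 0" "bl x2 x1 = 0"
    and quant: "\<And>e f. intv e \<Longrightarrow> intv f \<Longrightarrow> bl e e = 0 \<Longrightarrow> bl f f = 0 \<Longrightarrow> bl e f = 0 \<Longrightarrow>
        bl f (wedge x1 x2 e) = 0 \<or> \<bar>bl f (wedge x1 x2 e)\<bar> \<ge> 1"
    using q by (auto simp: quantized_def bl_commute)
  define z where "z = wedge x1 x2 e1"
  \<comment> \<open>The plane of \<open>x1\<close> and \<open>x2\<close> is totally isotropic, so
    \<open>z\<close>, lying in it, is isotropic and orthogonal to both; orthogonality to
    \<open>e1\<close> is skewness.\<close>
  have z: "z \<in> V" "bl z z = 0" "bl z e1 = 0" "bl x1 z = 0" "bl x2 z = 0"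
    using xV iso by (simp_all add: z_def bl_wedge) (simp_all add: wedge_def bl_lin)
  obtain w w' s t where w: "intv w" "intv w'" "bl w w = 0" "bl w' w' = 0" "bl w e1 = 0" "bl w' e1 = 0"
      "bl w f1 = 0" "bl w' f1 = 0" "bl w w' \<noteq> 0" and zw: "z = s \<cdot>\<^sub>v w + t \<cdot>\<^sub>v e1"
    using isotropic_direction_integral[OF z(1-3)] quant[of e1] unfolding z_def
    by (metis bl_commute intv_basis(1) bl_basis(1))
  have wV: "w \<in> V" "w' \<in> V" using w by auto
  show ?thesis
  proof (cases "s = 0")
    case True
    then have "z = t \<cdot>\<^sub>v e1" using wV zw by (auto intro!: eq_vecI)
    then show ?thesis unfolding z_def by (intro exI[of _ t] exI[of _ e1]) simp
  next
    case False
    define \<tau> where "\<tau> = t / s"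
    define k where "k = bl w w'"
    have k: "k \<in> \<int>" "k \<noteq> 0" using w bl_int by (simp_all add: k_def)
    define N where "N = nat \<lceil>\<bar>s * k\<bar>\<rceil> + 1"
    have N: "N > 0" "real N > \<bar>s * k\<bar>" unfolding N_def by linarith+
    obtain p q where qp: "0 < q" "\<bar>of_int q * \<tau> - of_int p\<bar> < 1 / N"
      using Dirichlet_approx[OF N(1), of \<tau>] by metis
    define m where "m = real_of_int q"
    define l where "l = real_of_int p"
    have ml: "m \<in> \<int>" "l \<in> \<int>" "m \<noteq> 0" using qp by (simp_all add: m_def l_def)
    define e where "e = l \<cdot>\<^sub>v e1 + m \<cdot>\<^sub>v w"
    define f where "f = (- m * k) \<cdot>\<^sub>v f1 + l \<cdot>\<^sub>v w'"
    have sym: "bl e1 w = 0" "bl e1 w' = 0" "bl f1 w = 0" "bl f1 w' = 0" "bl w' w = k"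
      using w by (simp_all add: bl_commute k_def)
    have ef: "intv e" "intv f" "bl e e = 0" "bl f f = 0" "bl e f = 0"
      unfolding e_def f_def using w ml k wV sym k_def[symmetric]
      by (simp_all add: intv_add intv_smult bl_lin)
    \<comment> \<open>In pairings with vectors orthogonal to \<open>z\<close>, in particular
      \<open>x1\<close> and \<open>x2\<close>, \<open>w\<close> may be replaced by
      \<open>- \<tau>\<close> times \<open>e1\<close>. This yields one factor
      \<open>l - m * \<tau>\<close>; the pairing of \<open>f\<close> with \<open>z\<close> yields
      the other.\<close>
    have xw: "bl x w = - \<tau> * bl x e1" if "bl x z = 0" for x
      using that False wV unfolding zw by (simp add: bl_lin \<tau>_def field_simps)
    have xe: "bl x e = (l - m * \<tau>) * bl x e1" if "bl x z = 0" for x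
      unfolding e_def using xw[OF that] wV by (simp add: bl_lin algebra_simps)
    have "bl f (wedge x1 x2 e) = (l - m * \<tau>) * bl f z"
      using xV z by (simp add: z_def bl_wedge xe algebra_simps)
    also have "bl f z = s * k * (l - m * \<tau>)"
      unfolding f_def zw using wV sym False w by (simp add: bl_lin \<tau>_def field_simps)
    finally have val: "bl f (wedge x1 x2 e) = s * k * (l - m * \<tau>)\<^sup>2" by (simp add: power2_eq_square)
    have "\<bar>l - m * \<tau>\<bar> \<le> 1 / N" using qp(2) by (simp add: l_def m_def)
    then have "(l - m * \<tau>)\<^sup>2 \<le> (1 / N)\<^sup>2" by (metis abs_ge_zero power2_abs power_mono)
    then have "\<bar>bl f (wedge x1 x2 e)\<bar> \<le> \<bar>s * k\<bar> * (1 / N)\<^sup>2"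
      unfolding val by (simp add: abs_mult mult_left_mono)
    also have "\<dots> < 1"
    proof -
      have "\<bar>s * k\<bar> < real N * real N"
        using N by (smt (verit, best) mult_le_cancel_left1 of_nat_less_iff of_nat_1 One_nat_def Suc_leI of_nat_mono)
      then show ?thesis using N(1) by (simp add: power2_eq_square field_simps)
    qed
    finally have "bl f (wedge x1 x2 e) = 0" using quant[OF ef] by linarith
    \<comment> \<open>So \<tau> is rational, and \<open>z\<close> is proportional to the integral
      vector \<open>e\<close>.\<close>
    then have "l = m * \<tau>" using val False k by simp
    then have "z = (s / m) \<cdot>\<^sub>v e"
      unfolding zw e_def using wV ml(3) False by (intro eq_vecI) (simp_all add: \<tau>_def field_simps)
    then show ?thesis using ef(1,3) unfolding z_def by blast
  qed
qed

end

context eichler_group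
begin

text \<open>By transitivity \<open>v\<close> is a multiple of the image of \<open>e1\<close> under
  some \<open>g\<close> in \<open>T\<close>. Pulling \<open>x1\<close> and \<open>x2\<close> back by
  \<open>g\<close> preserves \<open>quantized\<close>, as \<open>g\<close> permutes the integral
  test pairs, and reduces to \<open>e1\<close>.\<close>

lemma quantized_wedge:
  assumes q: "quantized x1 x2" and v: "intv v" "bl v v = 0"
  shows "\<exists>r w. intv w \<and> bl w w = 0 \<and> wedge x1 x2 v = r \<cdot>\<^sub>v w"
proof (cases "v = 0\<^sub>v (n + 4)")
  case True
  have x: "x1 \<in> V" "x2 \<in> V" using q by (auto simp: quantized_def)
  have "wedge x1 x2 v = 0 \<cdot>\<^sub>v e1" using x True unfolding wedge_def by (auto intro!: eq_vecI)
  then show ?thesis using intv_basis(1) bl_basis(1) by blast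
next
  case False
  obtain g a where g: "g \<in> T" and va: "v = a \<cdot>\<^sub>v (g *\<^sub>v e1)" using isotropic_transitive[OF v False] by blast
  obtain h where h: "h \<in> T" "g * h = 1\<^sub>m (n + 4)" "h * g = 1\<^sub>m (n + 4)" using T_inv[OF g] by blast
  have gM: "isom g" "g \<in> M" "isom h" "h \<in> M" using g h T_isom isom_carrier by auto
  have x: "x1 \<in> V" "x2 \<in> V" using q by (auto simp: quantized_def)
  let ?y1 = "h *\<^sub>v x1" and ?y2 = "h *\<^sub>v x2"
  have yV: "?y1 \<in> V" "?y2 \<in> V" using x gM by auto
  have tr: "bl (h *\<^sub>v y) u = bl y (g *\<^sub>v u)" if "y \<in> V" "u \<in> V" for y u
    using isom_bl[OF gM(1), of "h *\<^sub>v y" u] inverse_vec[OF gM(2,4) h(2)] that gM by simp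
  have w_eq: "g *\<^sub>v wedge ?y1 ?y2 u = wedge x1 x2 (g *\<^sub>v u)" if "u \<in> V" for u
  proof -
    have "g *\<^sub>v wedge ?y1 ?y2 u = bl ?y1 u \<cdot>\<^sub>v (g *\<^sub>v ?y2) + (- bl ?y2 u) \<cdot>\<^sub>v (g *\<^sub>v ?y1)"
      unfolding wedge_def using gM yV
      by (subst mult_add_distrib_mat_vec[where nr="n+4" and nc="n+4"]) (simp_all add: mult_mat_smult_vec)
    then show ?thesis unfolding wedge_def using tr that x inverse_vec[OF gM(2,4) h(2)] by simp
  qed
  have "quantized ?y1 ?y2"
    unfolding quantized_def
  proof (intro conjI allI impI)
    fix e f assume ef: "intv e" "intv f" "bl e e = 0" "bl f f = 0" "bl e f = 0"
    have "bl f (wedge ?y1 ?y2 e) = bl (g *\<^sub>v f) (wedge x1 x2 (g *\<^sub>v e))"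
      using isom_bl[OF gM(1), of f "wedge ?y1 ?y2 e"] ef yV by (simp add: w_eq)
    moreover have "bl (g *\<^sub>v f) (wedge x1 x2 (g *\<^sub>v e)) = 0 \<or> \<bar>bl (g *\<^sub>v f) (wedge x1 x2 (g *\<^sub>v e))\<bar> \<ge> 1"
      using q ef T_intv[OF g] isom_bl[OF gM(1)] unfolding quantized_def by simp
    ultimately show "bl f (wedge ?y1 ?y2 e) = 0 \<or> \<bar>bl f (wedge ?y1 ?y2 e)\<bar> \<ge> 1" by simp
  qed (use q yV isom_bl[OF gM(3)] x in \<open>simp_all add: quantized_def\<close>)
  then obtain r w where w: "intv w" "bl w w = 0" "wedge ?y1 ?y2 e1 = r \<cdot>\<^sub>v w"
    using quantized_wedge_e1 by blast
  have "wedge x1 x2 v = a \<cdot>\<^sub>v wedge x1 x2 (g *\<^sub>v e1)"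
    unfolding va wedge_def using x gM by (intro eq_vecI) (simp_all add: bl_lin algebra_simps)
  also have "\<dots> = a \<cdot>\<^sub>v (g *\<^sub>v (r \<cdot>\<^sub>v w))" using w_eq[of e1] w by simp
  also have "\<dots> = (a * r) \<cdot>\<^sub>v (g *\<^sub>v w)"
    using gM w by (simp add: mult_mat_smult_vec smult_smult_assoc)
  finally show ?thesis using T_intv[OF g w(1)] isom_bl[OF gM(1)] w by (metis intv_carrier)
qed

end

section \<open>Integrality of overgroups\<close>

locale normalizing_group = discrete_overgroup +
  fixes H :: "real mat set"
  assumes H_isom: "g \<in> H \<Longrightarrow> isom g"
    and H_mult: "g \<in> H \<Longrightarrow> h \<in> H \<Longrightarrow> g * h \<in> H"
    and H_inv: "g \<in> H \<Longrightarrow> \<exists>h\<in>H. g * h = 1\<^sub>m (n + 4) \<and> h * g = 1\<^sub>m (n + 4)"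
    and T_H: "T \<subseteq> H"
    and H_conj: "g \<in> H \<Longrightarrow> h \<in> H \<Longrightarrow> g * h = 1\<^sub>m (n + 4) \<Longrightarrow> t \<in> T \<Longrightarrow> g * t * h \<in> D"
begin

lemma H_carrier: "g \<in> H \<Longrightarrow> g \<in> M"
  using H_isom isom_carrier by blast

lemma H_vec_mult: "g \<in> H \<Longrightarrow> h \<in> H \<Longrightarrow> x \<in> V \<Longrightarrow> (g * h) *\<^sub>v x = g *\<^sub>v (h *\<^sub>v x)"
  using H_carrier by (meson assoc_mult_mat_vec)

lemma H_conj_E:
  assumes g: "g \<in> H" and eu: "intv e" "intv u" "bl e e = 0" "bl e u = 0"
  shows "E (g *\<^sub>v e) (g *\<^sub>v u) \<in> D"
proof -
  obtain h where h: "h \<in> H" "g * h = 1\<^sub>m (n + 4)" using H_inv[OF g] by blast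
  have "g * E e u * h = E (g *\<^sub>v e) (g *\<^sub>v u)"
    by (rule E_conj) (use g h H_isom H_carrier eu in auto)
  then show ?thesis using H_conj[OF g h T_E[OF eu]] by simp
qed

text \<open>Shimizu's lemma is applied to \<open>E e0 f0\<close>, which lies in \<open>T\<close>,
  and to the conjugate of \<open>E e f\<close> by \<open>g\<close>, which lies in \<open>D\<close>.
  Up to sign its pairing is the one tested in \<open>quantized\<close>.\<close>

lemma quantized_H:
  assumes g: "g \<in> H" and ef: "intv e" "intv f" "bl e e = 0" "bl f f = 0" "bl e f = 0"
  shows "quantized (g *\<^sub>v e) (g *\<^sub>v f)"
  unfolding quantized_def
proof (intro conjI allI impI)
  fix e0 f0 assume 0: "intv e0" "intv f0" "bl e0 e0 = 0" "bl f0 f0 = 0" "bl e0 f0 = 0"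
  let ?e = "g *\<^sub>v e" and ?f = "g *\<^sub>v f"
  have V: "?e \<in> V" "?f \<in> V" using ef H_isom[OF g] by auto
  have "bl e0 ?f * bl f0 ?e - bl e0 ?e * bl f0 ?f = 0 \<or> \<bar>bl e0 ?f * bl f0 ?e - bl e0 ?e * bl f0 ?f\<bar> \<ge> 1"
    by (rule shimizu)
      (use 0 V ef isom_bl[OF H_isom[OF g]] H_conj_E[OF g ef(1-3) ef(5)] T_E[OF 0(1-3) 0(5)] T_D in auto)
  moreover have "bl f0 (wedge ?e ?f e0) = - (bl e0 ?f * bl f0 ?e - bl e0 ?e * bl f0 ?f)"
    using V by (simp add: bl_wedge bl_commute[of ?e e0] bl_commute[of ?f e0])
  ultimately show "bl f0 (wedge ?e ?f e0) = 0 \<or> \<bar>bl f0 (wedge ?e ?f e0)\<bar> \<ge> 1" by linarith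
qed (use ef isom_bl[OF H_isom[OF g]] H_isom[OF g] in auto)

text \<open>The composition of the bivectors \<open>x \<and> g e2\<close> and \<open>x \<and> g f2\<close> with \<open>x = g e1\<close> is \<open>- \<langle>x, \<sqdot>\<rangle> x\<close>.\<close>

lemma image_e1_direction:
  assumes g: "g \<in> H"
  shows "\<exists>t\<in>T. \<exists>a. a \<noteq> 0 \<and> g *\<^sub>v e1 = a \<cdot>\<^sub>v (t *\<^sub>v e1)"
proof -
  note iso = isom_bl[OF H_isom[OF g]]
  define x y y' where "x = g *\<^sub>v e1" and "y = g *\<^sub>v e2" and "y' = g *\<^sub>v f2"
  have V: "x \<in> V" "y \<in> V" "y' \<in> V" using H_isom[OF g] by (simp_all add: x_def y_def y'_def)
  have b: "bl x x = 0" "bl x y = 0" "bl x y' = 0" "bl y y' = 1" "bl y x = 0" "bl y' x = 0"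
    using iso by (simp_all add: x_def y_def y'_def)
  have x0: "x \<noteq> 0\<^sub>v (n + 4)" using iso[of e1 f1] by (auto simp: x_def)
  \<comment> \<open>One of the four hyperbolic basis vectors serves as \<open>v\<close>, since
    \<open>x\<close> is isotropic and nonzero.\<close>
  obtain v where v: "intv v" "bl v v = 0" "bl x v \<noteq> 0"
    using isotropic_pairing_nonzero[OF V(1) b(1) x0] bl_commute bl_basis intv_basis by metis
  have q: "quantized x y" "quantized x y'"
    unfolding x_def y_def y'_def by (rule quantized_H[OF g]; simp)+
  obtain r w where w: "intv w" "bl w w = 0" "wedge x y' v = r \<cdot>\<^sub>v w"
    using quantized_wedge[OF q(2) v(1,2)] by blast
  \<comment> \<open>\<open>w\<close> is again integral and isotropic, so the rationality result
    applies a second time.\<close>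
  obtain r' w' where w': "intv w'" "bl w' w' = 0" "wedge x y w = r' \<cdot>\<^sub>v w'"
    using quantized_wedge[OF q(1) w(1,2)] by blast
  have "wedge x y (wedge x y' v) = (- bl x v) \<cdot>\<^sub>v x"
  proof -
    have "bl x (wedge x y' v) = 0" "bl y (wedge x y' v) = bl x v" using V b by (simp_all add: bl_wedge)
    then show ?thesis using V unfolding wedge_def[of x y] by (auto intro!: eq_vecI)
  qed
  moreover have "wedge x y (wedge x y' v) = r \<cdot>\<^sub>v wedge x y w"
    unfolding w(3) wedge_def[of x y] using V w(1) by (intro eq_vecI) (simp_all add: bl_lin algebra_simps)
  ultimately have "(- bl x v) \<cdot>\<^sub>v x = (r * r') \<cdot>\<^sub>v w'" unfolding w' by (simp add: smult_smult_assoc)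
  then have "(- 1 / bl x v) \<cdot>\<^sub>v ((- bl x v) \<cdot>\<^sub>v x) = (- 1 / bl x v) \<cdot>\<^sub>v ((r * r') \<cdot>\<^sub>v w')" by simp
  then have xw: "x = (- r * r' / bl x v) \<cdot>\<^sub>v w'" using v(3) by (simp add: smult_smult_assoc)
  then have w'0: "w' \<noteq> 0\<^sub>v (n + 4)" "- r * r' / bl x v \<noteq> 0"
  proof -
    show "w' \<noteq> 0\<^sub>v (n + 4)"
    proof
      assume "w' = 0\<^sub>v (n + 4)"
      then have "x = 0\<^sub>v (n + 4)" by (subst xw) auto
      then show False using x0 by simp
    qed
    show "- r * r' / bl x v \<noteq> 0"
    proof
      assume *: "- r * r' / bl x v = 0"
      have "x = 0\<^sub>v (n + 4)" by (subst xw, unfold *) (use intv_carrier[OF w'(1)] in auto)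
      then show False using x0 by simp
    qed
  qed
  obtain t a where t: "t \<in> T" "a \<noteq> 0" "w' = a \<cdot>\<^sub>v (t *\<^sub>v e1)"
    using isotropic_transitive[OF w'(1,2) w'0(1)] by blast
  have "x = (- r * r' / bl x v * a) \<cdot>\<^sub>v (t *\<^sub>v e1)" by (subst xw) (simp add: t(3) smult_smult_assoc)
  moreover have "- r * r' / bl x v * a \<noteq> 0" using w'0(2) t(2) by (metis mult_eq_0_iff)
  ultimately show ?thesis using t(1) unfolding x_def by blast
qed

text \<open>Apart from the term with \<open>qf w\<close>, the entries of the difference are linear
  in \<open>w\<close>. Restricting to \<open>r \<le> 1\<close> absorbs the quadratic term into a
  linear bound.\<close>

lemma E_e1_near_one:
  "\<exists>C>0. \<forall>w r. w \<in> V \<longrightarrow> r \<le> 1 \<longrightarrow> (\<forall>i<n+4. \<bar>w $ i\<bar> \<le> r) \<longrightarrow>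
    (\<forall>i<n+4. \<forall>j<n+4. \<bar>E e1 w $$ (i, j) - 1\<^sub>m (n + 4) $$ (i, j)\<bar> \<le> C * r)"
proof -
  let ?u = "\<lambda>j. unit_vec (n + 4) j :: real vec"
  define K where "K = (\<Sum>i\<in>{0..<n+4}. \<Sum>j\<in>{0..<n+4}. \<bar>bl (?u i) (?u j)\<bar>)"
  have K0: "K \<ge> 0" unfolding K_def by (intro sum_nonneg) auto
  have Kj: "(\<Sum>i\<in>{0..<n+4}. \<bar>bl (?u j) (?u i)\<bar>) \<le> K" if "j < n + 4" for j
    unfolding K_def using that
    by (intro member_le_sum[of j "{0..<n+4}" "\<lambda>j. \<Sum>i\<in>{0..<n+4}. \<bar>bl (?u j) (?u i)\<bar>"]) (auto intro: sum_nonneg)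
  have K1: "\<bar>bl e1 (?u j)\<bar> \<le> K" if "j < n + 4" for j
  proof -
    have "\<bar>bl (?u 0) (?u j)\<bar> \<le> (\<Sum>i\<in>{0..<n+4}. \<bar>bl (?u 0) (?u i)\<bar>)"
      using that by (intro member_le_sum[of j "{0..<n+4}" "\<lambda>i. \<bar>bl (?u 0) (?u i)\<bar>"]) auto
    also have "\<dots> \<le> K" by (rule Kj) simp
    finally show ?thesis by (simp add: e1_def)
  qed
  define C where "C = 2 * K + real (n + 4) * K * K + 1"
  show ?thesis
  proof (intro exI[of _ C] conjI allI impI)
    show "C > 0" using K0 by (simp add: C_def add_nonneg_pos)
    fix w :: "real vec" and r and i j :: nat
    assume w: "w \<in> V" "\<forall>i<n+4. \<bar>w $ i\<bar> \<le> r" and r: "r \<le> 1" and ij: "i < n + 4" "j < n + 4"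
    have r0: "r \<ge> 0" using w(2) by (metis abs_ge_zero order_trans ij(1))
    have L: "\<bar>bl w (?u j)\<bar> \<le> K * r" if "j < n + 4" for j
    proof -
      have "\<bar>bl w (?u j)\<bar> = \<bar>\<Sum>i\<in>{0..<n+4}. bl (?u j) (?u i) * w $ i\<bar>"
        using bl_expand[of "?u j" w] w by (simp add: bl_commute)
      also have "\<dots> \<le> (\<Sum>i\<in>{0..<n+4}. \<bar>bl (?u j) (?u i)\<bar> * r)"
        using w(2) by (intro order_trans[OF sum_abs] sum_mono) (auto simp: abs_mult intro!: mult_left_mono)
      also have "\<dots> \<le> K * r"
        unfolding sum_distrib_right[symmetric] using Kj[OF that] r0 by (rule mult_right_mono)
      finally show ?thesis .
    qed
    have "\<bar>bl w w\<bar> \<le> real (n + 4) * K * r"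
    proof -
      have "\<bar>bl w w\<bar> \<le> (\<Sum>j\<in>{0..<n+4}. \<bar>bl w (?u j) * w $ j\<bar>)"
        using bl_expand[of w w] w by (simp add: sum_abs)
      also have "\<dots> \<le> (\<Sum>j\<in>{0..<n+4}. (K * r) * 1)"
        unfolding abs_mult using L w(2) r K0 r0 by (intro sum_mono mult_mono) (auto intro: order_trans)
      finally show ?thesis by (simp add: algebra_simps)
    qed
    then have q: "\<bar>qf w\<bar> \<le> real (n + 4) * K * r"
      using K0 r0 by (simp add: qf_def)
    have "\<bar>bl e1 (?u j) * w $ i\<bar> \<le> K * r"
      unfolding abs_mult using K1 w(2) ij K0 by (intro mult_mono) auto
    moreover have "\<bar>qf w * bl e1 (?u j)\<bar> \<le> (real (n + 4) * K * r) * K"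
      unfolding abs_mult using q K1[OF ij(2)] K0 r0 by (intro mult_mono) auto
    moreover have "\<bar>(bl w (?u j) + qf w * bl e1 (?u j)) * e1 $ i\<bar> \<le> \<bar>bl w (?u j) + qf w * bl e1 (?u j)\<bar>"
      using ij by (simp add: e1_def unit_vec_def)
    moreover note L[OF ij(2)]
    moreover have "E e1 w $$ (i, j) - 1\<^sub>m (n + 4) $$ (i, j) =
        bl e1 (?u j) * w $ i - (bl w (?u j) + qf w * bl e1 (?u j)) * e1 $ i"
      using ij by (simp add: E_def)
    ultimately have "\<bar>E e1 w $$ (i, j) - 1\<^sub>m (n + 4) $$ (i, j)\<bar> \<le> K * r + (K * r + (real (n + 4) * K * r) * K)"
      by linarith
    also have "\<dots> \<le> C * r" using r0 by (simp add: C_def algebra_simps)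
    finally show "\<bar>E e1 w $$ (i, j) - 1\<^sub>m (n + 4) $$ (i, j)\<bar> \<le> C * r" .
  qed
qed

lemma one_in_T: "1\<^sub>m (n + 4) \<in> T"
proof -
  have "intv (0\<^sub>v (n + 4))" by (simp add: intv_def)
  then show ?thesis using T_E[of e1 "0\<^sub>v (n + 4)"] E_zero[of e1] by simp
qed

lemma E_e1_multiple:
  assumes "w \<in> V" "bl e1 w = 0" "E e1 w \<in> D"
  shows "E e1 (real k \<cdot>\<^sub>v w) \<in> D"
proof (induction k)
  case 0
  have "real 0 \<cdot>\<^sub>v w = 0\<^sub>v (n + 4)" using assms by auto
  then show ?case using one_in_T T_D by (auto simp: E_zero)
next
  case (Suc k)
  have "real (Suc k) \<cdot>\<^sub>v w = real k \<cdot>\<^sub>v w + w" using assms by (auto intro!: eq_vecI simp: algebra_simps)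
  then show ?case using D_mult[OF Suc assms(3)] assms by (simp add: E_add bl_lin)
qed

text \<open>By Dirichlet some multiple \<open>q w\<close>, with \<open>q\<close> bounded
  independently of \<open>w\<close>, is close to an integral vector \<open>P\<close>. The Eichler
  transformation of the difference lies in \<open>D\<close> close to 1, hence is 1, so
  \<open>q w\<close> and \<open>P\<close> agree modulo \<open>e1\<close> and have the same value of
  \<open>qf\<close>.\<close>

lemma E_e1_bounded_denominator:
  "\<exists>N\<ge>1. \<forall>w\<in>V. bl e1 w = 0 \<longrightarrow> E e1 w \<in> D \<longrightarrow> (\<exists>q::nat. 0 < q \<and> q \<le> N \<and> (real q)\<^sup>2 * qf w \<in> \<int>)"
proof -
  obtain \<epsilon> where \<epsilon>: "\<epsilon> > 0" "\<And>h. h \<in> D \<Longrightarrow>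
      (\<forall>i<n+4. \<forall>j<n+4. \<bar>h $$ (i, j) - 1\<^sub>m (n + 4) $$ (i, j)\<bar> < \<epsilon>) \<Longrightarrow> h = 1\<^sub>m (n + 4)"
    using D_discrete[of "1\<^sub>m (n + 4)"] one_in_T T_D by blast
  obtain C where C: "C > 0" "\<And>w r i j. w \<in> V \<Longrightarrow> r \<le> 1 \<Longrightarrow> (\<forall>i<n+4. \<bar>w $ i\<bar> \<le> r) \<Longrightarrow> i < n + 4 \<Longrightarrow> j < n + 4
      \<Longrightarrow> \<bar>E e1 w $$ (i, j) - 1\<^sub>m (n + 4) $$ (i, j)\<bar> \<le> C * r"
    using E_e1_near_one by blast
  define m where "m = nat \<lceil>C / \<epsilon>\<rceil> + 1"
  have m: "m > 0" "real m > C / \<epsilon>" unfolding m_def by linarith+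
  have Cm: "C * (1 / real m) < \<epsilon>" using m \<epsilon>(1) by (simp add: field_simps)
  show ?thesis
  proof (rule exI[of _ "m ^ (n + 4)"], intro conjI ballI impI)
    show "1 \<le> m ^ (n + 4)" using m by simp
    fix w :: "real vec" assume w: "w \<in> V" "bl e1 w = 0" "E e1 w \<in> D"
    obtain q p where qp: "0 < q" "q \<le> int (m ^ (n + 4))"
        "\<And>i. i < n + 4 \<Longrightarrow> \<bar>of_int q * w $ i - of_int (p i)\<bar> < 1 / m"
      using Dirichlet_approx_simult[OF m(1), of "n + 4" "\<lambda>i. w $ i"] by metis
    define P where "P = vec (n + 4) (\<lambda>i. real_of_int (p i))"
    have P: "intv P" "P \<in> V" by (auto simp: P_def intv_def)
    have wn: "w $ (n+3) = 0" using w by (simp add: bl_unit_left)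
    \<comment> \<open>The last coordinate of \<open>w\<close> is 0, and an integer of absolute value
      below 1 vanishes. So \<open>P\<close> is orthogonal to \<open>e1\<close> and defines an
      element of \<open>T\<close>.\<close>
    have "p (n+3) = 0"
    proof -
      have "\<bar>real_of_int (p (n+3))\<bar> < 1 / m" using qp(3)[of "n+3"] by (simp add: wn)
      also have "\<dots> \<le> 1" using m by simp
      finally show ?thesis by linarith
    qed
    then have Pe: "bl e1 P = 0" using P by (simp add: bl_unit_left) (simp add: P_def)
    define X where "X = real (nat q) \<cdot>\<^sub>v w"
    have X: "X \<in> V" "bl e1 X = 0" "E e1 X \<in> D" unfolding X_def using w E_e1_multiple by (simp_all add: bl_lin)
    define R where "R = X + (-1) \<cdot>\<^sub>v P"
    have R: "R \<in> V" "bl e1 R = 0" unfolding R_def using X P Pe by (simp_all add: bl_lin)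
    have "E e1 ((-1) \<cdot>\<^sub>v P) \<in> T" using P Pe by (intro T_E intv_smult) (simp_all add: bl_lin)
    then have "E e1 X * E e1 ((-1) \<cdot>\<^sub>v P) \<in> D" using X T_D D_mult by blast
    then have RD: "E e1 R \<in> D" unfolding R_def using X P Pe by (simp add: E_add bl_lin)
    have "\<forall>i<n+4. \<bar>R $ i\<bar> \<le> 1 / m"
      using qp(1,3) w(1) by (auto simp: R_def X_def P_def intro: less_imp_le)
    then have "\<bar>E e1 R $$ (i, j) - 1\<^sub>m (n + 4) $$ (i, j)\<bar> < \<epsilon>" if "i < n + 4" "j < n + 4" for i j
      using C(2)[OF R(1), of "1 / m" i j] that m Cm by simp
    then have "E e1 R = 1\<^sub>m (n + 4)" using \<epsilon>(2)[OF RD] by blast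
    \<comment> \<open>Evaluation at \<open>f1\<close>, which pairs to 1 with \<open>e1\<close>,
      shows that \<open>R\<close> is a multiple of \<open>e1\<close>.\<close>
    then have "E e1 R *\<^sub>v f1 = f1" by simp
    then have eq: "f1 + (bl e1 f1 \<cdot>\<^sub>v R + (- (bl R f1 + qf R * bl e1 f1)) \<cdot>\<^sub>v e1) = f1"
      using R by (simp add: E_mult_vec del: bl_basis)
    define t where "t = bl R f1 + qf R"
    have Rt: "R = t \<cdot>\<^sub>v e1"
    proof (rule eq_vecI)
      fix i assume "i < dim_vec (t \<cdot>\<^sub>v e1)"
      then show "R $ i = (t \<cdot>\<^sub>v e1) $ i"
        using arg_cong[OF eq, of "\<lambda>v. v $ i"] R(1) by (simp add: t_def algebra_simps)
    qed (use R in simp)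
    have "X = P + t \<cdot>\<^sub>v e1"
    proof -
      have "X = P + R" unfolding R_def using carrier_vecD[OF X(1)] carrier_vecD[OF P(2)] by (intro eq_vecI) simp_all
      then show ?thesis by (simp add: Rt)
    qed
    then have "qf X = qf P" using P Pe by (simp add: qf_def bl_lin bl_commute[of P e1])
    then have "(real (nat q))\<^sup>2 * qf w \<in> \<int>" using qf_int[OF P(1)] w(1)
      unfolding X_def by (simp add: qf_def bl_lin power2_eq_square mult.assoc)
    moreover have "nat q \<le> m ^ (n + 4)" using qp(2) by linarith
    ultimately show "\<exists>q::nat. 0 < q \<and> q \<le> m ^ (n + 4) \<and> (real q)\<^sup>2 * qf w \<in> \<int>"
      using qp(1) by (intro exI[of _ "nat q"]) simp
  qed
qed

lemma H_one: "1\<^sub>m (n + 4) \<in> H"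
  using one_in_T T_H by blast

text \<open>If \<open>a\<close> were below 1 in absolute value, conjugating one Eichler
  transformation by powers of \<open>g\<close> would give elements \<open>E e1 w\<close> of
  \<open>D\<close> with \<open>qf w = (a ^ k)^2\<close> positive and arbitrarily small. Bounded
  denominators forbid this.\<close>

lemma stabilizer_scale_ge_1:
  assumes g: "g \<in> H" "g *\<^sub>v e1 = a \<cdot>\<^sub>v e1"
  shows "\<bar>a\<bar> \<ge> 1"
proof (rule ccontr)
  assume "\<not> ?thesis"
  then have a1: "\<bar>a\<bar> < 1" by simp
  obtain N where N: "N \<ge> 1" "\<And>w. w \<in> V \<Longrightarrow> bl e1 w = 0 \<Longrightarrow> E e1 w \<in> D \<Longrightarrow>
      \<exists>q::nat. 0 < q \<and> q \<le> N \<and> (real q)\<^sup>2 * qf w \<in> \<int>"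
    using E_e1_bounded_denominator by blast
  have a0: "a \<noteq> 0"
  proof
    assume "a = 0"
    then have "g *\<^sub>v e1 = 0\<^sub>v (n + 4)" using g(2) by (auto simp: e1_def)
    then show False using isom_bl[OF H_isom[OF g(1)], of e1 f1] by simp
  qed
  have pow: "\<exists>h\<in>H. h *\<^sub>v e1 = a ^ k \<cdot>\<^sub>v e1" for k
  proof (induction k)
    case 0 then show ?case using H_one by (intro bexI[of _ "1\<^sub>m (n + 4)"]) (auto simp: e1_def)
  next
    case (Suc k)
    then obtain h where h: "h \<in> H" "h *\<^sub>v e1 = a ^ k \<cdot>\<^sub>v e1" by blast
    have "(h * g) *\<^sub>v e1 = a ^ Suc k \<cdot>\<^sub>v e1"
      using h g by (simp add: H_vec_mult mult_mat_smult_vec H_carrier smult_smult_assoc)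
    then show ?case using H_mult[OF h(1) g(1)] by blast
  qed
  have low: "(a ^ k)\<^sup>2 * (real N)\<^sup>2 \<ge> 1" for k
  proof -
    obtain h where h: "h \<in> H" "h *\<^sub>v e1 = a ^ k \<cdot>\<^sub>v e1" using pow by blast
    \<comment> \<open>This vector is integral, orthogonal to \<open>e1\<close>, and has
      \<open>qf\<close> equal to 1.\<close>
    let ?u = "e2 + f2"
    define w where "w = a ^ k \<cdot>\<^sub>v (h *\<^sub>v ?u)"
    have hu: "h *\<^sub>v ?u \<in> V" using H_isom[OF h(1)] by simp
    have "E (h *\<^sub>v e1) (h *\<^sub>v ?u) \<in> D"
      by (rule H_conj_E[OF h(1)]) (simp_all add: intv_add bl_lin)
    then have wD: "E e1 w \<in> D" unfolding h(2) w_def using hu by (simp add: E_scale)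
    have "a ^ k * bl e1 (h *\<^sub>v ?u) = bl (h *\<^sub>v e1) (h *\<^sub>v ?u)" unfolding h(2) by (simp add: bl_lin)
    also have "\<dots> = bl e1 ?u" by (rule isom_bl[OF H_isom[OF h(1)]]) simp_all
    finally have "bl e1 w = 0" unfolding w_def using hu by (simp add: bl_lin)
    moreover have "qf w = (a ^ k)\<^sup>2"
      unfolding w_def using hu isom_qf[OF H_isom[OF h(1)], of ?u] by (simp add: qf_lin)
    ultimately obtain q where q: "0 < q" "q \<le> N" "(real q)\<^sup>2 * (a ^ k)\<^sup>2 \<in> \<int>"
      using N(2)[of w] wD hu unfolding w_def by auto
    have "(real q)\<^sup>2 * (a ^ k)\<^sup>2 > 0" using q(1) a0 by simp
    then have "1 \<le> (real q)\<^sup>2 * (a ^ k)\<^sup>2" using q(3) by (auto elim!: Ints_cases)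
    also have "\<dots> \<le> (real N)\<^sup>2 * (a ^ k)\<^sup>2" using q(2) by (intro mult_right_mono power_mono) auto
    finally show ?thesis by (simp add: mult.commute)
  qed
  have N0: "real N > 0" using N(1) by simp
  have "\<bar>a\<bar>\<^sup>2 < 1" using a1 by (metis abs_ge_zero power2_less_imp_less[of _ 1] abs_square_less_1 power2_abs)
  then obtain k where k: "(\<bar>a\<bar>\<^sup>2) ^ k < 1 / (real N)\<^sup>2"
    using real_arch_pow_inv[of "1 / (real N)\<^sup>2" "\<bar>a\<bar>\<^sup>2"] N0 by auto
  have "(a ^ k)\<^sup>2 = (\<bar>a\<bar>\<^sup>2) ^ k" by (simp add: power_mult[symmetric] mult.commute)
  then have "(a ^ k)\<^sup>2 * (real N)\<^sup>2 < 1" using k N0 by (simp add: field_simps)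
  then show False using low[of k] by linarith
qed

text \<open>The lower bound for scaling factors applies to \<open>s * g\<close>, with factor
  \<open>a\<close>, and to its inverse, with factor \<open>1 / a\<close>.\<close>

lemma image_e1_integral:
  assumes g: "g \<in> H"
  shows "intv (g *\<^sub>v e1)"
proof -
  obtain t a where t: "t \<in> T" "a \<noteq> 0" "g *\<^sub>v e1 = a \<cdot>\<^sub>v (t *\<^sub>v e1)" using image_e1_direction[OF g] by blast
  obtain s where s: "s \<in> T" "s * t = 1\<^sub>m (n + 4)" using T_inv[OF t(1)] by blast
  have sH: "s \<in> H" "t \<in> H" using s t T_H by auto
  note MM = H_carrier[OF sH(1)] H_carrier[OF sH(2)]
  have sg: "s * g \<in> H" by (rule H_mult[OF sH(1) g])
  have e: "(s * g) *\<^sub>v e1 = a \<cdot>\<^sub>v e1"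
    using sH g MM inverse_vec[OF MM s(2), of e1] by (simp add: H_vec_mult t(3) mult_mat_smult_vec)
  obtain h where h: "h \<in> H" "h * (s * g) = 1\<^sub>m (n + 4)" using H_inv[OF sg] by blast
  have "e1 = h *\<^sub>v (a \<cdot>\<^sub>v e1)"
    using inverse_vec[OF H_carrier[OF h(1)] H_carrier[OF sg] h(2), of e1] by (simp add: e)
  also have "\<dots> = a \<cdot>\<^sub>v (h *\<^sub>v e1)" using H_carrier[OF h(1)] by (simp add: mult_mat_smult_vec)
  finally have "(1 / a) \<cdot>\<^sub>v e1 = (1 / a) \<cdot>\<^sub>v (a \<cdot>\<^sub>v (h *\<^sub>v e1))" by simp
  then have "h *\<^sub>v e1 = (1 / a) \<cdot>\<^sub>v e1" using t(2) by (simp add: smult_smult_assoc)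
  then have "\<bar>1 / a\<bar> \<ge> 1" using stabilizer_scale_ge_1[OF h(1)] by blast
  moreover have "\<bar>a\<bar> \<ge> 1" using stabilizer_scale_ge_1[OF sg e] .
  ultimately have "\<bar>a\<bar> = 1" by (simp add: abs_divide field_simps)
  then have "a \<in> \<int>" by (metis Ints_1 Ints_minus abs_if minus_minus)
  then show ?thesis unfolding t(3) using T_intv[OF t(1)] by (simp add: intv_smult)
qed

lemma image_isotropic_integral:
  assumes g: "g \<in> H" and v: "intv v" "bl v v = 0" "v \<noteq> 0\<^sub>v (n + 4)"
  shows "intv (g *\<^sub>v v)"
proof -
  obtain t a where t: "t \<in> T" "a \<in> \<int>" "v = a \<cdot>\<^sub>v (t *\<^sub>v e1)" using isotropic_transitive[OF v] by blast
  have tH: "t \<in> H" using t T_H by auto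
  have "g *\<^sub>v v = a \<cdot>\<^sub>v ((g * t) *\<^sub>v e1)"
    unfolding t(3) using g tH H_isom[OF tH] by (simp add: H_vec_mult mult_mat_smult_vec H_carrier)
  then show ?thesis using image_e1_integral[OF H_mult[OF g tH]] t(2) by (simp add: intv_smult)
qed

text \<open>A basis vector \<open>u\<close> of the middle block is not isotropic, but
  \<open>E f1 u\<close> sends \<open>e1\<close> to an isotropic integral \<open>v\<close> that
  differs from \<open>u\<close> by an integral combination of \<open>e1\<close> and
  \<open>f1\<close>.\<close>

theorem image_integral:
  assumes g: "g \<in> H" and j: "j < n + 4"
  shows "intv (g *\<^sub>v unit_vec (n + 4) j)"
proof -
  have nz: "v \<noteq> 0\<^sub>v (n + 4)" if "bl w v \<noteq> 0" for v w using that by auto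
  have b: "intv (g *\<^sub>v e1)" "intv (g *\<^sub>v f1)" "intv (g *\<^sub>v e2)" "intv (g *\<^sub>v f2)"
    using nz[of f1 e1] nz[of e1 f1] nz[of f2 e2] nz[of e2 f2]
    by (auto intro!: image_isotropic_integral[OF g])
  from j show ?thesis
  proof (cases rule: index_four_cases)
    case (3 k)
    define u where "u = (unit_vec (n + 4) j :: real vec)"
    have u: "intv u" "u \<in> V" "bl f1 u = 0"
      using 3 intv_unit[of j] by (simp_all add: u_def bl_unit_left)
    define v where "v = E f1 u *\<^sub>v e1"
    define c where "c = bl u e1 + qf u"
    have c: "c \<in> \<int>" using u by (simp add: c_def bl_int qf_int)
    have v: "intv v" "bl v v = 0" "bl f1 v = 1"
      unfolding v_def using u isom_bl[OF E_isom[of f1 u], of e1 e1] by (simp_all add: E_intv bl_E)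
    have uv: "u = v + ((-1) \<cdot>\<^sub>v e1 + c \<cdot>\<^sub>v f1)"
    proof (rule eq_vecI)
      fix i assume "i < dim_vec (v + ((-1) \<cdot>\<^sub>v e1 + c \<cdot>\<^sub>v f1))"
      then show "u $ i = (v + ((-1) \<cdot>\<^sub>v e1 + c \<cdot>\<^sub>v f1)) $ i"
        unfolding v_def using u by (simp add: E_mult_vec c_def algebra_simps)
    qed (use u in simp)
    have "g *\<^sub>v u = g *\<^sub>v v + ((-1) \<cdot>\<^sub>v (g *\<^sub>v e1) + c \<cdot>\<^sub>v (g *\<^sub>v f1))"
      by (subst uv) (rule mult_mat_vec_comb[OF H_carrier[OF g]]; use v in simp)
    moreover have "intv (g *\<^sub>v v)" by (rule image_isotropic_integral[OF g v(1,2)]) (use v(3) nz in fastforce)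
    ultimately show ?thesis using b c unfolding u_def by (simp add: intv_add intv_smult)
  qed (use b in \<open>simp_all add: basis_defs\<close>)
qed

end

section \<open>The identity component of the orthogonal group\<close>

lemma topspace_mat_topology [simp]: "topspace (mat_topology m) = carrier_mat m m"
  unfolding mat_topology_def topspace_pullback_topology by auto

lemma continuous_map_mat_entry:
  assumes "i < m" "j < m"
  shows "continuous_map (mat_topology m) euclideanreal (\<lambda>A. A $$ (i, j))"
proof -
  let ?I = "{..<m} \<times> {..<m}"
  have "continuous_map (product_topology (\<lambda>_. euclideanreal) ?I) euclideanreal (\<lambda>f. f (i, j))"
    using assms by (intro continuous_map_product_projection) auto
  from continuous_map_pullback[OF this, of "carrier_mat m m" "\<lambda>A. \<lambda>ij \<in> ?I. A $$ ij"]
  show ?thesis using assms by (simp add: mat_topology_def o_def)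
qed

lemma continuous_map_into_mat:
  assumes "\<And>x. x \<in> topspace X \<Longrightarrow> f x \<in> carrier_mat m m"
    and "\<And>i j. i < m \<Longrightarrow> j < m \<Longrightarrow> continuous_map X euclideanreal (\<lambda>x. f x $$ (i, j))"
  shows "continuous_map X (mat_topology m) f"
  unfolding mat_topology_def
proof (rule continuous_map_pullback')
  show "continuous_map X (product_topology (\<lambda>_. euclideanreal) ({..<m} \<times> {..<m}))
      ((\<lambda>A. \<lambda>ij\<in>{..<m} \<times> {..<m}. A $$ ij) \<circ> f)"
    unfolding continuous_map_componentwise using assms(2) by auto
qed (use assms(1) in auto)

lemma continuous_map_mult_mat:
  assumes "g \<in> carrier_mat m m"
  shows "continuous_map (mat_topology m) (mat_topology m) (\<lambda>A. g * A)"
proof (rule continuous_map_into_mat)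
  fix i j assume ij: "i < m" "j < m"
  have "continuous_map (mat_topology m) euclideanreal (\<lambda>A. \<Sum>k\<in>{0..<m}. g $$ (i, k) * A $$ (k, j))"
    using ij by (intro continuous_map_sum continuous_map_real_mult continuous_map_mat_entry) auto
  then show "continuous_map (mat_topology m) euclideanreal (\<lambda>A. (g * A) $$ (i, j))"
    by (rule continuous_map_eq) (use assms ij in \<open>auto simp: scalar_prod_def\<close>)
qed (use assms in auto)

lemma discrete_mat_topologyD:
  assumes D: "subtopology (mat_topology m) D = discrete_topology D" and A: "A \<in> D"
  shows "\<exists>\<epsilon>>0. \<forall>B\<in>D. (\<forall>i<m. \<forall>j<m. \<bar>B $$ (i, j) - A $$ (i, j)\<bar> < \<epsilon>) \<longrightarrow> B = A"
proof -
  let ?I = "{..<m} \<times> {..<m}"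
  let ?f = "\<lambda>M. \<lambda>ij\<in>?I. M $$ ij :: real"
  have DM: "D \<subseteq> carrier_mat m m" using arg_cong[OF D, of topspace] by auto
  have "openin (subtopology (mat_topology m) D) {A}" unfolding D using A by simp
  then obtain U where U: "openin (mat_topology m) U" "{A} = U \<inter> D" by (auto simp: openin_subtopology)
  then obtain W where W: "openin (product_topology (\<lambda>_. euclideanreal) ?I) W" "U = ?f -` W \<inter> carrier_mat m m"
    unfolding mat_topology_def openin_pullback_topology by auto
  have "?f A \<in> W" using U W by auto
  then have "\<exists>B. (\<forall>i\<in>?I. openin euclideanreal (B i)) \<and> ?f A \<in> Pi\<^sub>E ?I B \<and> Pi\<^sub>E ?I B \<subseteq> W"
    using W(1) unfolding openin_product_topology_alt by blast
  then obtain B where B: "\<forall>i\<in>?I. openin euclideanreal (B i)" "?f A \<in> Pi\<^sub>E ?I B" "Pi\<^sub>E ?I B \<subseteq> W"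
    by (elim exE conjE)
  have "\<exists>e>0. \<forall>y. \<bar>y - A $$ ij\<bar> < e \<longrightarrow> y \<in> B ij" if "ij \<in> ?I" for ij
  proof -
    have "?f A ij \<in> B ij" using B(2) that by (rule PiE_mem)
    then have "A $$ ij \<in> B ij" using that by simp
    moreover have "open (B ij)" by (rule iffD2[OF open_openin bspec[OF B(1) that]])
    ultimately show ?thesis unfolding open_dist by (simp add: dist_real_def)
  qed
  then have "\<forall>ij\<in>?I. \<exists>e>0. \<forall>y. \<bar>y - A $$ ij\<bar> < e \<longrightarrow> y \<in> B ij" by blast
  then have "\<exists>e. \<forall>ij\<in>?I. e ij > 0 \<and> (\<forall>y. \<bar>y - A $$ ij\<bar> < e ij \<longrightarrow> y \<in> B ij)" by (rule bchoice)
  then obtain e where "\<forall>ij\<in>?I. e ij > 0 \<and> (\<forall>y. \<bar>y - A $$ ij\<bar> < e ij \<longrightarrow> y \<in> B ij)" by (rule exE)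
  note e = bspec[OF this]
  \<comment> \<open>The inserted 1 keeps the minimum defined for \<open>m = 0\<close>, when there
    are no entries.\<close>
  define \<epsilon> where "\<epsilon> = Min (insert 1 (e ` ?I))"
  have fin: "finite (insert 1 (e ` ?I))" by simp
  have \<epsilon>0: "\<epsilon> > 0" unfolding \<epsilon>_def using fin e by (subst Min_gr_iff) auto
  have \<epsilon>e: "\<epsilon> \<le> e ij" if "ij \<in> ?I" for ij unfolding \<epsilon>_def by (rule Min_le[OF fin]) (use that in blast)
  show ?thesis
  proof (intro exI[of _ \<epsilon>] conjI ballI impI)
    fix C assume C: "C \<in> D" "\<forall>i<m. \<forall>j<m. \<bar>C $$ (i, j) - A $$ (i, j)\<bar> < \<epsilon>"
    have "C $$ ij \<in> B ij" if "ij \<in> ?I" for ij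
    proof -
      have "\<bar>C $$ ij - A $$ ij\<bar> < \<epsilon>" using C(2) that by (cases ij) auto
      then show ?thesis using e[OF that] \<epsilon>e[OF that] by (meson order_less_le_trans)
    qed
    then have "?f C \<in> Pi\<^sub>E ?I B" by auto
    then have "?f C \<in> W" using B(3) by (rule rev_subsetD)
    then have "C \<in> U" using W(2) C(1) DM by auto
    then show "C = A" using U(2) C(1) by auto
  qed (rule \<epsilon>0)
qed

lemma discrete_mat_topologyI:
  assumes DM: "D \<subseteq> carrier_mat m m"
    and sep: "\<And>A B. A \<in> D \<Longrightarrow> B \<in> D \<Longrightarrow> (\<And>i j. i < m \<Longrightarrow> j < m \<Longrightarrow> \<bar>B $$ (i, j) - A $$ (i, j)\<bar> < (1::real)) \<Longrightarrow> B = A"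
  shows "subtopology (mat_topology m) D = discrete_topology D"
proof -
  have "openin (subtopology (mat_topology m) D) {A}" if A: "A \<in> D" for A
  proof -
    let ?P = "\<lambda>i j. {B \<in> topspace (mat_topology m). B $$ (i, j) \<in> {x. \<bar>x - A $$ (i, j)\<bar> < 1}}"
    let ?N = "(\<Inter>i\<in>{..<m}. \<Inter>j\<in>{..<m}. ?P i j) \<inter> topspace (mat_topology m)"
    have "openin (mat_topology m) (?P i j)" if "i < m" "j < m" for i j
    proof (rule openin_continuous_map_preimage[OF continuous_map_mat_entry[OF that]])
      have "{x. \<bar>x - A $$ (i, j)\<bar> < 1} = ball (A $$ (i, j)) 1" by (auto simp: dist_real_def)
      then show "openin euclideanreal {x. \<bar>x - A $$ (i, j)\<bar> < 1}" by (simp add: open_openin[symmetric])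
    qed
    then have "openin (mat_topology m) ?N"
    proof (cases "m = 0")
      case False
      then show ?thesis using \<open>\<And>i j. i < m \<Longrightarrow> j < m \<Longrightarrow> openin (mat_topology m) (?P i j)\<close>
        by (intro openin_Int openin_Inter openin_topspace) auto
    qed (use openin_topspace[of "mat_topology 0"] in auto)
    moreover have "?N \<inter> D = {A}"
    proof -
      have "B = A" if "B \<in> ?N" "B \<in> D" for B using that A by (intro sep) auto
      moreover have "A \<in> ?N" using A DM by auto
      ultimately show ?thesis using A by blast
    qed
    ultimately show ?thesis unfolding openin_subtopology by blast
  qed
  then have "discrete_topology D = subtopology (mat_topology m) D"
    unfolding discrete_topology_unique using DM by auto
  then show ?thesis by simp
qed

text \<open>The adjugate gives an explicit inverse over every commutative ring, so the same formula
  serves real and integral matrices.\<close>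

lemma inverse_if_det_1:
  fixes g :: "'a::comm_ring_1 mat"
  assumes "g \<in> carrier_mat m m" "det g = 1"
  shows "g * adj_mat g = 1\<^sub>m m" "adj_mat g * g = 1\<^sub>m m" "adj_mat g \<in> carrier_mat m m"
  using adj_mat[OF assms(1)] assms(2) by auto

context split_lattice
begin

lemma Q_carrier: "Q \<in> M"
  using dim_S1 by simp

lemma isom_if_preserves:
  assumes g: "g \<in> M" "g\<^sup>T * Q * g = Q"
  shows "isom g"
  unfolding isom_def
proof (intro conjI ballI g(1))
  fix x y assume xy: "x \<in> V" "y \<in> V"
  have gV: "g *\<^sub>v x \<in> V" "g *\<^sub>v y \<in> V" using g xy by auto
  have gt: "g\<^sup>T \<in> M" using g by simp
  have "bl (g *\<^sub>v x) (g *\<^sub>v y) = (Q *\<^sub>v (g *\<^sub>v y)) \<bullet> (g *\<^sub>v x)"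
    using bl_mat[OF gV] comm_scalar_prod[OF gV(1)] Q_carrier gV by simp
  also have "\<dots> = (g\<^sup>T *\<^sub>v (Q *\<^sub>v (g *\<^sub>v y))) \<bullet> x"
    using Q_carrier gV by (intro transpose_vec_mult_scalar[OF g(1) xy(1), symmetric]) auto
  also have "g\<^sup>T *\<^sub>v (Q *\<^sub>v (g *\<^sub>v y)) = (g\<^sup>T * Q * g) *\<^sub>v y"
    using assoc_mult_mat_vec[OF gt Q_carrier gV(2)] assoc_mult_mat_vec[OF mult_M[OF gt Q_carrier] g(1) xy(2)] by simp
  also have "((g\<^sup>T * Q * g) *\<^sub>v y) \<bullet> x = bl x y"
    unfolding g(2) using comm_scalar_prod[of "Q *\<^sub>v y" "n+4" x] bl_mat[OF xy] xy Q_carrier by simp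
  finally show "bl (g *\<^sub>v x) (g *\<^sub>v y) = bl x y" .
qed

lemma mat_eq_if_form_eq:
  assumes A: "A \<in> M" "B \<in> M" and eq: "\<And>x y. x \<in> V \<Longrightarrow> y \<in> V \<Longrightarrow> x \<bullet> (A *\<^sub>v y) = x \<bullet> (B *\<^sub>v y)"
  shows "A = B"
proof (rule mat_eq_if_mult_vec_eq[OF A])
  fix y :: "real vec" assume y: "y \<in> V"
  show "A *\<^sub>v y = B *\<^sub>v y"
  proof (rule eq_vecI)
    fix i assume "i < dim_vec (B *\<^sub>v y)"
    then have i: "i < n + 4" using A by simp
    have V: "A *\<^sub>v y \<in> V" "B *\<^sub>v y \<in> V" using A y by auto
    show "(A *\<^sub>v y) $ i = (B *\<^sub>v y) $ i"
      using eq[OF unit_vec_carrier[of "n+4" i] y] scalar_prod_left_unit[OF V(1) i] scalar_prod_left_unit[OF V(2) i] by simp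
  qed (use A in auto)
qed

lemma isom_preserves:
  assumes "isom g"
  shows "g\<^sup>T * Q * g = Q"
proof (rule mat_eq_if_form_eq)
  have g: "g \<in> M" "g\<^sup>T \<in> M" using assms isom_carrier by auto
  show "g\<^sup>T * Q * g \<in> M" using g Q_carrier by simp
  show "Q \<in> M" by (rule Q_carrier)
  fix x y :: "real vec" assume xy: "x \<in> V" "y \<in> V"
  have gV: "g *\<^sub>v x \<in> V" "g *\<^sub>v y \<in> V" using g xy by auto
  have "(g\<^sup>T * Q * g) *\<^sub>v y = g\<^sup>T *\<^sub>v (Q *\<^sub>v (g *\<^sub>v y))"
    using assoc_mult_mat_vec[OF g(2) Q_carrier gV(2)] assoc_mult_mat_vec[OF mult_M[OF g(2) Q_carrier] g(1) xy(2)] by simp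
  then have "x \<bullet> ((g\<^sup>T * Q * g) *\<^sub>v y) = (g\<^sup>T *\<^sub>v (Q *\<^sub>v (g *\<^sub>v y))) \<bullet> x"
    using comm_scalar_prod[OF xy(1)] g Q_carrier gV by (metis mult_mat_vec_carrier)
  also have "\<dots> = (Q *\<^sub>v (g *\<^sub>v y)) \<bullet> (g *\<^sub>v x)"
    using Q_carrier gV by (intro transpose_vec_mult_scalar[OF g(1) xy(1)]) auto
  also have "\<dots> = bl (g *\<^sub>v x) (g *\<^sub>v y)"
    using bl_mat[OF gV] comm_scalar_prod[OF gV(1)] Q_carrier gV by simp
  also have "\<dots> = x \<bullet> (Q *\<^sub>v y)" using isom_bl[OF assms xy] bl_mat[OF xy] by simp
  finally show "x \<bullet> ((g\<^sup>T * Q * g) *\<^sub>v y) = x \<bullet> (Q *\<^sub>v y)" .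
qed

lemma SO_iff: "g \<in> SO (n + 4) Q \<longleftrightarrow> isom g \<and> det g = 1"
  unfolding SO_def using isom_if_preserves isom_preserves isom_carrier by blast

lemma det_Q: "det Q \<noteq> 0"
proof
  assume "det Q = 0"
  then obtain v where v: "v \<in> V" "v \<noteq> 0\<^sub>v (n + 4)" "Q *\<^sub>v v = 0\<^sub>v (n + 4)"
    using det_0_iff_vec_prod_zero[OF Q_carrier] by blast
  have "bl v y = 0" if "y \<in> V" for y
    using bl_mat[OF that v(1)] v(3) that by (simp add: bl_commute)
  then show False using bl_nondegenerate[OF v(1)] v(2) by blast
qed

lemma isom_det:
  assumes "isom g"
  shows "(det g)\<^sup>2 = 1"
proof -
  have g: "g \<in> M" "g\<^sup>T \<in> M" using assms isom_carrier by auto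
  have "det g * det Q * det g = det Q"
    using arg_cong[OF isom_preserves[OF assms], of det] det_mult[OF mult_M[OF g(2) Q_carrier] g(1)]
      det_mult[OF g(2) Q_carrier] det_transpose[OF g(1)] by simp
  then show ?thesis using det_Q by (simp add: power2_eq_square)
qed

text \<open>\<open>E e u\<close> is the square of \<open>E e (u / 2)\<close>, and an isometry has
  determinant 1 or -1.\<close>

lemma E_SO:
  assumes "e \<in> V" "u \<in> V" "bl e e = 0" "bl e u = 0"
  shows "E e u \<in> SO (n + 4) Q"
proof -
  let ?h = "(1 / 2) \<cdot>\<^sub>v u"
  have h: "?h \<in> V" "bl e ?h = 0" using assms by (simp_all add: bl_lin)
  have "?h + ?h = u" using assms by (auto intro!: eq_vecI)
  then have "E e u = E e ?h * E e ?h" using E_add[OF assms(1) h(1) h(1) assms(3) h(2) h(2)] by simp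
  then have "det (E e u) = (det (E e ?h))\<^sup>2"
    using det_mult[OF E_carrier E_carrier] by (simp add: power2_eq_square)
  also have "\<dots> = 1" using isom_det E_isom assms h by blast
  finally show ?thesis unfolding SO_iff using E_isom assms by blast
qed

section \<open>The identity component as a group\<close>

abbreviation "XSO \<equiv> subtopology (mat_topology (n + 4)) (SO (n + 4) Q)"
abbreviation "SOp \<equiv> SO_plus (n + 4) Q"

lemma SO_subset: "SO (n + 4) Q \<subseteq> M"
  by (auto simp: SO_def)

lemma topspace_XSO: "topspace XSO = SO (n + 4) Q"
  using SO_subset by auto

lemma one_SO: "1\<^sub>m (n + 4) \<in> SO (n + 4) Q"
  using Q_carrier by (simp add: SO_def)

lemma SO_mult:
  assumes "g \<in> SO (n + 4) Q" "h \<in> SO (n + 4) Q"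
  shows "g * h \<in> SO (n + 4) Q"
proof -
  have g: "isom g" "det g = 1" "g \<in> M" "isom h" "det h = 1" "h \<in> M" using assms SO_iff isom_carrier by auto
  have "isom (g * h)"
    unfolding isom_def using g assoc_mult_mat_vec[OF g(3,6)] by (simp add: isom_bl)
  then show ?thesis unfolding SO_iff using det_mult[OF g(3,6)] g by simp
qed

lemma SO_adj:
  assumes "g \<in> SO (n + 4) Q"
  shows "adj_mat g \<in> SO (n + 4) Q" "g * adj_mat g = 1\<^sub>m (n + 4)" "adj_mat g * g = 1\<^sub>m (n + 4)" "adj_mat g \<in> M"
proof -
  have g: "isom g" "det g = 1" "g \<in> M" using assms SO_iff isom_carrier by auto
  note adj = inverse_if_det_1[OF g(3,2)]
  show "g * adj_mat g = 1\<^sub>m (n + 4)" "adj_mat g * g = 1\<^sub>m (n + 4)" "adj_mat g \<in> M" by (rule adj)+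
  have "isom (adj_mat g)"
    unfolding isom_def
  proof (intro conjI ballI adj(3))
    fix x y assume xy: "x \<in> V" "y \<in> V"
    have "adj_mat g *\<^sub>v x \<in> V" "adj_mat g *\<^sub>v y \<in> V" using adj(3) xy by auto
    from isom_bl[OF g(1) this]
    show "bl (adj_mat g *\<^sub>v x) (adj_mat g *\<^sub>v y) = bl x y"
      using inverse_vec[OF g(3) adj(3) adj(1)] xy by simp
  qed
  moreover have "det (adj_mat g) = 1" using det_mult[OF g(3) adj(3)] adj(1) g(2) by simp
  ultimately show "adj_mat g \<in> SO (n + 4) Q" by (simp add: SO_iff)
qed

text \<open>Closure of the identity component under inverses and products rests on this: a connected
  translate that contains the identity, or meets the component, lies in the component.\<close>

lemma connectedin_mult_SO:
  assumes "g \<in> SO (n + 4) Q" "connectedin XSO C"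
  shows "connectedin XSO ((\<lambda>h. g * h) ` C)"
proof (rule connectedin_continuous_map_image[OF _ assms(2)])
  show "continuous_map XSO XSO (\<lambda>h. g * h)"
    unfolding continuous_map_in_subtopology
    using continuous_map_mult_mat[of g "n+4"] assms(1) SO_mult[OF assms(1)] SO_subset
    by (auto intro: continuous_map_from_subtopology)
qed

lemma SO_plus_eq: "SOp = connected_component_of_set XSO (1\<^sub>m (n + 4))"
  by (simp add: SO_plus_def)

lemma connectedin_SO_plus: "connectedin XSO SOp"
  unfolding SO_plus_eq by (rule connectedin_connected_component_of)

lemma SO_plus_SO: "SOp \<subseteq> SO (n + 4) Q"
  using connectedin_subset_topspace[OF connectedin_SO_plus] topspace_XSO by blast

lemma one_SO_plus: "1\<^sub>m (n + 4) \<in> SOp"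
  unfolding SO_plus_eq using one_SO topspace_XSO by (simp add: connected_component_of_refl)

lemma SO_plus_I:
  assumes "connectedin XSO C" "1\<^sub>m (n + 4) \<in> C" "g \<in> C"
  shows "g \<in> SOp"
  using connected_component_of_maximal[OF assms(1,2)] assms(3) unfolding SO_plus_eq by blast

lemma SO_plus_adj:
  assumes "g \<in> SOp"
  shows "adj_mat g \<in> SOp"
proof (rule SO_plus_I)
  have g: "g \<in> SO (n + 4) Q" using assms SO_plus_SO by blast
  show "connectedin XSO ((\<lambda>h. adj_mat g * h) ` SOp)"
    using connectedin_mult_SO[OF SO_adj(1)[OF g] connectedin_SO_plus] .
  show "1\<^sub>m (n + 4) \<in> (\<lambda>h. adj_mat g * h) ` SOp" by (rule image_eqI[OF _ assms]) (simp add: SO_adj(3)[OF g])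
  show "adj_mat g \<in> (\<lambda>h. adj_mat g * h) ` SOp" by (rule image_eqI[OF _ one_SO_plus]) (use SO_adj(4)[OF g] in simp)
qed

lemma SO_plus_mult:
  assumes "g \<in> SOp" "h \<in> SOp"
  shows "g * h \<in> SOp"
proof -
  have g: "g \<in> SO (n + 4) Q" using assms SO_plus_SO by blast
  let ?C = "(\<lambda>h. g * h) ` SOp"
  have "connectedin XSO ?C" by (rule connectedin_mult_SO[OF g connectedin_SO_plus])
  moreover have "g \<in> ?C" by (rule image_eqI[OF _ one_SO_plus]) (use SO_subset g in auto)
  ultimately have "connectedin XSO (SOp \<union> ?C)"
    using connectedin_SO_plus assms(1) by (intro connectedin_Un) auto
  then show ?thesis by (rule SO_plus_I) (use one_SO_plus assms in auto)
qed

lemma SO_plus_group: "group (SO_plus_group (n + 4) Q)"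
proof (rule groupI)
  fix x y z assume "x \<in> carrier (SO_plus_group (n + 4) Q)" "y \<in> carrier (SO_plus_group (n + 4) Q)"
    "z \<in> carrier (SO_plus_group (n + 4) Q)"
  then have "x \<in> M" "y \<in> M" "z \<in> M" using SO_plus_SO SO_subset by (auto simp: SO_plus_group_def)
  then show "x \<otimes>\<^bsub>SO_plus_group (n + 4) Q\<^esub> y \<otimes>\<^bsub>SO_plus_group (n + 4) Q\<^esub> z =
      x \<otimes>\<^bsub>SO_plus_group (n + 4) Q\<^esub> (y \<otimes>\<^bsub>SO_plus_group (n + 4) Q\<^esub> z)"
    by (simp add: SO_plus_group_def)
next
  fix x assume "x \<in> carrier (SO_plus_group (n + 4) Q)"
  then have x: "x \<in> SOp" by (simp add: SO_plus_group_def)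
  then have "x \<in> M" "x \<in> SO (n + 4) Q" using SO_plus_SO SO_subset by auto
  then show "\<one>\<^bsub>SO_plus_group (n + 4) Q\<^esub> \<otimes>\<^bsub>SO_plus_group (n + 4) Q\<^esub> x = x"
    "\<exists>y\<in>carrier (SO_plus_group (n + 4) Q). y \<otimes>\<^bsub>SO_plus_group (n + 4) Q\<^esub> x = \<one>\<^bsub>SO_plus_group (n + 4) Q\<^esub>"
    using SO_plus_adj[OF x] SO_adj(3)[of x] by (auto simp: SO_plus_group_def)
qed (auto simp: SO_plus_group_def SO_plus_mult one_SO_plus)

lemma SO_plus_inv:
  assumes "g \<in> SOp"
  shows "inv\<^bsub>SO_plus_group (n + 4) Q\<^esub> g = adj_mat g"
proof -
  interpret group "SO_plus_group (n + 4) Q" by (rule SO_plus_group)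
  have "g \<in> SO (n + 4) Q" using assms SO_plus_SO by blast
  then show ?thesis
    using assms SO_plus_adj SO_adj(3) by (intro inv_equality) (auto simp: SO_plus_group_def)
qed

text \<open>Scaling \<open>u\<close> by a real parameter gives a path from the identity to
  \<open>E e u\<close>.\<close>

lemma E_SO_plus:
  assumes eu: "e \<in> V" "u \<in> V" "bl e e = 0" "bl e u = 0"
  shows "E e u \<in> SOp"
proof (rule SO_plus_I)
  have SO: "E e (t \<cdot>\<^sub>v u) \<in> SO (n + 4) Q" for t using eu by (intro E_SO) (simp_all add: bl_lin)
  have "continuous_map euclideanreal (mat_topology (n + 4)) (\<lambda>t. E e (t \<cdot>\<^sub>v u))"
  proof (rule continuous_map_into_mat)
    fix i j assume ij: "i < n + 4" "j < n + 4"
    let ?u = "unit_vec (n + 4) j :: real vec"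
    have "(\<lambda>t. E e (t \<cdot>\<^sub>v u) $$ (i, j)) = (\<lambda>t. (if i = j then 1 else 0) + bl e ?u * (t * u $ i)
        - (t * bl u ?u + t\<^sup>2 * qf u * bl e ?u) * e $ i)"
      using ij eu by (intro ext) (simp add: E_def bl_lin qf_lin)
    moreover have "continuous_on UNIV (\<lambda>t. (if i = j then 1 else 0) + bl e ?u * (t * u $ i)
        - (t * bl u ?u + t\<^sup>2 * qf u * bl e ?u) * e $ i)"
      by (intro continuous_intros)
    ultimately show "continuous_map euclideanreal euclideanreal (\<lambda>t. E e (t \<cdot>\<^sub>v u) $$ (i, j))" by simp
  qed simp
  then have "continuous_map euclideanreal XSO (\<lambda>t. E e (t \<cdot>\<^sub>v u))"
    unfolding continuous_map_in_subtopology using SO by auto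
  then show "connectedin XSO ((\<lambda>t. E e (t \<cdot>\<^sub>v u)) ` UNIV)"
    by (rule connectedin_continuous_map_image) simp
  have "0 \<cdot>\<^sub>v u = 0\<^sub>v (n + 4)" using eu by auto
  then have "E e (0 \<cdot>\<^sub>v u) = 1\<^sub>m (n + 4)" using eu by (simp add: E_zero)
  then show "1\<^sub>m (n + 4) \<in> (\<lambda>t. E e (t \<cdot>\<^sub>v u)) ` UNIV" by (metis rangeI)
  have "1 \<cdot>\<^sub>v u = u" using eu by auto
  then show "E e u \<in> (\<lambda>t. E e (t \<cdot>\<^sub>v u)) ` UNIV" by (metis rangeI)
qed

end

section \<open>The modular group and its discriminant kernel\<close>

context split_lattice
begin

definition intm :: "real mat \<Rightarrow> bool" where
  "intm g \<longleftrightarrow> g \<in> M \<and> (\<forall>i<n+4. \<forall>j<n+4. g $$ (i, j) \<in> \<int>)"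

lemma intm_carrier [simp]: "intm g \<Longrightarrow> g \<in> M"
  by (simp add: intm_def)

lemma intm_iff: "intm g \<longleftrightarrow> (\<exists>A\<in>carrier_mat (n + 4) (n + 4). g = map_mat real_of_int A)"
proof
  assume g: "intm g"
  show "\<exists>A\<in>carrier_mat (n + 4) (n + 4). g = map_mat real_of_int A"
  proof (intro bexI)
    show "g = map_mat real_of_int (mat (n + 4) (n + 4) (\<lambda>ij. \<lfloor>g $$ ij\<rfloor>))"
      using g by (intro eq_matI) (auto simp: intm_def elim!: Ints_cases)
  qed simp
qed (auto simp: intm_def)

lemma intm_mult: "intm g \<Longrightarrow> intm h \<Longrightarrow> intm (g * h)"
  by (auto simp: intm_def scalar_prod_def intro!: Ints_sum Ints_mult)

lemma intm_add: "intm g \<Longrightarrow> intm h \<Longrightarrow> intm (g + h)"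
  by (auto simp: intm_def)

lemma intm_uminus: "intm g \<Longrightarrow> intm (- g)"
  by (auto simp: intm_def)

lemma intm_transpose: "intm g \<Longrightarrow> intm g\<^sup>T"
  by (auto simp: intm_def)

lemma intm_one: "intm (1\<^sub>m (n + 4))"
  by (auto simp: intm_def)

lemma intm_Q: "intm Q"
  using dim_S1 unfolding intm_iff by blast

lemma intm_intv: "intm g \<Longrightarrow> intv x \<Longrightarrow> intv (g *\<^sub>v x)"
  by (auto simp: intm_def intv_def scalar_prod_def intro!: Ints_sum Ints_mult)

lemma Gamma_S_iff: "g \<in> Gamma_S n S \<longleftrightarrow> g \<in> SOp \<and> intm g"
  unfolding Gamma_S_def intm_iff SO_plus_group_def by auto

lemma SOp_carrier: "g \<in> SOp \<Longrightarrow> g \<in> M"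
  using SO_plus_SO SO_subset by blast

lemma SOp_isom: "g \<in> SOp \<Longrightarrow> isom g"
  using SO_plus_SO SO_iff by blast

lemma SOp_adj: "g \<in> SOp \<Longrightarrow> g * adj_mat g = 1\<^sub>m (n + 4)" "g \<in> SOp \<Longrightarrow> adj_mat g * g = 1\<^sub>m (n + 4)"
  using SO_plus_SO SO_adj(2,3) by blast+

lemma inverse_unique:
  assumes "x \<in> M" "g \<in> M" "y \<in> M" "x * g = 1\<^sub>m (n + 4)" "g * y = 1\<^sub>m (n + 4)"
  shows "x = y"
  using assms by (metis assoc_mult_mat left_mult_one_mat right_mult_one_mat)

text \<open>The underlying integer matrix has determinant 1, so its adjugate is an integral inverse,
  and inverses are unique.\<close>

lemma Gamma_S_adj:
  assumes "g \<in> Gamma_S n S"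
  shows "adj_mat g \<in> Gamma_S n S"
proof -
  have g: "g \<in> SOp" "intm g" using assms Gamma_S_iff by auto
  obtain A where A: "A \<in> carrier_mat (n + 4) (n + 4)" "g = map_mat real_of_int A" using g(2) intm_iff by auto
  have "det g = 1" using g SO_plus_SO SO_iff by blast
  then have "real_of_int (det A) = 1" unfolding A(2) by simp
  then have "det A = 1" by simp
  note adj = inverse_if_det_1[OF A(1) this]
  have "g * map_mat real_of_int (adj_mat A) = map_mat real_of_int (A * adj_mat A)"
    unfolding A(2) by (rule of_int_hom.mat_hom_mult[OF A(1) adj(3), symmetric])
  also have "\<dots> = 1\<^sub>m (n + 4)" unfolding adj(1) by (rule of_int_hom.mat_hom_one)
  finally have "adj_mat g = map_mat real_of_int (adj_mat A)"
    using inverse_unique SOp_adj(2)[OF g(1)] SOp_carrier SO_plus_adj[OF g(1)] g(1) adj(3) map_carrier_mat by metis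
  then show ?thesis unfolding Gamma_S_iff intm_iff using SO_plus_adj[OF g(1)] adj(3) by blast
qed

lemma Gamma_S_mult: "g \<in> Gamma_S n S \<Longrightarrow> h \<in> Gamma_S n S \<Longrightarrow> g * h \<in> Gamma_S n S"
  unfolding Gamma_S_iff using SO_plus_mult intm_mult by blast

lemma Gamma_S_subgroup: "subgroup (Gamma_S n S) (G_S n S)"
proof
  show "Gamma_S n S \<subseteq> carrier (G_S n S)" using Gamma_S_iff by (auto simp: SO_plus_group_def)
  show "\<one>\<^bsub>G_S n S\<^esub> \<in> Gamma_S n S" using Gamma_S_iff one_SO_plus intm_one by (auto simp: SO_plus_group_def)
  fix x y assume xy: "x \<in> Gamma_S n S" "y \<in> Gamma_S n S"
  show "x \<otimes>\<^bsub>G_S n S\<^esub> y \<in> Gamma_S n S" using Gamma_S_mult xy by (auto simp: SO_plus_group_def)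
  show "inv\<^bsub>G_S n S\<^esub> x \<in> Gamma_S n S" using Gamma_S_adj[OF xy(1)] SO_plus_inv xy(1) Gamma_S_iff by auto
qed

lemma Gamma_S_discrete: "discrete_subgroup (n + 4) (G_S n S) (Gamma_S n S)"
  unfolding discrete_subgroup_def
proof (intro conjI Gamma_S_subgroup discrete_mat_topologyI)
  show "Gamma_S n S \<subseteq> M" using Gamma_S_iff by auto
  fix A B assume AB: "A \<in> Gamma_S n S" "B \<in> Gamma_S n S"
    and near: "\<And>i j. i < n + 4 \<Longrightarrow> j < n + 4 \<Longrightarrow> \<bar>B $$ (i, j) - A $$ (i, j)\<bar> < 1"
  have I: "intm A" "intm B" using AB Gamma_S_iff by auto
  show "B = A"
  proof (rule eq_matI)
    fix i j assume "i < dim_row A" "j < dim_col A"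
    then have ij: "i < n + 4" "j < n + 4" using intm_carrier[OF I(1)] by auto
    then have "B $$ (i, j) - A $$ (i, j) \<in> \<int>" using I by (auto simp: intm_def)
    then obtain z where z: "B $$ (i, j) - A $$ (i, j) = real_of_int z" by (auto elim: Ints_cases)
    then have "\<bar>real_of_int z\<bar> < 1" using near[OF ij] by simp
    then have "z = 0" by linarith
    then show "B $$ (i, j) = A $$ (i, j)" using z by simp
  qed (use intm_carrier[OF I(1)] intm_carrier[OF I(2)] in auto)
qed

section \<open>The discriminant kernel and its invariance under conjugation\<close>

lemma tilde_iff: "g \<in> tilde_Gamma_S n S \<longleftrightarrow> g \<in> SOp \<and> (\<exists>A. intm A \<and> g = 1\<^sub>m (n + 4) + A * Q)"
proof -
  have eq: "map_mat real_of_int (1\<^sub>m (n + 4) + A * S1 S) = 1\<^sub>m (n + 4) + map_mat real_of_int A * Q"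
    if A: "A \<in> carrier_mat (n + 4) (n + 4)" for A
  proof -
    have "map_mat real_of_int (1\<^sub>m (n + 4) + A * S1 S) = map_mat real_of_int (1\<^sub>m (n + 4)) + map_mat real_of_int (A * S1 S)"
      using A dim_S1 by (intro eq_matI) auto
    then show ?thesis by (simp add: of_int_hom.mat_hom_mult[OF A dim_S1] of_int_hom.mat_hom_one)
  qed
  have "g \<in> tilde_Gamma_S n S \<longleftrightarrow> g \<in> Gamma_S n S \<and> (\<exists>A. intm A \<and> g = 1\<^sub>m (n + 4) + A * Q)"
    unfolding tilde_Gamma_S_def intm_iff using eq by auto
  moreover have "intm g" if "intm A" "g = 1\<^sub>m (n + 4) + A * Q" for A
    using that by (simp add: intm_add intm_one intm_mult intm_Q)
  ultimately show ?thesis unfolding Gamma_S_iff by blast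
qed

lemma tilde_Gamma: "tilde_Gamma_S n S \<subseteq> Gamma_S n S"
  by (auto simp: tilde_Gamma_S_def)

lemma tilde_mult:
  assumes "g \<in> tilde_Gamma_S n S" "h \<in> tilde_Gamma_S n S"
  shows "g * h \<in> tilde_Gamma_S n S"
proof -
  obtain A B where A: "intm A" "g = 1\<^sub>m (n + 4) + A * Q" and B: "intm B" "h = 1\<^sub>m (n + 4) + B * Q"
    using assms tilde_iff by auto
  have AM: "A \<in> M" "B \<in> M" "Q \<in> M" using A B Q_carrier by auto
  have "g * h = h + A * Q * h"
    unfolding A(2) using AM B(2) by (subst add_mult_distrib_mat[where nr="n+4" and n="n+4" and nc="n+4"]) auto
  also have "A * Q * h = A * Q + A * Q * (B * Q)"
    unfolding B(2) using AM by (subst mult_add_distrib_mat[where nr="n+4" and n="n+4" and nc="n+4"]) auto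
  also have "A * Q * (B * Q) = (A * Q * B) * Q"
    using AM by (subst assoc_mult_mat[where n\<^sub>1="n+4" and n\<^sub>2="n+4" and n\<^sub>3="n+4" and n\<^sub>4="n+4"]) auto
  also have "h + (A * Q + (A * Q * B) * Q) = 1\<^sub>m (n + 4) + (B + (A + A * Q * B)) * Q"
    unfolding B(2) using AM
    by (simp add: add_mult_distrib_mat[where nr="n+4" and n="n+4" and nc="n+4"]
        assoc_add_mat[where nr="n+4" and nc="n+4"])
  finally have "g * h = 1\<^sub>m (n + 4) + (B + (A + A * Q * B)) * Q" .
  moreover have "intm (B + (A + A * Q * B))" using A B by (intro intm_add intm_mult intm_Q) auto
  ultimately show ?thesis using assms SO_plus_mult unfolding tilde_iff by blast
qed

text \<open>For the inverse \<open>h\<close> of \<open>g = 1 + A Q\<close>, expanding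
  \<open>h g = 1\<close> gives \<open>h = 1 - (h A) Q\<close>, and \<open>h\<close> is already known
  to be integral.\<close>

lemma tilde_adj:
  assumes "g \<in> tilde_Gamma_S n S"
  shows "adj_mat g \<in> tilde_Gamma_S n S"
proof -
  obtain A where A: "intm A" "g = 1\<^sub>m (n + 4) + A * Q" and g: "g \<in> SOp"
    using assms tilde_iff by auto
  define h where "h = adj_mat g"
  have h: "h \<in> SOp" "intm h" "h * g = 1\<^sub>m (n + 4)"
    using SO_plus_adj[OF g] Gamma_S_adj[of g] assms tilde_Gamma SOp_adj(2)[OF g] Gamma_S_iff by (auto simp: h_def)
  have MM: "A \<in> M" "h \<in> M" "Q \<in> M" "h * A \<in> M" "(h * A) * Q \<in> M" using A h Q_carrier by auto
  have "h * g = h + (h * A) * Q"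
    unfolding A(2) using MM
    by (subst mult_add_distrib_mat[where nr="n+4" and n="n+4" and nc="n+4"])
       (auto simp: assoc_mult_mat[where n\<^sub>1="n+4" and n\<^sub>2="n+4" and n\<^sub>3="n+4" and n\<^sub>4="n+4"])
  then have eq: "h + (h * A) * Q = 1\<^sub>m (n + 4)" using h(3) by simp
  have "h = 1\<^sub>m (n + 4) + (- (h * A)) * Q"
  proof (rule eq_matI)
    fix i j assume "i < dim_row (1\<^sub>m (n + 4) + (- (h * A)) * Q)" "j < dim_col (1\<^sub>m (n + 4) + (- (h * A)) * Q)"
    then have ij: "i < n + 4" "j < n + 4" using MM by auto
    have "((- (h * A)) * Q) $$ (i, j) = - (((h * A) * Q) $$ (i, j))"
      using uminus_mult_left_mat[of "h * A" Q] MM ij by auto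
    moreover have "h $$ (i, j) + ((h * A) * Q) $$ (i, j) = 1\<^sub>m (n + 4) $$ (i, j)"
      using arg_cong[OF eq, of "\<lambda>X. X $$ (i, j)"] MM ij by simp
    moreover have "(1\<^sub>m (n + 4) + (- (h * A)) * Q) $$ (i, j) = 1\<^sub>m (n + 4) $$ (i, j) + ((- (h * A)) * Q) $$ (i, j)"
      using MM ij by (intro index_add_mat) auto
    ultimately show "h $$ (i, j) = (1\<^sub>m (n + 4) + (- (h * A)) * Q) $$ (i, j)" by linarith
  qed (use MM in auto)
  moreover have "intm (- (h * A))" using A h by (intro intm_uminus intm_mult)
  ultimately show ?thesis using h(1) unfolding tilde_iff h_def by blast
qed

text \<open>Invariance of the form gives \<open>Q h\<close> as the transpose of \<open>g\<close>
  times \<open>Q\<close>, so \<open>Q\<close> can be moved to the right end of the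
  conjugate.\<close>

lemma tilde_conj:
  assumes g: "g \<in> Gamma_S n S" and t: "t \<in> tilde_Gamma_S n S"
  shows "g * t * adj_mat g \<in> tilde_Gamma_S n S"
proof -
  obtain A where A: "intm A" "t = 1\<^sub>m (n + 4) + A * Q" and tS: "t \<in> SOp"
    using t tilde_iff by auto
  define h where "h = adj_mat g"
  have gS: "g \<in> SOp" "intm g" using g Gamma_S_iff by auto
  have h: "h \<in> SOp" "g * h = 1\<^sub>m (n + 4)" using SO_plus_adj gS SOp_adj by (auto simp: h_def)
  have MM: "A \<in> M" "h \<in> M" "g \<in> M" "Q \<in> M" "g\<^sup>T \<in> M" using A h gS SOp_carrier Q_carrier by auto
  note assoc = assoc_mult_mat[where n\<^sub>1="n+4" and n\<^sub>2="n+4" and n\<^sub>3="n+4" and n\<^sub>4="n+4"]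
  have "Q * h = (g\<^sup>T * Q * g) * h" using isom_preserves SOp_isom gS by simp
  also have "\<dots> = g\<^sup>T * Q * (g * h)" using MM by (intro assoc) auto
  finally have Qh: "Q * h = g\<^sup>T * Q" using h MM by simp
  have "g * t * h = (g + g * (A * Q)) * h"
    unfolding A(2) using MM by (subst mult_add_distrib_mat[where nr="n+4" and n="n+4" and nc="n+4"]) auto
  also have "\<dots> = 1\<^sub>m (n + 4) + g * (A * Q) * h"
    using MM h by (subst add_mult_distrib_mat[where nr="n+4" and n="n+4" and nc="n+4"]) auto
  also have "g * (A * Q) * h = g * A * (Q * h)" using MM by (simp add: assoc)
  also have "\<dots> = (g * A * g\<^sup>T) * Q" unfolding Qh using MM by (simp add: assoc)
  finally have "g * t * h = 1\<^sub>m (n + 4) + (g * A * g\<^sup>T) * Q" .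
  moreover have "intm (g * A * g\<^sup>T)" using gS A by (intro intm_mult intm_transpose)
  ultimately show ?thesis using gS h tS SO_plus_mult unfolding tilde_iff h_def by blast
qed

text \<open>Pairings with unit vectors are entries of a row vector times \<open>Q\<close>, so
  \<open>Q\<close> factors out of \<open>E e u - 1\<close> on the right. The remaining matrix
  \<open>A\<close> is integral because \<open>qf u\<close> is.\<close>

lemma E_tilde:
  assumes eu: "intv e" "intv u" "bl e e = 0" "bl e u = 0"
  shows "E e u \<in> tilde_Gamma_S n S"
proof -
  define A where "A = mat (n + 4) (n + 4) (\<lambda>(i, k). u $ i * e $ k - (u $ k + qf u * e $ k) * e $ i)"
  have AM: "A \<in> M" by (simp add: A_def)
  have "intm A" using eu qf_int[OF eu(2)] by (auto simp: A_def intm_def intv_def)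
  moreover have "E e u = 1\<^sub>m (n + 4) + A * Q"
  proof (rule eq_matI)
    fix i j assume "i < dim_row (1\<^sub>m (n + 4) + A * Q)" "j < dim_col (1\<^sub>m (n + 4) + A * Q)"
    then have ij: "i < n + 4" "j < n + 4" using AM dim_S1 by auto
    let ?u = "unit_vec (n + 4) j :: real vec"
    have "(A * Q) $$ (i, j) = (\<Sum>k\<in>{0..<n+4}. A $$ (i, k) * Q $$ (k, j))"
      using AM Q_carrier ij by (simp add: scalar_prod_def)
    also have "\<dots> = (\<Sum>k\<in>{0..<n+4}. u $ i * (e $ k * Q $$ (k, j)) - e $ i * (u $ k * Q $$ (k, j))
        - qf u * e $ i * (e $ k * Q $$ (k, j)))"
      using ij by (intro sum.cong refl) (simp add: A_def algebra_simps)
    also have "\<dots> = u $ i * bl e ?u - e $ i * bl u ?u - qf u * e $ i * bl e ?u"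
      using eu ij by (simp only: bl_unit_sum intv_carrier sum_subtractf sum_distrib_left)
    finally have "(A * Q) $$ (i, j) = u $ i * bl e ?u - e $ i * bl u ?u - qf u * e $ i * bl e ?u" .
    moreover have "(1\<^sub>m (n + 4) + A * Q) $$ (i, j) = (if i = j then 1 else 0) + (A * Q) $$ (i, j)"
      using AM Q_carrier ij by simp
    ultimately show "E e u $$ (i, j) = (1\<^sub>m (n + 4) + A * Q) $$ (i, j)"
      using ij by (simp add: E_def algebra_simps)
  qed (use AM dim_S1 in \<open>auto simp: E_def\<close>)
  moreover have "E e u \<in> SOp" using eu by (intro E_SO_plus) auto
  ultimately show ?thesis unfolding tilde_iff by blast
qed

end

section \<open>Maximality of the lattice\<close>

context split_lattice
begin

abbreviation "Qr \<equiv> map_mat rat_of_int (S1 S)"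

lemma of_rat_form:
  assumes x: "x \<in> carrier_vec (n + 4)"
  shows "of_rat (x \<bullet> (Qr *\<^sub>v x)) = bl (map_vec of_rat x) (map_vec of_rat x)"
proof -
  have "bl (map_vec of_rat x) (map_vec of_rat x) = map_vec of_rat x \<bullet> (Q *\<^sub>v map_vec of_rat x)"
    using x by (intro bl_mat[symmetric]) auto
  also have "\<dots> = (\<Sum>i\<in>{0..<n+4}. of_rat (x $ i) * (\<Sum>j\<in>{0..<n+4}. real_of_int (S1 S $$ (i, j)) * of_rat (x $ j)))"
    using x dim_S1 by (simp add: scalar_prod_def)
  also have "\<dots> = of_rat (x \<bullet> (Qr *\<^sub>v x))"
    using x dim_S1 by (simp add: scalar_prod_def of_rat_sum of_rat_mult)
  finally show ?thesis by simp
qed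

text \<open>If the coordinate of \<open>u\<close> at \<open>i\<close> is 1, then adjoining \<open>u / p\<close> to the integral lattice amounts to
  replacing the \<open>i\<close>-th basis vector by \<open>u / p\<close>.\<close>

lemma adjoin_lattice:
  fixes U :: "nat \<Rightarrow> int" and p :: int
  assumes i: "i < n + 4" "U i = 1" and p: "p > 1"
    and int1: "\<And>l. intv l \<Longrightarrow> bl (vec (n + 4) (\<lambda>a. real_of_int (U a))) l / p \<in> \<int>"
    and int2: "qf (vec (n + 4) (\<lambda>a. real_of_int (U a))) / (real_of_int p)\<^sup>2 \<in> \<int>"
  shows "\<exists>L. even_lattice (n + 4) Qr L \<and> int_lattice (n + 4) \<subset> L"
proof -
  let ?m = "n + 4"
  define B where "B = mat ?m ?m (\<lambda>(a, b). if b = i then rat_of_int (U a) / of_int p else if a = b then 1 else 0)"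
  \<comment> \<open>The inverse of \<open>B\<close>; it takes this form because the coordinate of
    \<open>U\<close> at \<open>i\<close> is 1.\<close>
  define B' where "B' = mat ?m ?m (\<lambda>(a, b). if b = i then if a = i then rat_of_int p else - of_int (U a)
      else if a = b then 1 else 0)"
  have BM: "B \<in> carrier_mat ?m ?m" "B' \<in> carrier_mat ?m ?m" by (simp_all add: B_def B'_def)
  have split: "(\<Sum>b\<in>{0..<?m}. (if b = i then f b else if a = b then 1 else 0) * z b) =
      f i * z i + (if a = i then 0 else z a)" if "a < ?m" for a and f z :: "nat \<Rightarrow> rat"
  proof -
    have "(\<Sum>b\<in>{0..<?m}. (if b = i then f b else if a = b then 1 else 0) * z b) =
        f i * z i + (\<Sum>b\<in>{0..<?m} - {i}. (if b = i then f b else if a = b then 1 else 0) * z b)"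
      using i(1) by (subst sum.remove[of _ i]) auto
    also have "(\<Sum>b\<in>{0..<?m} - {i}. (if b = i then f b else if a = b then 1 else 0) * z b) =
        (\<Sum>b\<in>{0..<?m} - {i}. if a = b then z b else 0)"
      by (intro sum.cong) auto
    also have "\<dots> = (if a = i then 0 else z a)" using that by simp
    finally show ?thesis .
  qed
  have Bz: "(B *\<^sub>v z) $ a = (if a = i then z $ i / of_int p else z $ a + z $ i * of_int (U a) / of_int p)"
    if "z \<in> carrier_vec ?m" "a < ?m" for z a
    using that split[OF that(2), of "\<lambda>_. rat_of_int (U a) / of_int p" "\<lambda>b. z $ b"] i
    by (simp add: B_def scalar_prod_def algebra_simps)
  have B'z: "(B' *\<^sub>v z) $ a = (if a = i then of_int p * z $ i else z $ a - z $ i * of_int (U a))"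
    if "z \<in> carrier_vec ?m" "a < ?m" for z a
    using that split[OF that(2), of "\<lambda>_. if a = i then rat_of_int p else - of_int (U a)" "\<lambda>b. z $ b"] i
    by (simp add: B'_def scalar_prod_def algebra_simps)
  have p0: "rat_of_int p \<noteq> 0" using p by simp
  have BB': "B *\<^sub>v (B' *\<^sub>v z) = z" "B' *\<^sub>v (B *\<^sub>v z) = z" if z: "z \<in> carrier_vec ?m" for z
  proof -
    have V: "B *\<^sub>v z \<in> carrier_vec ?m" "B' *\<^sub>v z \<in> carrier_vec ?m" using BM z by auto
    show "B *\<^sub>v (B' *\<^sub>v z) = z"
    proof (rule eq_vecI)
      fix a assume "a < dim_vec z"
      then have a: "a < ?m" using z by simp
      show "(B *\<^sub>v (B' *\<^sub>v z)) $ a = z $ a"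
        using Bz[OF V(2) a] B'z[OF z a] B'z[OF z i(1)] p0 by simp
    qed (use BM z in auto)
    show "B' *\<^sub>v (B *\<^sub>v z) = z"
    proof (rule eq_vecI)
      fix a assume "a < dim_vec z"
      then have a: "a < ?m" using z by simp
      show "(B' *\<^sub>v (B *\<^sub>v z)) $ a = z $ a"
        using B'z[OF V(1) a] Bz[OF z a] Bz[OF z i(1)] p0 by simp
    qed (use BM z in auto)
  qed
  have "B * B' = 1\<^sub>m ?m"
  proof (rule mat_eq_if_mult_vec_eq[where m="?m" and k="?m"])
    fix z :: "rat vec" assume "z \<in> carrier_vec ?m"
    then show "B * B' *\<^sub>v z = 1\<^sub>m ?m *\<^sub>v z" using BB' assoc_mult_mat_vec[OF BM] by simp
  qed (use BM in auto)
  moreover have "B' * B = 1\<^sub>m ?m"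
  proof (rule mat_eq_if_mult_vec_eq[where m="?m" and k="?m"])
    fix z :: "rat vec" assume "z \<in> carrier_vec ?m"
    then show "B' * B *\<^sub>v z = 1\<^sub>m ?m *\<^sub>v z" using BB' assoc_mult_mat_vec[OF BM(2,1)] by simp
  qed (use BM in auto)
  ultimately have inv: "invertible_mat B" unfolding invertible_mat_def inverts_mat_def using BM by auto
  define L where "L = {B *\<^sub>v map_vec rat_of_int v | v. v \<in> carrier_vec ?m}"
  have lat: "is_lattice ?m L" unfolding is_lattice_def L_def using BM inv by blast
  define ur where "ur = vec ?m (\<lambda>a. real_of_int (U a))"
  have ur: "ur \<in> V" by (simp add: ur_def)
  have "\<exists>k::int. x \<bullet> (Qr *\<^sub>v x) = rat_of_int (2 * k)" if "x \<in> L" for x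
  proof -
    obtain v where v: "v \<in> carrier_vec ?m" "x = B *\<^sub>v map_vec rat_of_int v" using \<open>x \<in> L\<close> L_def by auto
    have xV: "x \<in> carrier_vec ?m" using BM v by auto
    \<comment> \<open>An element of \<open>L\<close> is split into an integral vector without
      \<open>i\<close>-th coordinate and a multiple of \<open>u / p\<close>.\<close>
    define y where "y = vec ?m (\<lambda>a. if a = i then 0 else real_of_int (v $ a))"
    have y: "intv y" "y \<in> V" by (simp_all add: y_def intv_def)
    define c where "c = real_of_int (v $ i) / of_int p"
    have xr: "map_vec of_rat x = y + c \<cdot>\<^sub>v ur"
    proof (rule eq_vecI)
      fix a assume "a < dim_vec (y + c \<cdot>\<^sub>v ur)"
      then have a: "a < ?m" using ur by simp
      have "map_vec real_of_rat x $ a = of_rat (x $ a)" using a xV by simp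
      also have "x $ a = (if a = i then of_int (v $ i) / of_int p
          else of_int (v $ a) + of_int (v $ i) * of_int (U a) / of_int p)"
        using a i v Bz[of "map_vec rat_of_int v" a] by simp
      finally show "map_vec of_rat x $ a = (y + c \<cdot>\<^sub>v ur) $ a"
        using a i by (simp add: y_def ur_def c_def of_rat_add of_rat_mult of_rat_divide)
    qed (use xV ur in simp)
    have "bl (y + c \<cdot>\<^sub>v ur) (y + c \<cdot>\<^sub>v ur) = 2 * (qf y + real_of_int (v $ i) * (bl ur y / p)
        + (real_of_int (v $ i))\<^sup>2 * (qf ur / (real_of_int p)\<^sup>2))"
      using y(2) ur p by (simp add: bl_lin c_def qf_def bl_commute[of y ur] power2_eq_square field_simps)
    moreover have "qf y + real_of_int (v $ i) * (bl ur y / p) + (real_of_int (v $ i))\<^sup>2 * (qf ur / (real_of_int p)\<^sup>2) \<in> \<int>"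
      using int1[OF y(1)] int2 qf_int[OF y(1)] unfolding ur_def by (intro Ints_add Ints_mult Ints_power) auto
    ultimately obtain k :: int where "bl (y + c \<cdot>\<^sub>v ur) (y + c \<cdot>\<^sub>v ur) = 2 * real_of_int k"
      by (metis Ints_cases)
    then have "real_of_rat (x \<bullet> (Qr *\<^sub>v x)) = real_of_int (2 * k)"
      using of_rat_form[OF xV] xr by simp
    then have "real_of_rat (x \<bullet> (Qr *\<^sub>v x)) = real_of_rat (rat_of_int (2 * k))"
      by (simp only: of_rat_of_int_eq)
    then have "x \<bullet> (Qr *\<^sub>v x) = rat_of_int (2 * k)" by (simp only: of_rat_eq_iff)
    then show ?thesis by (rule exI)
  qed
  then have even: "even_lattice ?m Qr L" unfolding even_lattice_def using lat by blast
  have "int_lattice ?m \<subseteq> L"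
  proof
    fix x assume "x \<in> int_lattice ?m"
    then obtain v where v: "v \<in> carrier_vec ?m" "x = map_vec rat_of_int v" by (auto simp: int_lattice_def)
    define w where "w = vec ?m (\<lambda>a. if a = i then p * v $ i else v $ a - v $ i * U a)"
    have "B' *\<^sub>v x = map_vec rat_of_int w"
    proof (rule eq_vecI)
      fix a assume "a < dim_vec (map_vec rat_of_int w)"
      then have "a < ?m" by (simp add: w_def)
      then show "(B' *\<^sub>v x) $ a = map_vec rat_of_int w $ a"
        using B'z[of x a] v i by (simp add: w_def)
    qed (use BM in \<open>simp add: w_def\<close>)
    then have "x = B *\<^sub>v map_vec rat_of_int w" using BB'(1)[of x] v by simp
    then show "x \<in> L" unfolding L_def by (auto simp: w_def)
  qed
  moreover have "L \<noteq> int_lattice ?m"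
  proof
    assume eq: "L = int_lattice ?m"
    \<comment> \<open>The adjoined vector has \<open>i\<close>-th coordinate \<open>1 / p\<close>,
      which is not an integer.\<close>
    have "B *\<^sub>v map_vec rat_of_int (unit_vec ?m i) \<in> L" unfolding L_def by auto
    then obtain v where v: "v \<in> carrier_vec ?m" "B *\<^sub>v map_vec rat_of_int (unit_vec ?m i) = map_vec rat_of_int v"
      unfolding eq int_lattice_def by auto
    have "(B *\<^sub>v map_vec rat_of_int (unit_vec ?m i)) $ i = 1 / of_int p"
      using Bz[of "map_vec rat_of_int (unit_vec ?m i)" i] i by simp
    then have "1 / rat_of_int p = of_int (v $ i)" using v i by simp
    then have "rat_of_int 1 = rat_of_int (p * v $ i)" using p0 by (simp add: field_simps)
    then have "1 = p * v $ i" by (simp only: of_int_eq_iff)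
    then have "p dvd 1" by (rule dvdI)
    then show False using p by simp
  qed
  ultimately show ?thesis using even by blast
qed

text \<open>Prime factors \<open>p\<close> of \<open>a\<close> are removed one by one. If
  \<open>p\<close> divides all coordinates of \<open>W\<close>, both are divided by
  \<open>p\<close>; otherwise a multiple of \<open>W / p\<close> could be adjoined to the lattice,
  against maximality.\<close>

lemma maximal_dvd:
  fixes W :: "nat \<Rightarrow> int" and a :: int
  assumes max: "maximal_even_lattice (n + 4) Qr (int_lattice (n + 4))" and a: "a \<noteq> 0"
    and int1: "\<And>l. intv l \<Longrightarrow> bl (vec (n + 4) (\<lambda>i. real_of_int (W i))) l / a \<in> \<int>"
    and int2: "qf (vec (n + 4) (\<lambda>i. real_of_int (W i))) / (real_of_int a)\<^sup>2 \<in> \<int>"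
    and i: "i < n + 4"
  shows "a dvd W i"
  using a int1 int2
proof (induction "nat \<bar>a\<bar>" arbitrary: a W rule: less_induct)
  case less
  let ?w = "\<lambda>W. vec (n + 4) (\<lambda>i. real_of_int (W i)) :: real vec"
  show ?case
  proof (cases "\<bar>a\<bar> = 1")
    case True then show ?thesis by (metis abs_dvd_iff one_dvd)
  next
    case False
    then have "\<bar>a\<bar> \<noteq> 1 \<and> a \<noteq> 0" using less.prems by simp
    then obtain p where p: "prime p" "p dvd a" using prime_factor_int by blast
    obtain a' where a': "a = p * a'" using p(2) by auto
    have p1: "p > 1" using p(1) by (simp add: prime_gt_1_int)
    have a'0: "a' \<noteq> 0" using less.prems a' by auto
    show ?thesis
    proof (cases "\<forall>j<n+4. p dvd W j")
      case True
      define W' where "W' j = W j div p" for j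
      have WW: "W j = p * W' j" if "j < n + 4" for j using True that by (simp add: W'_def)
      have w: "?w W = real_of_int p \<cdot>\<^sub>v ?w W'" by (intro eq_vecI) (simp_all add: WW)
      have V: "?w W' \<in> V" by simp
      have "a' dvd W' i"
      proof (rule less.hyps)
        have "\<bar>a'\<bar> * 1 < \<bar>a'\<bar> * \<bar>p\<bar>" using p1 a'0 by (intro mult_strict_left_mono) auto
        then show "nat \<bar>a'\<bar> < nat \<bar>a\<bar>" unfolding a' by (simp add: abs_mult mult.commute)
        show "bl (?w W') l / a' \<in> \<int>" if "intv l" for l
          using less.prems(2)[OF that] p1 unfolding w a' by (simp add: bl_lin)
        have "qf (?w W) = (real_of_int p)\<^sup>2 * qf (?w W')" unfolding w qf_def by (simp add: bl_lin power2_eq_square)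
        then show "qf (?w W') / (real_of_int a')\<^sup>2 \<in> \<int>"
          using less.prems(3) p1 unfolding a' by (simp add: power_mult_distrib)
      qed (rule a'0)
      then show ?thesis using WW[OF i] a' by simp
    next
      case False
      then obtain j where j: "j < n + 4" "\<not> p dvd W j" by blast
      have "coprime (W j) p" using p(1) j(2) prime_imp_coprime by (metis coprime_commute)
      then obtain k t where kt: "k * W j + t * p = 1" by (metis bezout_int coprime_imp_gcd_eq_1)
      \<comment> \<open>By Bezout, \<open>U\<close> is \<open>k W\<close> plus a multiple of
        \<open>p\<close> times the \<open>j\<close>-th unit vector. So \<open>U / p\<close> and
        \<open>k W / p\<close> agree modulo the lattice, and the coordinate of \<open>U\<close> at
        \<open>j\<close> is 1 as \<open>adjoin_lattice\<close> requires.\<close>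
      define U where "U b = (if b = j then 1 else k * W b)" for b
      have u: "?w U = real_of_int k \<cdot>\<^sub>v ?w W + real_of_int (t * p) \<cdot>\<^sub>v unit_vec (n + 4) j"
      proof (rule eq_vecI)
        fix b assume "b < dim_vec (real_of_int k \<cdot>\<^sub>v ?w W + real_of_int (t * p) \<cdot>\<^sub>v unit_vec (n + 4) j)"
        then have b: "b < n + 4" by simp
        have "real_of_int k * real_of_int (W j) + real_of_int t * real_of_int p = 1"
          using arg_cong[OF kt, of real_of_int] by simp
        then show "?w U $ b = (real_of_int k \<cdot>\<^sub>v ?w W + real_of_int (t * p) \<cdot>\<^sub>v unit_vec (n + 4) j) $ b"
          using b j by (simp add: U_def)
      qed simp
      let ?u = "unit_vec (n + 4) j :: real vec"
      have uI: "intv ?u" by (rule intv_unit)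
      have Wp: "bl (?w W) l / p \<in> \<int>" if "intv l" for l
      proof -
        have "bl (?w W) l / p = real_of_int a' * (bl (?w W) l / a)" using a'0 p1 by (simp add: a')
        also have "\<dots> \<in> \<int>" using less.prems(2)[OF that] by (intro Ints_mult) auto
        finally show ?thesis .
      qed
      have "\<exists>L. even_lattice (n + 4) Qr L \<and> int_lattice (n + 4) \<subset> L"
      proof (rule adjoin_lattice[of j U p])
        show "bl (?w U) l / p \<in> \<int>" if l: "intv l" for l
        proof -
          have "bl (?w U) l / p = real_of_int k * (bl (?w W) l / p) + real_of_int t * bl ?u l"
            unfolding u using p1 by (simp add: bl_lin field_simps)
          also have "\<dots> \<in> \<int>" using Wp[OF l] bl_int[OF uI l] by (intro Ints_add Ints_mult) auto
          finally show ?thesis .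
        qed
        have "qf (?w U) / (real_of_int p)\<^sup>2 = (real_of_int k)\<^sup>2 * (real_of_int a')\<^sup>2 * (qf (?w W) / (real_of_int a)\<^sup>2)
            + real_of_int k * real_of_int t * (bl (?w W) ?u / p) + (real_of_int t)\<^sup>2 * qf ?u"
          unfolding u using p1 a'0
          by (simp add: qf_def bl_lin bl_commute[of ?u "?w W"] a' power2_eq_square field_simps)
        also have "\<dots> \<in> \<int>"
          using less.prems(3) Wp[OF uI] qf_int[OF uI] by (intro Ints_add Ints_mult Ints_power) auto
        finally show "qf (?w U) / (real_of_int p)\<^sup>2 \<in> \<int>" .
      qed (use j p1 U_def in auto)
      then show ?thesis using max unfolding maximal_even_lattice_def by blast
    qed
  qed
qed

lemma eichler_group_tilde:
  assumes max: "maximal_even_lattice (n + 4) Qr (int_lattice (n + 4))"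
  shows "eichler_group n S (tilde_Gamma_S n S)"
proof unfold_locales
  have TS: "g \<in> SOp" "intm g" if "g \<in> tilde_Gamma_S n S" for g
    using that tilde_Gamma Gamma_S_iff by auto
  show "isom g" if "g \<in> tilde_Gamma_S n S" for g using SOp_isom TS that by blast
  show "intv (g *\<^sub>v x)" if "g \<in> tilde_Gamma_S n S" "intv x" for g x using TS that intm_intv by blast
  show "\<exists>h\<in>tilde_Gamma_S n S. g * h = 1\<^sub>m (n + 4) \<and> h * g = 1\<^sub>m (n + 4)" if "g \<in> tilde_Gamma_S n S" for g
    using tilde_adj[OF that] SOp_adj TS(1)[OF that] by blast
  fix w a assume w: "intv w" and a: "(a::real) \<in> \<int>" "a \<noteq> 0" and int1: "\<And>l. intv l \<Longrightarrow> bl w l / a \<in> \<int>"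
    and int2: "qf w / a\<^sup>2 \<in> \<int>"
  obtain A where A: "a = real_of_int A" using a by (auto elim: Ints_cases)
  define W where "W i = \<lfloor>w $ i\<rfloor>" for i
  have wW: "w = vec (n + 4) (\<lambda>i. real_of_int (W i))"
    using w by (intro eq_vecI) (auto simp: W_def intv_def elim!: Ints_cases)
  have "A dvd W i" if "i < n + 4" for i
    using int1 int2 a(2) that unfolding wW A by (intro maximal_dvd[OF max]) auto
  then have "real_of_int (W i) / real_of_int A \<in> \<int>" if "i < n + 4" for i
    using that by (metis Ints_of_int dvd_def of_int_mult nonzero_mult_div_cancel_left a(2) A)
  then show "intv ((1 / a) \<cdot>\<^sub>v w)" unfolding wW A by (auto simp: intv_def)
qed (use tilde_mult E_tilde in auto)

section \<open>Overgroups and the normalizer\<close>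

lemma overgroup_subset_Gamma_S:
  assumes max: "maximal_even_lattice (n + 4) Qr (int_lattice (n + 4))"
    and D: "discrete_subgroup (n + 4) (G_S n S) D" and H: "subgroup H (G_S n S)"
    and TH: "tilde_Gamma_S n S \<subseteq> H"
    and conj: "\<And>g t. g \<in> H \<Longrightarrow> t \<in> tilde_Gamma_S n S \<Longrightarrow> g * t * adj_mat g \<in> D"
  shows "H \<subseteq> Gamma_S n S"
proof -
  interpret eichler_group n S "tilde_Gamma_S n S" by (rule eichler_group_tilde[OF max])
  have sub: "X \<subseteq> SOp \<and> (\<forall>g\<in>X. \<forall>h\<in>X. g * h \<in> X) \<and> (\<forall>g\<in>X. adj_mat g \<in> X)" if "subgroup X (G_S n S)" for X
  proof -
    have "X \<subseteq> SOp" using subgroup.subset[OF that] by (simp add: SO_plus_group_def)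
    then show ?thesis
      using subgroup.m_closed[OF that] subgroup.m_inv_closed[OF that] SO_plus_inv
      by (auto simp: SO_plus_group_def subset_eq)
  qed
  have Ds: "subgroup D (G_S n S)" "subtopology (mat_topology (n + 4)) D = discrete_topology D"
    using D by (auto simp: discrete_subgroup_def)
  note DD = sub[OF Ds(1)] and HH = sub[OF H]
  interpret normalizing_group n S "tilde_Gamma_S n S" D H
  proof unfold_locales
    show "isom g" if "g \<in> D" for g using DD SOp_isom that by blast
    show "isom g" if "g \<in> H" for g using HH SOp_isom that by blast
    show "\<exists>h\<in>D. g * h = 1\<^sub>m (n + 4) \<and> h * g = 1\<^sub>m (n + 4)" if "g \<in> D" for g
      using DD SOp_adj that by blast
    show "\<exists>h\<in>H. g * h = 1\<^sub>m (n + 4) \<and> h * g = 1\<^sub>m (n + 4)" if "g \<in> H" for g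
      using HH SOp_adj that by blast
    show "\<exists>\<epsilon>>0. \<forall>h\<in>D. (\<forall>i<n+4. \<forall>j<n+4. \<bar>h $$ (i, j) - g $$ (i, j)\<bar> < \<epsilon>) \<longrightarrow> h = g" if "g \<in> D" for g
      using discrete_mat_topologyD[OF Ds(2) that] .
    show "g * t * h \<in> D" if gh: "g \<in> H" "h \<in> H" "g * h = 1\<^sub>m (n + 4)" and t: "t \<in> tilde_Gamma_S n S" for g h t
    proof -
      have g: "g \<in> SOp" "h \<in> SOp" using HH gh by auto
      have "adj_mat g = h"
        using inverse_unique[OF SOp_carrier[OF SO_plus_adj[OF g(1)]] SOp_carrier[OF g(1)] SOp_carrier[OF g(2)]]
          SOp_adj(2)[OF g(1)] gh(3) by blast
      then show ?thesis using conj[OF gh(1) t] by simp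
    qed
    \<comment> \<open>This is the conjugation hypothesis at the identity of
      \<open>H\<close>.\<close>
    show "tilde_Gamma_S n S \<subseteq> D"
    proof
      fix t assume t: "t \<in> tilde_Gamma_S n S"
      have "1\<^sub>m (n + 4) \<in> H" using subgroup.one_closed[OF H] by (simp add: SO_plus_group_def)
      moreover have "adj_mat (1\<^sub>m (n + 4)) = (1\<^sub>m (n + 4) :: real mat)"
        using SOp_adj(1)[OF one_SO_plus] SOp_carrier[OF SO_plus_adj[OF one_SO_plus]] by simp
      moreover have "t \<in> M" using T_isom[OF t] isom_carrier by blast
      ultimately show "t \<in> D" using conj[of "1\<^sub>m (n + 4)" t] t by simp
    qed
  qed (use DD HH TH in auto)
  show ?thesis
  proof
    fix g assume g: "g \<in> H"
    have gM: "g \<in> M" by (rule H_carrier[OF g])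
    have "g $$ (i, j) \<in> \<int>" if "i < n + 4" "j < n + 4" for i j
    proof -
      have "(g *\<^sub>v unit_vec (n + 4) j) $ i \<in> \<int>" using image_integral[OF g that(2)] that(1) by (simp add: intv_def)
      then show ?thesis using gM that by simp
    qed
    then show "g \<in> Gamma_S n S" unfolding Gamma_S_iff intm_def using g HH gM by blast
  qed
qed

lemma normalizer_tilde_iff:
  "g \<in> normalizer (G_S n S) (tilde_Gamma_S n S) \<longleftrightarrow>
     g \<in> SOp \<and> (\<lambda>t. g * t * adj_mat g) ` tilde_Gamma_S n S = tilde_Gamma_S n S"
proof -
  have T: "tilde_Gamma_S n S \<subseteq> carrier (G_S n S)"
    using tilde_Gamma Gamma_S_iff by (auto simp: SO_plus_group_def)
  have "g <#\<^bsub>G_S n S\<^esub> tilde_Gamma_S n S #>\<^bsub>G_S n S\<^esub> (inv\<^bsub>G_S n S\<^esub> g) =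
      (\<lambda>t. g * t * adj_mat g) ` tilde_Gamma_S n S" if "g \<in> SOp"
    unfolding l_coset_def r_coset_def SO_plus_inv[OF that] by (auto simp: SO_plus_group_def)
  then show ?thesis
    unfolding normalizer_def stabilizer_def using T by (auto simp: SO_plus_group_def)
qed

text \<open>The normalizer is a stabilizer of a set under conjugation, so equality of the conjugated
  set is required. The reverse inclusion comes from conjugating by the inverse.\<close>

lemma Gamma_S_normalizes: "Gamma_S n S \<subseteq> normalizer (G_S n S) (tilde_Gamma_S n S)"
proof
  fix g assume g: "g \<in> Gamma_S n S"
  define h where "h = adj_mat g"
  have gS: "g \<in> SOp" using g Gamma_S_iff by blast
  have h: "h \<in> Gamma_S n S" "h \<in> SOp" unfolding h_def using Gamma_S_adj[OF g] Gamma_S_iff by auto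
  have MM: "g \<in> M" "h \<in> M" "adj_mat h \<in> M" using SOp_carrier gS h SO_plus_adj by auto
  have gh: "g * h = 1\<^sub>m (n + 4)" "h * g = 1\<^sub>m (n + 4)" using SOp_adj gS by (auto simp: h_def)
  have hg: "adj_mat h = g" using inverse_unique[OF MM(3,2,1) SOp_adj(2)[OF h(2)] gh(2)] .
  note assoc = assoc_mult_mat[where n\<^sub>1="n+4" and n\<^sub>2="n+4" and n\<^sub>3="n+4" and n\<^sub>4="n+4"]
  have "(\<lambda>t. g * t * h) ` tilde_Gamma_S n S = tilde_Gamma_S n S"
  proof
    show "(\<lambda>t. g * t * h) ` tilde_Gamma_S n S \<subseteq> tilde_Gamma_S n S"
      using tilde_conj[OF g] by (auto simp: h_def)
    show "tilde_Gamma_S n S \<subseteq> (\<lambda>t. g * t * h) ` tilde_Gamma_S n S"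
    proof
      fix t assume t: "t \<in> tilde_Gamma_S n S"
      have tM: "t \<in> M" using t tilde_Gamma Gamma_S_iff by auto
      have "g * (h * t * g) * h = (g * h) * t * (g * h)" using MM tM by (simp add: assoc)
      also have "\<dots> = t" using tM by (simp add: gh)
      finally have "t = g * (h * t * g) * h" by simp
      moreover have "h * t * g \<in> tilde_Gamma_S n S" using tilde_conj[OF h(1) t] by (simp add: hg)
      ultimately show "t \<in> (\<lambda>t. g * t * h) ` tilde_Gamma_S n S" by (rule image_eqI)
    qed
  qed
  then show "g \<in> normalizer (G_S n S) (tilde_Gamma_S n S)"
    unfolding normalizer_tilde_iff using gS by (simp add: h_def)
qed

end

theorem theorem3:
  fixes n :: nat and S :: "int mat"
  assumes "S \<in> carrier_mat n n"
    and "even_mat S"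
    and "pos_def_mat n (map_mat real_of_int S)"
    and "maximal_even_lattice (n + 4) (map_mat rat_of_int (S1 S)) (int_lattice (n + 4))"
  shows "discrete_subgroup (n + 4) (G_S n S) (Gamma_S n S)
       \<and> tilde_Gamma_S n S \<subseteq> Gamma_S n S
       \<and> (\<forall>\<Delta>. discrete_subgroup (n + 4) (G_S n S) \<Delta> \<and> tilde_Gamma_S n S \<subseteq> \<Delta>
              \<longrightarrow> \<Delta> \<subseteq> Gamma_S n S)
       \<and> Gamma_S n S = normalizer (G_S n S) (tilde_Gamma_S n S)"
proof -
  interpret split_lattice n S by (rule split_lattice.intro) (fact assms)+
  interpret G: group "G_S n S" by (rule SO_plus_group)
  let ?N = "normalizer (G_S n S) (tilde_Gamma_S n S)"
  have T: "tilde_Gamma_S n S \<subseteq> carrier (G_S n S)"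
    using tilde_Gamma Gamma_S_iff by (auto simp: SO_plus_group_def)
  have "\<Delta> \<subseteq> Gamma_S n S" if \<Delta>: "discrete_subgroup (n + 4) (G_S n S) \<Delta>" "tilde_Gamma_S n S \<subseteq> \<Delta>" for \<Delta>
  proof (rule overgroup_subset_Gamma_S[OF assms(4) \<Delta>(1) _ \<Delta>(2)])
    show sub: "subgroup \<Delta> (G_S n S)" using \<Delta> by (simp add: discrete_subgroup_def)
    fix g t assume g: "g \<in> \<Delta>" and t: "t \<in> tilde_Gamma_S n S"
    have "g \<in> SOp" using subgroup.subset[OF sub] g by (auto simp: SO_plus_group_def)
    then have "adj_mat g \<in> \<Delta>" using subgroup.m_inv_closed[OF sub g] SO_plus_inv by simp
    then show "g * t * adj_mat g \<in> \<Delta>"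
      using subgroup.m_closed[OF sub] g t \<Delta>(2) by (auto simp: SO_plus_group_def)
  qed
  moreover have "?N \<subseteq> Gamma_S n S"
  proof (rule overgroup_subset_Gamma_S[OF assms(4) Gamma_S_discrete G.normalizer_imp_subgroup[OF T]])
    show "tilde_Gamma_S n S \<subseteq> ?N" using tilde_Gamma Gamma_S_normalizes by blast
    show "g * t * adj_mat g \<in> Gamma_S n S" if "g \<in> ?N" "t \<in> tilde_Gamma_S n S" for g t
      using that tilde_Gamma unfolding normalizer_tilde_iff by blast
  qed
  ultimately show ?thesis using Gamma_S_discrete tilde_Gamma Gamma_S_normalizes by blast
qed

end
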